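(* Let $f$ be a transcendental meromorphic function in $\mathbb{C}$ with a direct tract $D$, and suppose $f$ has a Baker wandering domain $U$. Then: (a) $\overline{U}\subset A(f,D)$; more precisely, there exist $N\in\mathbb{N}$ and $\rho>0$ such that, for $n\ge N$, $U_n\subset\widetilde{U_{n+1}}$ and $\overline{U_n}\subset A(f,D,\rho)$; (b) $\overline{U_n}\subset D$ for $n\ge N$, so $D$ is the only direct tract of $f$ and it has no unbounded complementary components; (c) $A(f,D)\cap J(f)$ contains infinitely many bounded continua; (d) $A(f,D)$ has exactly one unbounded component, as do $Z(f)$ and $I(f)$.
   Context: $F(f)$, $J(f)$: Fatou and Julia sets; $I(f)$: points whose iterates are defined and tend to $\infty$; $Z(f)=\{z\in I(f):\frac1n\log\log|f^n(z)|\to\infty\}$. For a Fatou component $U$, $U_n$ is the Fatou component containing $f^n(U)$. A Baker wandering domain is a Fatou component $U$ with $U_m\ne U_n$ for $m\ne n$ such that for all large $n$, $U_n$ is a bounded multiply connected Fatou component surrounding $0$ and $U_n\to\infty$. For a set $V$, $\widetilde V$ is the union of $V$ and its bounded complementary components. A direct tract of $f$: an unbounded domain $D$ with piecewise smooth boundary curves and unbounded complement, $f$ holomorphic in $D$, continuous on $\overline D$, with $R>0$ such that $|f|=R$ on $\partial D$, $|f|>R$ in $D$. $M_D(r)=\max_{|z|=r,z\in D}|f(z)|$, $M^n_D$ its iterates; $A(f,D,\rho)=\{z\in D: f^n(z)\in D,\ |f^n(z)|\ge M_D^n(\rho)\ \forall n\in\mathbb{N}\}$; $A(f,D)=\{z:\exists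 L\in\mathbb{N},\ f^L(z)\in A(f,D,\rho)\}$ for a fixed $\rho>\rho_0$, where $\rho_0>R$ is such that $M_D(\rho)>\rho$ for $\rho>\rho_0$ (independent of $\rho$). *)

theory Defs
  imports "HOL-Complex_Analysis.Complex_Analysis" "HOL-Computational_Algebra.Polynomial"
begin

text \<open>Transcendental meromorphic function on the plane: meromorphic in C, holomorphic
  off its poles (so values at removable singularities are the correct ones), and not a
  rational function.\<close>
definition transcendental_meromorphic :: "(complex \<Rightarrow> complex) \<Rightarrow> bool" where
  "transcendental_meromorphic f \<longleftrightarrow>
     f meromorphic_on UNIV \<and> f analytic_on {z. \<not> is_pole f z} \<and>
     \<not> (\<exists>p q :: complex poly. q \<noteq> 0 \<and>
          (\<forall>z. \<not> is_pole f z \<and> poly q z \<noteq> 0 \<longrightarrow> f z = poly p z / poly q z))"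

definition iterates_defined :: "(complex \<Rightarrow> complex) \<Rightarrow> complex \<Rightarrow> bool" where
  "iterates_defined f z \<longleftrightarrow> (\<forall>k. \<not> is_pole f ((f ^^ k) z))"

text \<open>Normal family of holomorphic functions on an open set W: every sequence has a
  subsequence converging locally uniformly on W, or tending to infinity locally
  uniformly on W (normality with respect to the spherical metric).\<close>
definition normal_family :: "complex set \<Rightarrow> (complex \<Rightarrow> complex) set \<Rightarrow> bool" where
  "normal_family W F \<longleftrightarrow>
     (\<forall>g :: nat \<Rightarrow> complex \<Rightarrow> complex. (\<forall>n. g n \<in> F) \<longrightarrow>
        (\<exists>r. strict_mono r \<and>
           ((\<exists>h. \<forall>K. compact K \<and> K \<subseteq> W \<longrightarrow> uniform_limit K (\<lambda>n. g (r n)) h sequentially)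
            \<or> (\<forall>K. compact K \<and> K \<subseteq> W \<longrightarrow>
                 (\<forall>B. eventually (\<lambda>n. \<forall>z\<in>K. B \<le> norm (g (r n) z)) sequentially)))))"

definition fatou :: "(complex \<Rightarrow> complex) \<Rightarrow> complex set" where
  "fatou f = {z. \<exists>W. open W \<and> z \<in> W \<and> (\<forall>w\<in>W. iterates_defined f w) \<and>
                    normal_family W (range (\<lambda>n. f ^^ n))}"

definition julia :: "(complex \<Rightarrow> complex) \<Rightarrow> complex set" where
  "julia f = - fatou f"

definition escaping :: "(complex \<Rightarrow> complex) \<Rightarrow> complex set" where
  "escaping f = {z. iterates_defined f z \<and>
                    filterlim (\<lambda>n. norm ((f ^^ n) z)) at_top sequentially}"

definition Zset :: "(complex \<Rightarrow> complex) \<Rightarrow> complex set" where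
  "Zset f = {z \<in> escaping f.
     filterlim (\<lambda>n. ln (ln (norm ((f ^^ n) z))) / real n) at_top sequentially}"

definition fatou_comp_iter :: "(complex \<Rightarrow> complex) \<Rightarrow> complex set \<Rightarrow> nat \<Rightarrow> complex set" where
  "fatou_comp_iter f U n = (THE V. V \<in> components (fatou f) \<and> (f ^^ n) ` U \<subseteq> V)"

definition fill :: "complex set \<Rightarrow> complex set" where
  "fill V = V \<union> \<Union> {C \<in> components (- V). bounded C}"

definition baker_wandering_domain :: "(complex \<Rightarrow> complex) \<Rightarrow> complex set \<Rightarrow> bool" where
  "baker_wandering_domain f U \<longleftrightarrow>
     U \<in> components (fatou f) \<and>
     (\<forall>m n. m \<noteq> n \<longrightarrow> fatou_comp_iter f U m \<noteq> fatou_comp_iter f U n) \<and>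
     (eventually (\<lambda>n. bounded (fatou_comp_iter f U n) \<and>
                      \<not> simply_connected (fatou_comp_iter f U n) \<and>
                      0 \<in> fill (fatou_comp_iter f U n) - fatou_comp_iter f U n) sequentially) \<and>
     (\<forall>B. eventually (\<lambda>n. \<forall>z \<in> fatou_comp_iter f U n. B \<le> norm z) sequentially)"

text \<open>Direct tract D of f with level R. The boundary consists of piecewise smooth
  curves: it is a locally finite union of piecewise C1 arcs (valid paths).\<close>
definition direct_tract :: "(complex \<Rightarrow> complex) \<Rightarrow> complex set \<Rightarrow> real \<Rightarrow> bool" where
  "direct_tract f D R \<longleftrightarrow>
     open D \<and> connected D \<and> \<not> bounded D \<and> \<not> bounded (- D) \<and>
     (\<exists>g :: nat \<Rightarrow> real \<Rightarrow> complex. (\<forall>i. valid_path (g i)) \<and>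
        frontier D = (\<Union>i. path_image (g i)) \<and>
        (\<forall>K. compact K \<longrightarrow> finite {i. path_image (g i) \<inter> K \<noteq> {}})) \<and>
     f holomorphic_on D \<and> (\<forall>z\<in>closure D. \<not> is_pole f z) \<and> continuous_on (closure D) f \<and>
     R > 0 \<and> (\<forall>z\<in>frontier D. norm (f z) = R) \<and> (\<forall>z\<in>D. norm (f z) > R)"

definition M_D :: "(complex \<Rightarrow> complex) \<Rightarrow> complex set \<Rightarrow> real \<Rightarrow> real" where
  "M_D f D r = Sup {norm (f z) | z. norm z = r \<and> z \<in> D}"

definition A_rho :: "(complex \<Rightarrow> complex) \<Rightarrow> complex set \<Rightarrow> real \<Rightarrow> complex set" where
  "A_rho f D \<rho> = {z \<in> D. \<forall>n::nat. n \<ge> 1 \<longrightarrow>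
       (f ^^ n) z \<in> D \<and> norm ((f ^^ n) z) \<ge> (M_D f D ^^ n) \<rho>}"

definition A_set :: "(complex \<Rightarrow> complex) \<Rightarrow> complex set \<Rightarrow> real \<Rightarrow> complex set" where
  "A_set f D \<rho> = {z. \<exists>L::nat. (f ^^ L) z \<in> A_rho f D \<rho>}"

end

theory Submission
  imports Defs
begin

text \<open>For large \<open>n\<close> the iterates \<open>U n\<close> of the wandering domain lie in the tract \<open>D\<close>, and \<open>f\<close> maps
  \<open>D \<inter> fill (U n)\<close> into \<open>fill (U (n + 1))\<close>; hence the \<open>U n\<close> are nested outwards. Let \<open>r n\<close> be the inradius
  of \<open>fill (U n)\<close>. The values of \<open>f\<close> in \<open>D\<close> inside \<open>|z| < r n\<close> omit a continuum joining a point of modulus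
  \<open>r (n + 1)\<close> to infinity, and a harmonic measure argument gives a Bohr type inequality
  \<open>ln M_D (r n powr (1 - d)) \<le> ln (r (n + 1)) + C / d\<close>. As \<open>ln M_D\<close> grows faster than any multiple of
  \<open>ln\<close>, choosing \<open>d = (ln (r n)) powr (- 1 / 2)\<close> makes the losses summable, so \<open>r (n + k)\<close> dominates the
  iterates \<open>M_D ^^ k\<close>. Points of \<open>D\<close> whose \<open>k\<close>-th iterate stays in \<open>D\<close> outside \<open>fill (U (n + k))\<close> for all \<open>k\<close> are
  therefore fast escaping; these include an unbounded connected set, and each unbounded connected set
  meets all \<open>U n\<close> with \<open>n\<close> large.

  The superpolynomial growth of \<open>M_D\<close> uses that circular means of \<open>ln\<^sup>+ |f / R|\<close> over circles in \<open>D\<close> have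
  integral slopes as functions of \<open>ln |z|\<close>, and that these slopes increase strictly across each
  complementary component of \<open>D\<close>.\<close>

section \<open>A maximum principle\<close>

text \<open>Its place is taken by the topology of preimages. Since \<open>|f| = R\<close> on the
  frontier of \<open>D\<close>, a closed set in \<open>|w| > R\<close> all of whose components are
  unbounded has a preimage in \<open>D\<close> with the same property. For the outside of
  \<open>U (n + 1)\<close> this keeps \<open>f\<close> from mapping points of \<open>D\<close>
  inside \<open>U n\<close> to the outside of \<open>U (n + 1)\<close>; applied repeatedly it
  produces the unbounded connected set of fast escaping points. No annulus inside \<open>U n\<close>
  and no hyperbolic metric enters: the domains act as barriers, and the link between
  \<open>r n\<close> and \<open>r (n + 1)\<close> comes from the filled domain being simply
  connected and missing a point of modulus \<open>r (n + 1)\<close>. Growth of \<open>M_D\<close>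
  faster than every power is used three times: to absorb the loss \<open>C / d\<close>, to make
  \<open>ln M_D (exp x) / x\<close> nondecreasing for large \<open>x\<close>, and to let
  \<open>ln ln |f^n| / n\<close> tend to infinity.\<close>

text \<open>A substitute for subharmonicity: \<open>u\<close> has a harmonic minorant near \<open>z\<close> that touches it at \<open>z\<close>. This
  is stable under sums and maxima and suffices for the maximum principle, without any integrals.\<close>

definition supported_at :: "(complex \<Rightarrow> real) \<Rightarrow> complex \<Rightarrow> bool" where
  "supported_at u z \<longleftrightarrow> (\<exists>e>0. \<exists>h. h holomorphic_on ball z e \<and>
     (\<forall>w\<in>ball z e. Re (h w) \<le> u w) \<and> Re (h z) = u z)"

lemma supported_atI:
  assumes "open S" "z \<in> S" "h holomorphic_on S" "\<And>w. w \<in> S \<Longrightarrow> Re (h w) \<le> u w" "Re (h z) = u z"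
  shows "supported_at u z"
proof -
  obtain e where "e > 0" "ball z e \<subseteq> S"
    using assms(1,2) openE by blast
  then show ?thesis
    unfolding supported_at_def using assms holomorphic_on_subset by (metis subsetD)
qed

lemma supported_at_mono:
  assumes "supported_at u z" "open S" "z \<in> S" "\<And>w. w \<in> S \<Longrightarrow> u w \<le> u' w" "u z = u' z"
  shows "supported_at u' z"
proof -
  obtain e h where e: "e > 0" "h holomorphic_on ball z e"
      "\<And>w. w\<in>ball z e \<Longrightarrow> Re (h w) \<le> u w" "Re (h z) = u z"
    using assms(1) unfolding supported_at_def by auto
  show ?thesis
  proof (rule supported_atI[of "S \<inter> ball z e" _ h])
    show "h holomorphic_on S \<inter> ball z e"
      using e(2) by (rule holomorphic_on_subset) auto
      fix w assume "w \<in> S \<inter> ball z e"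
    then show "Re (h w) \<le> u' w"
      using e(3)[of w] assms(4)[of w] by auto
  qed (use assms e in auto)
qed

lemma supported_at_const: "supported_at (\<lambda>_. c) z"
  by (rule supported_atI[of UNIV _ "\<lambda>_. of_real c"]) auto

lemma supported_at_add:
  assumes "supported_at u z" "supported_at v z"
  shows "supported_at (\<lambda>w. u w + v w) z"
proof -
  obtain e h where e: "e > 0" "h holomorphic_on ball z e"
      "\<And>w. w\<in>ball z e \<Longrightarrow> Re (h w) \<le> u w" "Re (h z) = u z"
    using assms(1) unfolding supported_at_def by auto
  obtain d k where d: "d > 0" "k holomorphic_on ball z d"
      "\<And>w. w\<in>ball z d \<Longrightarrow> Re (k w) \<le> v w" "Re (k z) = v z"
    using assms(2) unfolding supported_at_def by auto
  show ?thesis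
  proof (rule supported_atI[of "ball z e \<inter> ball z d" _ "\<lambda>w. h w + k w"])
    show "(\<lambda>w. h w + k w) holomorphic_on ball z e \<inter> ball z d"
      using holomorphic_on_subset[OF e(2)] holomorphic_on_subset[OF d(2)] by (intro holomorphic_intros) auto
  qed (use e d in \<open>auto intro: add_mono\<close>)
qed

lemma supported_at_cmult:
  assumes "supported_at u z" "c \<ge> 0"
  shows "supported_at (\<lambda>w. c * u w) z"
proof -
  obtain e h where e: "e > 0" "h holomorphic_on ball z e"
      "\<And>w. w\<in>ball z e \<Longrightarrow> Re (h w) \<le> u w" "Re (h z) = u z"
    using assms(1) unfolding supported_at_def by auto
  show ?thesis
    by (rule supported_atI[of "ball z e" _ "\<lambda>w. of_real c * h w"])
       (use e assms(2) in \<open>auto intro!: holomorphic_intros mult_left_mono\<close>)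
qed

lemma supported_at_sum:
  assumes "finite I" "\<And>i. i \<in> I \<Longrightarrow> supported_at (u i) z"
  shows "supported_at (\<lambda>w. \<Sum>i\<in>I. u i w) z"
  using assms by (induction I rule: finite_induct) (auto intro: supported_at_const supported_at_add)

lemma supported_at_max:
  assumes "supported_at u z" "supported_at v z"
  shows "supported_at (\<lambda>w. max (u w) (v w)) z"
proof (cases "u z \<ge> v z")
  case True
  show ?thesis
    by (rule supported_at_mono[OF assms(1), of UNIV]) (use True in auto)
next
  case False
  show ?thesis
    by (rule supported_at_mono[OF assms(2), of UNIV]) (use False in auto)
qed

text \<open>Prepares the finite sums of rotated copies by which circular means are
  approximated.\<close>

lemma supported_at_rotate:
  assumes "supported_at u (z * a)" "norm a = 1"
  shows "supported_at (\<lambda>w. u (w * a)) z"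
proof -
  obtain e h where e: "e > 0" "h holomorphic_on ball (z * a) e"
      "\<And>w. w\<in>ball (z * a) e \<Longrightarrow> Re (h w) \<le> u w" "Re (h (z * a)) = u (z * a)"
    using assms(1) unfolding supported_at_def by auto
  have sub: "w * a \<in> ball (z * a) e" if "w \<in> ball z e" for w
  proof -
    have "dist (z * a) (w * a) = norm ((z - w) * a)"
      by (simp add: dist_norm algebra_simps)
    then show ?thesis
      using that assms(2) by (simp add: norm_mult dist_norm)
  qed
  show ?thesis
  proof (rule supported_atI[of "ball z e" _ "\<lambda>w. h (w * a)"])
    have "(h \<circ> (\<lambda>w. w * a)) holomorphic_on ball z e"
      by (rule holomorphic_on_compose_gen[OF _ e(2)]) (use sub in \<open>auto intro!: holomorphic_intros\<close>)
    then show "(\<lambda>w. h (w * a)) holomorphic_on ball z e"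
      by (simp add: o_def)
  qed (use e sub in auto)
qed

lemma supported_at_Re:
  assumes "open S" "z \<in> S" "h holomorphic_on S"
  shows "supported_at (\<lambda>w. Re (h w)) z"
  using assms by (rule supported_atI) auto

text \<open>Near \<open>z\<close> the function \<open>g\<close> has no zeros, so the term is the
  real part of \<open>c\<close> times a branch of \<open>log g\<close>. The sign of \<open>c\<close>
  is free: logarithms may be subtracted as comparison functions.\<close>

lemma supported_at_ln_norm:
  assumes "open S" "z \<in> S" "g holomorphic_on S" "g z \<noteq> 0"
  shows "supported_at (\<lambda>w. c * ln (norm (g w))) z"
proof -
  obtain d where d: "d > 0" "ball z d \<subseteq> S" "\<And>w. w \<in> ball z d \<Longrightarrow> g w \<noteq> 0"
  proof -
    have "continuous_on S g" using assms holomorphic_on_imp_continuous_on by blast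
    then have "open (S \<inter> g -` (-{0}))"
      by (intro continuous_open_preimage assms) auto
    then obtain d where "d > 0" "ball z d \<subseteq> S \<inter> g -` (-{0})"
      using assms openE[of "S \<inter> g -` (-{0})" z] by auto
    then show thesis using that by blast
  qed
  have "g holomorphic_on ball z d"
    using assms(3) d(2) holomorphic_on_subset by blast
  then obtain k where k: "k holomorphic_on ball z d" "\<And>w. w \<in> ball z d \<Longrightarrow> g w = exp (k w)"
    using contractible_imp_holomorphic_log[of g "ball z d"] d(3) convex_imp_contractible convex_ball
    by metis
  show ?thesis
    by (rule supported_atI[of "ball z d" _ "\<lambda>w. of_real c * k w"])
       (use d k in \<open>auto intro!: holomorphic_intros\<close>)
qed

text \<open>The set \<open>E\<close> where the maximum over the closure is attained is closed. It is
  also open: a harmonic minorant touching \<open>u\<close> at a maximum of \<open>u\<close> has a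
  maximum there too, hence is constant and forces \<open>u\<close> to be constant nearby. A nonempty
  clopen set is the whole plane, but \<open>W\<close> is bounded.\<close>

lemma supported_at_maximum_principle:
  fixes u :: "complex \<Rightarrow> real"
  assumes "open W" "bounded W" and cont: "continuous_on (closure W) u"
    and supp: "\<And>z. z \<in> W \<Longrightarrow> supported_at u z"
    and fr: "\<And>z. z \<in> frontier W \<Longrightarrow> u z \<le> b"
    and "z \<in> W"
  shows "u z \<le> b"
proof (rule ccontr)
  assume nle: "\<not> u z \<le> b"
  have comp: "compact (closure W)"
    using assms(2) by (simp add: compact_eq_bounded_closed bounded_closure)
  obtain x where x: "x \<in> closure W" "\<And>y. y \<in> closure W \<Longrightarrow> u y \<le> u x"
    using continuous_attains_sup[OF comp _ cont] assms(6) closure_subset by blast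
  define E where "E = {y \<in> closure W. u y = u x}"
  have "u x > b"
    using nle x(2)[of z] assms(6) closure_subset by fastforce
  then have EW: "E \<subseteq> W"
    using fr assms(1) by (fastforce simp: E_def frontier_def interior_open)
  have "closed E"
    unfolding E_def using continuous_closed_preimage_constant[OF cont] by simp
  moreover have "open E"
    unfolding open_contains_ball
  proof
    fix y assume y: "y \<in> E"
    then obtain e h where e: "e > 0" "h holomorphic_on ball y e"
        "\<And>w. w\<in>ball y e \<Longrightarrow> Re (h w) \<le> u w" "Re (h y) = u y"
      using supp EW unfolding supported_at_def by blast
    obtain d where d: "d > 0" "ball y d \<subseteq> W" "d \<le> e"
    proof -
      obtain d where "d > 0" "ball y d \<subseteq> W" using y EW assms(1) openE by blast
      then show thesis using that[of "min d e"] e(1) by (auto simp: subset_eq)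
    qed
    have le: "u w \<le> u x" if "w \<in> ball y d" for w
      using that d(2) x(2) closure_subset by blast
    have "(\<lambda>w. exp (h w)) constant_on ball y d"
    proof (rule maximum_modulus_principle[where U="ball y d" and \<xi>=y])
      show "(\<lambda>w. exp (h w)) holomorphic_on ball y d"
        using holomorphic_on_subset[OF e(2) subset_ball[OF d(3)]] by (intro holomorphic_intros)
      fix w assume w: "w \<in> ball y d"
      then have "Re (h w) \<le> Re (h y)"
        using e(3)[of w] e(4) d(3) le[OF w] y by (auto simp: E_def)
      then show "norm (exp (h w)) \<le> norm (exp (h y))" by simp
    qed (use d in auto)
    then have const: "Re (h w) = Re (h y)" if "w \<in> ball y d" for w
      using that d(1) unfolding constant_on_def by (metis centre_in_ball norm_exp_eq_Re exp_inj_iff)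
    have "w \<in> E" if w: "w \<in> ball y d" for w
    proof -
      have "Re (h w) \<le> u w" using e(3)[of w] w d(3) by auto
      then have "u w = u x" using const[OF w] e(4) le[OF w] y by (auto simp: E_def)
      then show ?thesis using w d(2) closure_subset[of W] by (auto simp: E_def)
    qed
    then show "\<exists>d>0. ball y d \<subseteq> E" using d(1) by blast
  qed
  ultimately have "E = {} \<or> E = UNIV"
    using clopen by blast
  moreover have "x \<in> E" using x by (simp add: E_def)
  ultimately have "W = UNIV" using EW by auto
  then show False using assms(2) not_bounded_UNIV by blast
qed

section \<open>The unbounded complementary component\<close>

definition outer :: "complex set \<Rightarrow> complex set" where
  "outer U = - fill U"

lemma outer_in_components:
  assumes "bounded U"
  shows "outer U \<in> components (- U)" and "\<not> bounded (outer U)"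
proof -
  obtain X where X: "X \<in> components (- U)" "\<not> bounded X"
    using cobounded_unbounded_components[of "- U"] assms by auto
  have "outer U = X"
  proof
    show "X \<subseteq> outer U"
    proof
      fix x assume x: "x \<in> X"
      then have "x \<notin> U" using X(1) in_components_subset by blast
      moreover have "C = X" if "C \<in> components (- U)" "x \<in> C" for C
        using components_eq[OF that(1) X(1)] that(2) x by blast
      ultimately show "x \<in> outer U"
        using X(2) by (auto simp: outer_def fill_def)
    qed
    show "outer U \<subseteq> X"
    proof
      fix x assume x: "x \<in> outer U"
      then have "x \<in> - U" by (auto simp: outer_def fill_def)
      then obtain C where C: "C \<in> components (- U)" "x \<in> C"
        using Union_components by blast
      then have "\<not> bounded C" using x by (auto simp: outer_def fill_def)
      then have "C = X"
        using cobounded_unique_unbounded_components[of "- U" X C] X C(1) assms by auto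
      then show "x \<in> X" using C by simp
    qed
  qed
  then show "outer U \<in> components (- U)" "\<not> bounded (outer U)" using X by auto
qed

lemma outer_disjoint: "outer U \<inter> U = {}"
  by (auto simp: outer_def fill_def)

lemma connected_outer: "bounded U \<Longrightarrow> connected (outer U)"
  using outer_in_components(1) in_components_connected by blast

lemma closed_outer: "bounded U \<Longrightarrow> open U \<Longrightarrow> closed (outer U)"
  using outer_in_components(1) closed_components[of "- U"] by (auto simp: closed_Compl)

lemma open_fill: "bounded U \<Longrightarrow> open U \<Longrightarrow> open (fill U)"
  using closed_outer[of U] by (simp add: outer_def closed_def)

lemma subset_outer:
  assumes "bounded U" "connected S" "S \<inter> U = {}" "x \<in> S" "x \<in> outer U"
  shows "S \<subseteq> outer U"
  using components_maximal[OF outer_in_components(1)[OF assms(1)] assms(2)] assms by blast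

lemma unbounded_subset_outer:
  assumes "bounded U" "connected S" "S \<inter> U = {}" "\<not> bounded S"
  shows "S \<subseteq> outer U"
proof -
  have "S \<noteq> {}" using assms(4) by auto
  then obtain C where C: "C \<in> components (- U)" "S \<subseteq> C"
    using exists_component_superset[of S "- U"] assms(2,3) by blast
  then have "\<not> bounded C" using assms(4) bounded_subset by blast
  then have "C = outer U"
    using cobounded_unique_unbounded_components[of "- U" "outer U" C]
      outer_in_components[OF assms(1)] C(1) assms(1) by auto
  then show ?thesis using C by simp
qed

lemma bounded_fill:
  assumes "bounded U" shows "bounded (fill U)"
proof -
  obtain B where B: "U \<subseteq> ball 0 B" using assms bounded_subset_ballD by blast
  have "connected (- ball 0 B :: complex set)"
    by (intro connected_complement_bounded_convex) auto
  moreover have "\<not> bounded (- ball 0 B :: complex set)"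
    using cobounded_imp_unbounded[of "- ball 0 B :: complex set"] by auto
  ultimately have "- ball 0 B \<subseteq> outer U"
    using B by (intro unbounded_subset_outer[OF assms]) auto
  then have "fill U \<subseteq> ball 0 B" by (auto simp: outer_def)
  then show ?thesis using bounded_ball bounded_subset by blast
qed

lemma subset_fill: "U \<subseteq> fill U"
  by (auto simp: fill_def)

lemma connected_fill:
  assumes "bounded U" "connected U" shows "connected (fill U)"
  using component_complement_connected[OF assms(2) outer_in_components(1)[OF assms(1)]]
  by (simp add: outer_def)

lemma simply_connected_fill:
  assumes "bounded U" "connected U" "open U" shows "simply_connected (fill U)"
proof -
  have "connected (- fill U)" "\<not> bounded (- fill U)"
    using connected_outer[OF assms(1)] outer_in_components(2)[OF assms(1)] by (auto simp: outer_def)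
  then have "\<forall>C \<in> components (- fill U). \<not> bounded C"
    by (metis components_eq_sing_iff bounded_empty singletonD)
  then show ?thesis
    using simply_connected_eq_unbounded_complement_components[OF open_fill[OF assms(1,3)]]
      connected_fill[OF assms(1,2)] by blast
qed

lemma fill_mono:
  assumes "bounded U" "bounded V" "V \<subseteq> fill U"
  shows "fill V \<subseteq> fill U"
proof -
  have "outer U \<subseteq> outer V"
    using assms(3) by (intro unbounded_subset_outer[OF assms(2)] connected_outer[OF assms(1)]
        outer_in_components(2)[OF assms(1)]) (auto simp: outer_def)
  then show ?thesis by (auto simp: outer_def)
qed

lemma outer_or_fill:
  assumes "bounded U" "connected V" "V \<inter> U = {}"
  shows "V \<subseteq> outer U \<or> V \<subseteq> fill U"
  using subset_outer[OF assms] by (auto simp: outer_def)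

text \<open>\<open>fill U\<close> is connected and misses \<open>V\<close>, so it lies on one side
  of \<open>V\<close>; the common point 0 decides on which.\<close>

lemma nested_domains:
  assumes U: "bounded U" "connected U" and V: "bounded V" "connected V" and "U \<inter> V = {}"
    and "0 \<in> fill U - U" "0 \<in> fill V - V" and "V \<subseteq> outer U"
  shows "fill U \<subseteq> fill V"
proof -
  have "fill U \<inter> V = {}" using assms(8) by (auto simp: outer_def)
  then have "fill U \<subseteq> outer V \<or> fill U \<subseteq> fill V"
    by (intro outer_or_fill connected_fill assms)
  then show ?thesis using assms(6,7) by (auto simp: outer_def)
qed

lemma cball_subset_fill:
  assumes "bounded U" "0 \<in> fill U" "r \<ge> 0" "\<And>z. z \<in> U \<Longrightarrow> norm z > r"
  shows "cball 0 r \<subseteq> fill U"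
proof -
  have "cball 0 r \<subseteq> outer U \<or> cball 0 r \<subseteq> fill U"
    by (rule outer_or_fill[OF assms(1)]) (use assms(4) in force)+
  moreover have "0 \<in> cball (0::complex) r" using assms(3) by simp
  ultimately show ?thesis using assms(2) unfolding outer_def by blast
qed

text \<open>If \<open>S\<close> avoided \<open>U\<close>, it would lie outside, but \<open>x\<close>
  lies in a disc about 0 that \<open>U\<close> encloses. This is the source of every uniqueness
  claim: unbounded connected sets cannot bypass the wandering domains.\<close>

lemma unbounded_connected_meets:
  assumes "bounded U" "0 \<in> fill U" "connected S" "\<not> bounded S" "x \<in> S"
    and "\<And>z. z \<in> U \<Longrightarrow> norm z > norm x"
  shows "S \<inter> U \<noteq> {}"
proof
  assume "S \<inter> U = {}"
  then have "S \<subseteq> outer U" by (intro unbounded_subset_outer assms)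
  moreover have "x \<in> fill U" using cball_subset_fill[OF assms(1,2) _ assms(6)] by auto
  ultimately show False using assms(5) by (auto simp: outer_def)
qed

section \<open>Tracts\<close>

locale tract =
  fixes f :: "complex \<Rightarrow> complex" and D :: "complex set" and R :: real
  assumes open_D: "open D" and connected_D: "connected D" and unbounded_D: "\<not> bounded D"
    and holo: "f holomorphic_on D" and cont: "continuous_on (closure D) f"
    and R_pos: "R > 0" and norm_frontier: "\<And>z. z \<in> frontier D \<Longrightarrow> norm (f z) = R"
    and norm_gt: "\<And>z. z \<in> D \<Longrightarrow> norm (f z) > R"
    and frontier_nonempty: "frontier D \<noteq> {}"
begin

lemma in_D_iff: "z \<in> closure D \<Longrightarrow> z \<in> D \<longleftrightarrow> norm (f z) > R"
  using norm_gt norm_frontier open_D by (auto simp: frontier_def interior_open)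

lemma not_constant: "\<not> f constant_on D"
proof
  assume "f constant_on D"
  then obtain c where c: "\<And>z. z \<in> D \<Longrightarrow> f z = c" by (auto simp: constant_on_def)
  have "f z = c" if "z \<in> closure D" for z
    using continuous_constant_on_closure[OF cont c that] by auto
  moreover obtain z where "z \<in> frontier D" using frontier_nonempty by auto
  moreover obtain w where "w \<in> D" using unbounded_D by (metis bounded_empty equals0I)
  ultimately show False
    using norm_gt[of w] norm_frontier[of z] c[of w] by (auto simp: frontier_def)
qed

lemma open_image: "open b \<Longrightarrow> b \<subseteq> D \<Longrightarrow> open (f ` b)"
  using open_mapping_thm[OF holo open_D connected_D _ _ not_constant] by blast

definition pull :: "complex set \<Rightarrow> complex set" where
  "pull G = {z \<in> D. f z \<in> G}"

text \<open>\<open>D\<close> may be replaced by its closure: at a frontier point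
  \<open>|f| = R\<close>, so such a point is never mapped into \<open>G\<close>.\<close>

lemma closed_pull:
  assumes "closed G" "G \<subseteq> {w. norm w > R}"
  shows "closed (pull G)"
proof -
  have "pull G = closure D \<inter> f -` G"
    using in_D_iff closure_subset[of D] assms(2) by (auto simp: pull_def)
  then show ?thesis
    using continuous_closed_preimage[OF cont closed_closure assms(1)] by simp
qed

text \<open>A bounded component need not be open in the preimage, but Sura-Bura encloses it in a
  compact relatively clopen \<open>K\<close>. As \<open>f\<close> is open on \<open>D\<close>, the
  image of \<open>K\<close> is compact and relatively open in \<open>G\<close>; hence it swallows a
  whole component of \<open>G\<close>, which would then be bounded.\<close>

lemma unbounded_component_pull:
  assumes G: "closed G" "G \<subseteq> {w. norm w > R}"
    and unb: "\<And>C. C \<in> components G \<Longrightarrow> \<not> bounded C"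
    and C: "C \<in> components (pull G)"
  shows "\<not> bounded C"
proof
  assume "bounded C"
  have cl: "closed (pull G)" by (rule closed_pull[OF G])
  then have "compact C"
    using \<open>bounded C\<close> closed_components[OF _ C] by (simp add: compact_eq_bounded_closed)
  then obtain K where K: "openin (top_of_set (pull G)) K" "compact K" "C \<subseteq> K"
    using Sura_Bura_clopen_subset[OF closed_imp_locally_compact[OF cl] C, of UNIV] by auto
  obtain T where T: "open T" "K = pull G \<inter> T"
    using K(1) by (auto simp: openin_open)
  have KD: "K \<subseteq> D" and KG: "f ` K \<subseteq> G" using T by (auto simp: pull_def)
  have fK: "f ` K = G \<inter> f ` (D \<inter> T)" using T by (auto simp: pull_def)
  have op: "open (f ` (D \<inter> T))" using open_image T(1) open_D by blast
  have "continuous_on K f"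
    using cont KD closure_subset[of D] continuous_on_subset by (metis order_trans)
  then have cK: "compact (f ` K)"
    using K(2) compact_continuous_image by blast
  then have clK: "closed (f ` K)" by (rule compact_imp_closed)
  obtain z where z: "z \<in> C" using in_components_nonempty[OF C] by auto
  then have "f z \<in> G" using K(3) KG by auto
  then obtain G1 where G1: "G1 \<in> components G" "f z \<in> G1"
    using Union_components by blast
  have "G1 \<subseteq> G" using G1 in_components_subset by blast
  then have "G1 \<inter> f ` K = G1 \<inter> f ` (D \<inter> T)" using fK by blast
  then have "openin (top_of_set G1) (G1 \<inter> f ` K)" "closedin (top_of_set G1) (G1 \<inter> f ` K)"
    using openin_open_Int[OF op, of G1] closedin_closed_Int[OF clK, of G1] by simp_all
  then have "G1 \<inter> f ` K = G1"
    using in_components_connected[OF G1(1)] z K(3) G1(2) unfolding connected_clopen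
    by (metis IntI empty_iff imageI subsetD)
  then have "bounded G1"
    using cK compact_imp_bounded bounded_subset by (metis inf_le2)
  then show False using unb[OF G1(1)] by simp
qed

end

section \<open>A positive harmonic function decaying at infinity\<close>

text \<open>On a simply connected \<open>Y\<close> a global branch of the logarithm may wind far
  from the principal one. Matching both at 0 makes them agree on the disc where
  \<open>Re h > 0\<close>, and there the imaginary part is below \<open>pi / 2\<close> in absolute
  value.\<close>

lemma holomorphic_log_extending_Ln:
  assumes Y: "open Y" "simply_connected Y" and h: "h holomorphic_on Y" "\<And>w. w \<in> Y \<Longrightarrow> h w \<noteq> 0"
    and "r > 0" and sub: "ball 0 r \<subseteq> Y" and Re_pos: "\<And>w. w \<in> ball 0 r \<Longrightarrow> Re (h w) > 0"
  obtains l where "l holomorphic_on Y" "\<And>w. w \<in> Y \<Longrightarrow> exp (l w) = h w"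
    "\<And>w. w \<in> ball 0 r \<Longrightarrow> l w = Ln (h w)"
proof -
  obtain l1 where l1: "l1 holomorphic_on Y" "\<And>w. w \<in> Y \<Longrightarrow> h w = exp (l1 w)"
    using simply_connected_imp_holomorphic_log[OF h(1) Y(2) open_imp_locally_path_connected[OF Y(1)] h(2)]
    by blast
  define l where "l w = l1 w - l1 0 + Ln (h 0)" for w
  have 0: "0 \<in> Y" using sub \<open>r > 0\<close> by auto
  have lh: "l holomorphic_on Y"
    unfolding l_def by (intro holomorphic_intros l1)
  have el: "exp (l w) = h w" if "w \<in> Y" for w
    using l1(2)[OF that] l1(2)[OF 0] h(2)[OF 0] by (simp add: l_def exp_add exp_diff)
  have "\<exists>c. \<forall>w\<in>ball 0 r. l w - Ln (h w) = c"
  proof (rule has_field_derivative_zero_constant)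
    fix w :: complex assume w: "w \<in> ball 0 r"
    then have wY: "w \<in> Y" using sub by auto
    obtain l' where l': "(l has_field_derivative l') (at w)"
      using lh Y(1) wY holomorphic_derivI by blast
    obtain h' where h': "(h has_field_derivative h') (at w)"
      using h(1) Y(1) wY holomorphic_derivI by blast
    have "((\<lambda>w. exp (l w)) has_field_derivative exp (l w) * l') (at w)"
      using l' by (auto intro!: derivative_eq_intros)
    then have "(h has_field_derivative exp (l w) * l') (at w)"
      by (rule has_field_derivative_transform_within_open[OF _ Y(1) wY]) (use el in auto)
    then have eq: "h' = h w * l'"
      using h' DERIV_unique el[OF wY] by metis
    have "h w \<notin> \<real>\<^sub>\<le>\<^sub>0"
      using Re_pos[OF w] by (auto simp: complex_nonpos_Reals_iff)
    then have "((\<lambda>w. Ln (h w)) has_field_derivative h' / h w) (at w)"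
      using h' by (auto intro!: derivative_eq_intros simp: field_simps)
    then have "((\<lambda>w. l w - Ln (h w)) has_field_derivative l' - h' / h w) (at w)"
      by (intro derivative_intros l')
    moreover have "l' - h' / h w = 0"
      using eq h(2)[OF wY] by simp
    ultimately show "((\<lambda>w. l w - Ln (h w)) has_field_derivative 0) (at w within ball 0 r)"
      using DERIV_subset by (metis top_greatest)
  qed auto
  then obtain c where c: "\<And>w. w \<in> ball 0 r \<Longrightarrow> l w - Ln (h w) = c" by blast
  have "c = 0" using c[of 0] \<open>r > 0\<close> by (simp add: l_def)
  then show ?thesis
    using that[OF lh el] c by simp
qed

lemma Re_inverse_bounds:
  assumes "Re l \<ge> 1"
  shows "Re (1 / l) > 0" "Re (1 / l) \<le> 1 / Re l"
proof -
  have eq: "Re (1 / l) = Re l / ((Re l)\<^sup>2 + (Im l)\<^sup>2)"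
    by (simp add: Re_divide)
  have pos: "(Re l)\<^sup>2 + (Im l)\<^sup>2 > 0"
    using assms by (intro add_pos_nonneg) auto
  then show "Re (1 / l) > 0" using assms eq by simp
  have "Re l / ((Re l)\<^sup>2 + (Im l)\<^sup>2) \<le> Re l / (Re l)\<^sup>2"
    using assms pos by (intro divide_left_mono) auto
  also have "\<dots> = 1 / Re l" by (simp add: power2_eq_square)
  finally show "Re (1 / l) \<le> 1 / Re l" using eq by simp
qed

lemma exp_1_bounds: "exp (1::real) \<ge> 27/10" "exp (1::real) \<le> 3"
  proof -
  have "(inverse (2 ^ 32) :: real) \<le> 1 / 1000" by simp
  then show "exp (1::real) \<ge> 27/10"
    using e_approx_32 unfolding abs_le_iff by linarith
qed (rule exp_le)

text \<open>With a branch \<open>g\<close> of the square root of \<open>1 - w / w0\<close>, a disc about \<open>-1\<close> is omitted by \<open>g\<close>, so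
  \<open>log (g + 1)\<close> has real part bounded below and \<open>1 / log\<close> has positive real part.\<close>

lemma decaying_positive_real_part:
  assumes Y: "open Y" "simply_connected Y" and "r > 0" and sub: "ball 0 r \<subseteq> Y"
    and w0: "w0 \<notin> Y" "norm w0 = r"
  obtains q where "q holomorphic_on Y" "\<And>w. w \<in> Y \<Longrightarrow> Re (q w) > 0"
    "\<And>w. w \<in> Y \<Longrightarrow> norm w > r \<Longrightarrow> Re (q w) \<le> 2 / ln (norm w / r)"
    "\<And>w. w \<in> ball 0 r \<Longrightarrow> Re (q w) \<ge> 1 / 20"
proof -
  have w0nz: "w0 \<noteq> 0" using w0 \<open>r > 0\<close> by auto
  have small: "norm (w / w0) < 1" if "w \<in> ball 0 r" for w
    using that w0 \<open>r > 0\<close> by (simp add: norm_divide)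
  have Re1: "Re (1 - w / w0) > 0" if "w \<in> ball 0 r" for w
    using small[OF that] complex_Re_le_cmod[of "w / w0"] by simp
  obtain \<mu> where \<mu>: "\<mu> holomorphic_on Y" "\<And>w. w \<in> Y \<Longrightarrow> exp (\<mu> w) = 1 - w / w0"
      "\<And>w. w \<in> ball 0 r \<Longrightarrow> \<mu> w = Ln (1 - w / w0)"
  proof (rule holomorphic_log_extending_Ln[OF Y _ _ \<open>r > 0\<close> sub])
    show "(\<lambda>w. 1 - w / w0) holomorphic_on Y"
      using w0nz by (intro holomorphic_intros) auto
  qed (use w0 w0nz Re1 in \<open>auto simp: field_simps\<close>)
  define g where "g w = exp (\<mu> w / 2)" for w
  have g_holo: "g holomorphic_on Y"
    unfolding g_def by (intro holomorphic_intros \<mu>) auto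
  have g2: "(g w)\<^sup>2 = 1 - w / w0" if "w \<in> Y" for w
    using \<mu>(2)[OF that] by (simp add: g_def exp_double[symmetric])
  have Re_g: "Re (g w) > 0" if w: "w \<in> ball 0 r" for w
  proof -
    have "\<bar>Im (\<mu> w)\<bar> < pi / 2"
      using \<mu>(3)[OF w] Re_Ln_pos_lt_imp[OF Re1[OF w]] by auto
    then have "cos (Im (\<mu> w) / 2) > 0"
      by (intro cos_gt_zero_pi) auto
    then show ?thesis by (simp add: g_def Re_exp)
  qed
  \<comment> \<open>If \<open>g w\<close> is near \<open>-1\<close>, then
    \<open>w / w0 = (1 - g w) * (1 + g w)\<close> is small, which puts \<open>w\<close> into the
    disc of radius \<open>r\<close>. But there the chosen branch has
    \<open>Re (g w) > 0\<close>.\<close>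
  have g1: "norm (g w + 1) \<ge> 1 / 4" if w: "w \<in> Y" for w
  proof (rule ccontr)
    assume "\<not> ?thesis"
    then have lt: "norm (g w + 1) < 1 / 4" by simp
    have "norm (1 - g w) \<le> 2 + norm (g w + 1)"
      using norm_triangle_ineq4[of 2 "g w + 1"] by (simp add: algebra_simps)
    then have "norm (1 - g w) * norm (g w + 1) \<le> (9/4) * (1/4)"
      using lt by (intro mult_mono) auto
    moreover have "w = w0 * ((1 - g w) * (g w + 1))"
      using g2[OF w] w0nz by (simp add: power2_eq_square field_simps)
    then have "norm w = r * (norm (1 - g w) * norm (g w + 1))"
      using w0 by (metis norm_mult)
    ultimately have "norm w \<le> r * (9/16)"
      using \<open>r > 0\<close> by simp
    then have "w \<in> ball 0 r" using \<open>r > 0\<close> by simp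
    then have "Re (g w + 1) > 1" using Re_g by simp
    then show False using lt complex_Re_le_cmod[of "g w + 1"] by linarith
  qed
  \<comment> \<open>The factor turns the bound \<open>1 / 4\<close> into
    \<open>|h| \<ge> exp 1\<close>, so that \<open>Re l \<ge> 1\<close> and \<open>1 / l\<close> has
    positive real part.\<close>
  define h where "h w = of_real (4 * exp 1) * (g w + 1)" for w
  have norm_h: "norm (h w) = 4 * exp 1 * norm (g w + 1)" for w
    by (simp add: h_def norm_mult)
  have h_ge: "norm (h w) \<ge> exp 1" if "w \<in> Y" for w
    using g1[OF that] by (simp add: norm_h)
  obtain l where l: "l holomorphic_on Y" "\<And>w. w \<in> Y \<Longrightarrow> exp (l w) = h w"
      "\<And>w. w \<in> ball 0 r \<Longrightarrow> l w = Ln (h w)"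
  proof (rule holomorphic_log_extending_Ln[OF Y _ _ \<open>r > 0\<close> sub])
    show "h holomorphic_on Y"
      unfolding h_def by (intro holomorphic_intros g_holo)
    show "h w \<noteq> 0" if "w \<in> Y" for w
      using h_ge[OF that] exp_gt_zero[of "1::real"] by (metis norm_zero not_le)
    show "Re (h w) > 0" if "w \<in> ball 0 r" for w
      using Re_g[OF that] by (simp add: h_def)
  qed blast
  have exp_Re_l: "exp (Re (l w)) = norm (h w)" if "w \<in> Y" for w
    using l(2)[OF that] by (metis norm_exp_eq_Re)
  have Re_l: "Re (l w) \<ge> 1" if "w \<in> Y" for w
    using h_ge[OF that] exp_Re_l[OF that] by (metis exp_le_cancel_iff)
  show ?thesis
  proof (rule that[of "\<lambda>w. 1 / l w"])
    show "(\<lambda>w. 1 / l w) holomorphic_on Y"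
      using Re_l by (intro holomorphic_intros l) force
    show "Re (1 / l w) > 0" if "w \<in> Y" for w
      using Re_inverse_bounds(1)[OF Re_l[OF that]] .
    show "Re (1 / l w) \<le> 2 / ln (norm w / r)" if w: "w \<in> Y" and gt: "norm w > r" for w
    proof -
      define x where "x = norm w / r"
      have x1: "x > 1" using gt \<open>r > 0\<close> by (simp add: x_def)
      have xg: "(norm (g w))\<^sup>2 \<ge> x - 1"
      proof -
        have "(norm (g w))\<^sup>2 = norm (1 - w / w0)" using g2[OF w] by (metis norm_power)
        moreover have "norm (w / w0) = x" using w0 by (simp add: x_def norm_divide)
        ultimately show ?thesis
          using norm_triangle_ineq2[of "w / w0" 1] by (simp add: norm_minus_commute)
      qed
      \<comment> \<open>For \<open>x \<le> 7\<close> the bound \<open>|h| \<ge> exp 1\<close>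
        suffices, as \<open>2.7 ^ 2 > 7\<close>. For larger \<open>x\<close> the growth of
        \<open>|g|\<close> like the square root of \<open>x\<close> dominates the shift by
        1.\<close>
      have "(norm (h w))\<^sup>2 \<ge> x"
      proof (cases "x \<le> 7")
        case True
        have "7 \<le> (27/10 :: real)\<^sup>2" by (simp add: power2_eq_square)
        also have "\<dots> \<le> (norm (h w))\<^sup>2"
          using h_ge[OF w] exp_1_bounds by (intro power_mono) auto
        finally show ?thesis using True by simp
      next
        case False
        then have "norm (g w) ^ 2 \<ge> 2 ^ 2" using xg by simp
        then have "norm (g w) \<ge> 2" by (rule power2_le_imp_le) auto
        moreover have "norm (g w + 1) \<ge> norm (g w) - 1"
          using norm_triangle_ineq2[of "g w" "-1"] by simp
        ultimately have "norm (g w + 1) \<ge> norm (g w) / 2" by linarith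
        then have "norm (h w) \<ge> 4 * 1 * (norm (g w) / 2)"
          unfolding norm_h by (intro mult_mono) auto
        then have "(norm (h w))\<^sup>2 \<ge> (2 * norm (g w))\<^sup>2"
          by (intro power_mono) auto
        then show ?thesis using xg False by (simp add: power_mult_distrib)
      qed
      then have "exp (2 * Re (l w)) \<ge> x"
        using exp_Re_l[OF w] by (simp add: exp_double)
      then have "ln x \<le> 2 * Re (l w)"
        using x1 by (metis exp_gt_zero ln_exp ln_mono order_less_trans zero_less_one)
      moreover have "ln x > 0" using x1 by simp
      moreover have "Re (l w) > 0" using Re_l[OF w] by simp
      ultimately have "1 / Re (l w) \<le> 2 / ln x"
        by (simp add: field_simps)
      then show ?thesis using Re_inverse_bounds(2)[OF Re_l[OF w]] by (simp add: x_def)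
    qed
    \<comment> \<open>Here \<open>|h| \<le> 12 * exp 1 \<le> exp 4\<close> gives
      \<open>1 \<le> Re l \<le> 4\<close>, and the principal branch gives
      \<open>|Im l| \<le> 2\<close>. Hence \<open>|l|^2 \<le> 4^2 + 2^2 = 20\<close>.\<close>
    show "Re (1 / l w) \<ge> 1 / 20" if w: "w \<in> ball 0 r" for w
    proof -
      have wY: "w \<in> Y" using w sub by auto
      have "norm (1 - w / w0) \<le> 2"
        using norm_triangle_ineq4[of 1 "w / w0"] small[OF w] by simp
      then have "norm (g w) ^ 2 \<le> 2 ^ 2"
        using g2[OF wY] by (simp flip: norm_power)
      then have "norm (g w) \<le> 2" by (rule power2_le_imp_le) auto
      then have "norm (g w + 1) \<le> 3"
        using norm_triangle_ineq[of "g w" 1] by simp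
      then have "norm (h w) \<le> exp 1 * 12" by (simp add: norm_h)
      also have "\<dots> \<le> exp 1 * exp 1 ^ 3"
        using power_mono[OF exp_1_bounds(1), of 3] by (simp add: power3_eq_cube)
      also have "\<dots> = exp (4::real)"
        by (simp flip: exp_of_nat_mult exp_add)
      finally have "exp (Re (l w)) \<le> exp 4" using exp_Re_l[OF wY] by simp
      then have R4: "Re (l w) \<le> 4" by simp
      have "Re (h w) > 0" using Re_g[OF w] by (simp add: h_def)
      then have "\<bar>Im (l w)\<bar> < pi / 2"
        using l(3)[OF w] Re_Ln_pos_lt_imp by auto
      then have "\<bar>Im (l w)\<bar> \<le> 2" using pi_less_4 by linarith
      then have "(Im (l w))\<^sup>2 \<le> 2\<^sup>2" by (metis abs_le_square_iff abs_numeral)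
      moreover have "(Re (l w))\<^sup>2 \<le> 4\<^sup>2" using R4 Re_l[OF wY] by (intro power_mono) auto
      ultimately have le: "(Re (l w))\<^sup>2 + (Im (l w))\<^sup>2 \<le> 20" by simp
      have pos: "(Re (l w))\<^sup>2 + (Im (l w))\<^sup>2 > 0"
        using Re_l[OF wY] by (intro add_pos_nonneg) auto
      have "1 / 20 \<le> Re (l w) / ((Re (l w))\<^sup>2 + (Im (l w))\<^sup>2)"
        using Re_l[OF wY] le pos by (intro frac_le) auto
      then show ?thesis by (simp add: Re_divide)
    qed
  qed
qed

section \<open>The maximum modulus in a tract\<close>

context tract
begin

text \<open>The frontier of the part of \<open>D\<close> in the annulus lies in the frontier of
  \<open>D\<close> and the two circles. A negative \<open>a\<close> removes the inner circle, so the
  same statement covers discs.\<close>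

lemma annulus_maximum_principle:
  assumes cont_u: "continuous_on {z \<in> closure D. a \<le> norm z \<and> norm z \<le> b} u"
    and supp: "\<And>z. z \<in> D \<Longrightarrow> a < norm z \<Longrightarrow> norm z < b \<Longrightarrow> supported_at u z"
    and fr: "\<And>z. z \<in> frontier D \<Longrightarrow> a \<le> norm z \<Longrightarrow> norm z \<le> b \<Longrightarrow> u z \<le> c"
    and circ: "\<And>z. z \<in> D \<Longrightarrow> norm z = a \<or> norm z = b \<Longrightarrow> u z \<le> c"
    and z: "z \<in> D" "a \<le> norm z" "norm z \<le> b"
  shows "u z \<le> c"
proof (cases "norm z = a \<or> norm z = b")
  case False
  define W where "W = D \<inter> {z. a < norm z \<and> norm z < b}"
  have "open {z::complex. a < norm z \<and> norm z < b}"
    by (intro open_Collect_conj open_Collect_less continuous_intros)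
  then have oW: "open W" unfolding W_def using open_D by blast
  have "closed {z::complex. a \<le> norm z \<and> norm z \<le> b}"
    by (intro closed_Collect_conj closed_Collect_le continuous_intros)
  then have "closure W \<subseteq> closure D \<inter> {z. a \<le> norm z \<and> norm z \<le> b}"
    by (intro closure_minimal) (use closure_subset[of D] in \<open>auto simp: W_def\<close>)
  then have cW: "closure W \<subseteq> {z \<in> closure D. a \<le> norm z \<and> norm z \<le> b}" by auto
  show ?thesis
  proof (rule supported_at_maximum_principle[OF oW])
    show "bounded W"
      by (rule bounded_subset[of "cball 0 b"]) (auto simp: W_def)
    show "continuous_on (closure W) u"
      using cont_u cW continuous_on_subset by blast
    show "supported_at u z" if "z \<in> W" for z
      using that supp by (auto simp: W_def)
    show "u z \<le> c" if "z \<in> frontier W" for z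
    proof -
      have z: "z \<in> closure D" "a \<le> norm z" "norm z \<le> b" "z \<notin> W"
        using that cW oW by (auto simp: frontier_def interior_open)
      show ?thesis
      proof (cases "z \<in> D")
        case True
        then have "norm z = a \<or> norm z = b" using z by (auto simp: W_def)
        then show ?thesis using circ True by blast
      next
        case False
        then have "z \<in> frontier D" using z open_D by (auto simp: frontier_def interior_open)
        then show ?thesis using fr z by blast
      qed
    qed
    show "z \<in> W" using z False by (auto simp: W_def)
  qed
qed (use circ z in blast)

lemma f_nonzero: "z \<in> closure D \<Longrightarrow> f z \<noteq> 0"
  using norm_gt[of z] norm_frontier[of z] R_pos open_D
  by (cases "z \<in> D") (auto simp: frontier_def interior_open)

lemma supported_at_ln_f: "z \<in> D \<Longrightarrow> supported_at (\<lambda>z. c * ln (norm (f z))) z"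
  using f_nonzero closure_subset[of D] by (intro supported_at_ln_norm[OF open_D _ holo]) auto

lemma M_upper: assumes "z \<in> D" shows "norm (f z) \<le> M_D f D (norm z)"
proof -
  have "compact (closure D \<inter> sphere 0 (norm z))"
    by (intro closed_Int_compact) auto
  moreover have "continuous_on (closure D \<inter> sphere 0 (norm z)) (\<lambda>w. norm (f w))"
    by (intro continuous_intros continuous_on_subset[OF cont]) auto
  ultimately have "bounded ((\<lambda>w. norm (f w)) ` (closure D \<inter> sphere 0 (norm z)))"
    using compact_continuous_image compact_imp_bounded by blast
  then have "bdd_above ((\<lambda>w. norm (f w)) ` (closure D \<inter> sphere 0 (norm z)))"
    by (rule bounded_imp_bdd_above)
  then have "bdd_above {norm (f w) |w. norm w = norm z \<and> w \<in> D}"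
    by (rule bdd_above_mono) (use closure_subset[of D] in force)
  then show ?thesis
    unfolding M_D_def by (rule cSup_upper[rotated]) (use assms in auto)
qed

text \<open>The point \<open>z\<close> ensures that the supremum is not taken over the empty
  set.\<close>

lemma M_le:
  assumes "z \<in> D" "norm z = r" "\<And>z. z \<in> D \<Longrightarrow> norm z = r \<Longrightarrow> norm (f z) \<le> B"
  shows "M_D f D r \<le> B"
  unfolding M_D_def by (rule cSup_least) (use assms in auto)

lemma circle_meets:
  assumes "d \<in> D" "r \<ge> norm d" obtains z where "z \<in> D" "norm z = r"
proof -
  obtain w where w: "w \<in> D" "norm w > r"
    using unbounded_D unfolding bounded_iff by (meson not_le)
  have "connected (norm ` D)"
    by (intro connected_continuous_image connected_D continuous_intros)
  then have "r \<in> norm ` D"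
    using w assms connectedD_interval[of "norm ` D" "norm d" "norm w" r] by auto
  then show thesis using that by auto
qed

lemma M_gt_R: assumes "d \<in> D" "r \<ge> norm d" shows "M_D f D r > R"
proof -
  obtain z where "z \<in> D" "norm z = r" using circle_meets[OF assms] .
  then show ?thesis using M_upper[of z] norm_gt[of z] by auto
qed

lemma M_upper_disc:
  assumes "d \<in> D" "r \<ge> norm d" "z \<in> D" "norm z \<le> r"
  shows "norm (f z) \<le> M_D f D r"
proof -
  have pos: "norm (f z) > 0" if "z \<in> closure D" for z
    using f_nonzero[OF that] by simp
  have "1 * ln (norm (f z)) \<le> ln (M_D f D r)"
  proof (rule annulus_maximum_principle[of "-1" r "\<lambda>z. 1 * ln (norm (f z))"])
    show "continuous_on {z \<in> closure D. - 1 \<le> norm z \<and> norm z \<le> r} (\<lambda>z. 1 * ln (norm (f z)))"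
      using f_nonzero by (intro continuous_intros continuous_on_subset[OF cont]) auto
    show "1 * ln (norm (f z)) \<le> ln (M_D f D r)" if "z \<in> frontier D" for z
      using norm_frontier[OF that] M_gt_R[OF assms(1,2)] R_pos by simp
    show "1 * ln (norm (f z)) \<le> ln (M_D f D r)" if "z \<in> D" "norm z = - 1 \<or> norm z = r" for z
    proof -
      have "norm z = r" using that(2) norm_ge_zero[of z] by linarith
      then show ?thesis
        using M_upper[OF that(1)] pos[of z] that(1) closure_subset[of D] by (auto simp: ln_mono)
    qed
    show "supported_at (\<lambda>z. 1 * ln (norm (f z))) z" if "z \<in> D" for z
      using supported_at_ln_f[OF that] .
    show "- 1 \<le> norm z" using norm_ge_zero[of z] by linarith
  qed (use assms in auto)
  moreover have "M_D f D r > 0" using M_gt_R[OF assms(1,2)] R_pos by simp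
  ultimately show ?thesis
    using pos[of z] assms(3) closure_subset[of D] by auto
qed

lemma M_mono:
  assumes "d \<in> D" "norm d \<le> r" "r \<le> s" shows "M_D f D r \<le> M_D f D s"
proof -
  obtain z where "z \<in> D" "norm z = r" using circle_meets[OF assms(1,2)] .
  then show ?thesis
    using M_upper_disc[OF assms(1), of s] assms by (intro M_le) auto
qed

text \<open>Half of a three circles theorem: \<open>\<kappa> * ln |z|\<close> is harmonic, so it
  majorizes \<open>ln |f|\<close> as soon as it does so on both circles. On the frontier of
  \<open>D\<close> this is the condition on \<open>ln R\<close>, as \<open>|z| \<ge> a\<close>
  there.\<close>

lemma power_bound:
  assumes "1 \<le> a" "ln R \<le> \<kappa> * ln a" "\<kappa> \<ge> 0"
    and "\<And>z. z \<in> D \<Longrightarrow> norm z = a \<or> norm z = b \<Longrightarrow> ln (norm (f z)) \<le> \<kappa> * ln (norm z)"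
    and z: "z \<in> D" "a \<le> norm z" "norm z \<le> b"
  shows "ln (norm (f z)) \<le> \<kappa> * ln (norm z)"
proof -
  have "1 * ln (norm (f z)) + (- \<kappa>) * ln (norm z) \<le> 0"
  proof (rule annulus_maximum_principle[of a b])
    show "continuous_on {z \<in> closure D. a \<le> norm z \<and> norm z \<le> b}
            (\<lambda>z. 1 * ln (norm (f z)) + (- \<kappa>) * ln (norm z))"
      using f_nonzero \<open>1 \<le> a\<close> by (intro continuous_intros continuous_on_subset[OF cont]) auto
    show "supported_at (\<lambda>z. 1 * ln (norm (f z)) + (- \<kappa>) * ln (norm z)) z"
      if "z \<in> D" "a < norm z" for z
      using that \<open>1 \<le> a\<close>
      by (intro supported_at_add supported_at_ln_f supported_at_ln_norm[of UNIV]) auto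
    show "1 * ln (norm (f z)) + (- \<kappa>) * ln (norm z) \<le> 0"
      if "z \<in> frontier D" "a \<le> norm z" for z
    proof -
      have "\<kappa> * ln a \<le> \<kappa> * ln (norm z)"
        using that \<open>1 \<le> a\<close> \<open>\<kappa> \<ge> 0\<close> by (intro mult_left_mono ln_mono) auto
      then show ?thesis using norm_frontier[OF that(1)] assms(2) by simp
    qed
  qed (use assms in auto)
  then show ?thesis by simp
qed

text \<open>A Bohr type estimate: if the values of \<open>f\<close> in the tract inside \<open>|z| < q\<close> omit a continuum joining
  a point of modulus \<open>r\<close> to infinity, then \<open>|f|\<close> cannot be much larger than \<open>r\<close> there.\<close>

lemma bohr_estimate:
  assumes Y: "open Y" "simply_connected Y" "ball 0 r \<subseteq> Y" "w0 \<notin> Y" "norm w0 = r" and "R < r"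
    and "1 \<le> a" "a < q" and maps: "\<And>z. z \<in> D \<Longrightarrow> norm z \<le> q \<Longrightarrow> f z \<in> Y"
    and inner: "\<And>z. z \<in> D \<Longrightarrow> norm z = a \<Longrightarrow> norm (f z) < r"
    and z: "z \<in> D" "a < norm z" "norm z < q" and large: "norm (f z) > r"
  shows "ln (norm (f z) / r) \<le> 40 * ln (q / a) / ln (q / norm z)"
proof -
  have "r > 0" using R_pos \<open>R < r\<close> by simp
  obtain p where p: "p holomorphic_on Y" "\<And>w. w \<in> Y \<Longrightarrow> Re (p w) > 0"
    "\<And>w. w \<in> Y \<Longrightarrow> norm w > r \<Longrightarrow> Re (p w) \<le> 2 / ln (norm w / r)"
    "\<And>w. w \<in> ball 0 r \<Longrightarrow> Re (p w) \<ge> 1 / 20"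
    using decaying_positive_real_part[OF Y(1,2) \<open>r > 0\<close> Y(3-5)] by blast
  \<comment> \<open>Chosen so that \<open>c * ln (q / |z|)\<close> equals \<open>1 / 20\<close> at
    \<open>|z| = a\<close> and is no larger beyond; \<open>1 / 20\<close> is the lower bound of
    \<open>Re p\<close> on \<open>|w| < r\<close>.\<close>
  define c where "c = 1 / (20 * ln (q / a))"
  have lqa: "ln (q / a) > 0" using \<open>1 \<le> a\<close> \<open>a < q\<close> by simp
  then have "c > 0" by (simp add: c_def)
  have cqa: "c * (ln q - ln a) = 1 / 20"
    using lqa \<open>1 \<le> a\<close> \<open>a < q\<close> by (simp add: c_def ln_div)
  have maps': "f z \<in> Y" if "z \<in> closure D" "norm z \<le> q" for z
    using that maps[of z] norm_frontier[of z] Y(3) \<open>R < r\<close> open_D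
    by (cases "z \<in> D") (auto simp: frontier_def interior_open)
  have le: "c * (ln q - ln (norm z)) \<le> 1 / 20" if "a \<le> norm z" for z :: complex
  proof -
    have "c * (ln q - ln (norm z)) \<le> c * (ln q - ln a)"
      using that \<open>1 \<le> a\<close> \<open>c > 0\<close> by (intro mult_left_mono diff_left_mono) (auto simp: ln_mono)
    then show ?thesis using cqa by simp
  qed
  \<comment> \<open>Compares \<open>c * ln (q / |z|)\<close> with \<open>Re (p (f z))\<close>: on
    the frontier of \<open>D\<close> and on the inner circle \<open>|f| < r\<close>, and on the
    outer circle the logarithm vanishes, so positivity of \<open>Re p\<close> is enough. With the
    decay \<open>2 / ln (|w| / r)\<close> of \<open>Re p\<close> this yields the constant
    \<open>40 = 2 * 20\<close>.\<close>
  have "(Re (- p (f z)) + c * ln q) + (- c) * ln (norm z) \<le> 0"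
  proof (rule annulus_maximum_principle[of a q])
    have "continuous_on {z \<in> closure D. a \<le> norm z \<and> norm z \<le> q} (\<lambda>z. p (f z))"
      by (rule continuous_on_compose2[OF holomorphic_on_imp_continuous_on[OF p(1)]
            continuous_on_subset[OF cont]]) (use maps' in auto)
    then show "continuous_on {z \<in> closure D. a \<le> norm z \<and> norm z \<le> q}
            (\<lambda>z. (Re (- p (f z)) + c * ln q) + (- c) * ln (norm z))"
      using \<open>1 \<le> a\<close> by (intro continuous_intros) auto
    show "supported_at (\<lambda>z. (Re (- p (f z)) + c * ln q) + (- c) * ln (norm z)) z"
      if z: "z \<in> D" "a < norm z" "norm z < q" for z
    proof (intro supported_at_add supported_at_const supported_at_ln_norm[of UNIV])
      have "(p \<circ> f) holomorphic_on D \<inter> ball 0 q"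
        by (rule holomorphic_on_compose_gen[OF holomorphic_on_subset[OF holo] p(1)]) (use maps in auto)
      then have "(\<lambda>z. - p (f z)) holomorphic_on D \<inter> ball 0 q"
        by (auto intro: holomorphic_intros simp: o_def)
      then show "supported_at (\<lambda>z. Re (- p (f z))) z"
        by (rule supported_at_Re[rotated 2]) (use z open_D in auto)
    qed (use z \<open>1 \<le> a\<close> in auto)
    show "(Re (- p (f z)) + c * ln q) + (- c) * ln (norm z) \<le> 0"
      if z: "z \<in> frontier D" "a \<le> norm z" "norm z \<le> q" for z
    proof -
      have "Re (p (f z)) \<ge> 1 / 20" using norm_frontier[OF z(1)] \<open>R < r\<close> by (intro p(4)) auto
      then show ?thesis using le[OF z(2)] by (simp add: algebra_simps)
    qed
    show "(Re (- p (f z)) + c * ln q) + (- c) * ln (norm z) \<le> 0"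
      if z: "z \<in> D" "norm z = a \<or> norm z = q" for z
    proof (cases "norm z = a")
      case True
      then have "Re (p (f z)) \<ge> 1 / 20" using inner[OF z(1)] by (intro p(4)) auto
      then show ?thesis using le[of z] True by (simp add: algebra_simps)
    next
      case False
      then have "norm z = q" using z by simp
      then show ?thesis using p(2)[OF maps[OF z(1)]] by simp
    qed
  qed (use z in auto)
  then have "c * (ln q - ln (norm z)) \<le> Re (p (f z))"
    by (simp add: algebra_simps)
  also have "\<dots> \<le> 2 / ln (norm (f z) / r)"
    using p(3)[OF maps large] z by simp
  finally have "c * ln (q / norm z) \<le> 2 / ln (norm (f z) / r)"
    using z \<open>1 \<le> a\<close> ln_div[of q "norm z"] by auto
  moreover have "ln (norm (f z) / r) > 0" using large \<open>r > 0\<close> by (intro ln_gt_zero) simp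
  moreover have "ln (q / norm z) > 0" 
  proof (intro ln_gt_zero)
    have "norm z > 0" using z \<open>1 \<le> a\<close> by linarith
    then show "1 < q / norm z" using z by (simp add: less_divide_eq)
  qed
  ultimately show ?thesis
    using lqa by (simp add: c_def field_simps)
qed

end

section \<open>Circular means\<close>

definition circ_mean :: "(complex \<Rightarrow> real) \<Rightarrow> complex \<Rightarrow> real" where
  "circ_mean v z = integral {0..1} (\<lambda>t. v (z * cis (2 * pi * t)))"

lemma norm_cis_diff: "norm (cis a - cis b) \<le> \<bar>a - b\<bar>"
proof -
  have "cis a - cis b = cis b * (exp (\<i> * of_real (a - b)) - 1)"
    unfolding cis_conv_exp[symmetric] by (simp add: right_diff_distrib cis_mult)
  then have "norm (cis a - cis b) = 2 * \<bar>sin ((a - b) / 2)\<bar>"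
    using dist_exp_i_1[of "a - b"] by (simp add: norm_mult)
  then show ?thesis
    using abs_sin_x_le_abs_x[of "(a - b) / 2"] by simp
qed

lemma continuous_on_circle:
  fixes v :: "complex \<Rightarrow> real"
  assumes "continuous_on UNIV v" shows "continuous_on S (\<lambda>t. v (z * cis (2 * pi * t)))"
  by (rule continuous_on_compose2[OF assms]) (auto intro!: continuous_intros)

lemma integrable_circle:
  fixes v :: "complex \<Rightarrow> real"
  assumes "continuous_on UNIV v" shows "(\<lambda>t. v (z * cis (2 * pi * t))) integrable_on {a..b}"
  using continuous_on_circle[OF assms] integrable_continuous_real by blast

lemma integral_periodic:
  fixes F :: "real \<Rightarrow> real"
  assumes "continuous_on UNIV F" "\<And>t. F (t + 1) = F t" "0 \<le> a" "a \<le> 1"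
  shows "integral {0..1} (\<lambda>t. F (t + a)) = integral {0..1} F"
proof -
  have int: "F integrable_on {x..y}" for x y
    using continuous_on_subset[OF assms(1)] integrable_continuous_real by blast
  have "integral {0..1} (\<lambda>t. F (t + a)) = integral {a..1 + a} F"
    using integral_shift[of 0 a 1 F] continuous_on_subset[OF assms(1)] by (simp add: o_def add.commute)
  also have "\<dots> = integral {a..1} F + integral {1..1 + a} F"
    using assms int by (intro Henstock_Kurzweil_Integration.integral_combine[symmetric]) auto
  also have "integral {1..1 + a} F = integral {0..a} (\<lambda>t. F (t + 1))"
    using integral_shift[of 0 1 a F] continuous_on_subset[OF assms(1)] by (simp add: o_def add.commute)
  also have "\<dots> = integral {0..a} F" using assms(2) by simp
  also have "integral {a..1} F + integral {0..a} F = integral {0..1} F"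
    using assms int Henstock_Kurzweil_Integration.integral_combine[of 0 a 1 F] by simp
  finally show ?thesis .
qed

lemma circ_mean_norm:
  assumes "continuous_on UNIV v"
  shows "circ_mean v z = circ_mean v (of_real (norm z))"
proof -
  define a where "a = (Arg2pi z) / (2 * pi)"
  have a: "0 \<le> a" "a \<le> 1"
    using Arg2pi_ge_0[of z] Arg2pi_lt_2pi[of z] by (auto simp: a_def)
  have z: "z = of_real (norm z) * cis (2 * pi * a)"
    using Arg2pi_eq[of z] by (simp add: a_def cis_conv_exp mult.commute)
  define F where "F t = v (of_real (norm z) * cis (2 * pi * t))" for t
  have "continuous_on UNIV F" unfolding F_def by (rule continuous_on_circle[OF assms])
  moreover have "F (t + 1) = F t" for t
    by (simp add: F_def distrib_left cis_mult[symmetric])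
  ultimately have "integral {0..1} (\<lambda>t. F (t + a)) = integral {0..1} F"
    using integral_periodic a by blast
  moreover have "F (t + a) = v (z * cis (2 * pi * t))" for t
    by (subst z) (simp add: F_def mult.assoc cis_mult algebra_simps)
  moreover have "circ_mean v (of_real (norm z)) = integral {0..1} F"
    unfolding circ_mean_def F_def ..
  ultimately show ?thesis by (simp add: circ_mean_def)
qed

text \<open>By uniform continuity of \<open>v\<close> on the disc, one \<open>N\<close> serves all
  circles of radius at most \<open>r\<close>. The finite sums inherit supports from
  \<open>v\<close>, so they give the maximum principle access to circular means.\<close>

lemma circ_mean_approx:
  assumes v: "continuous_on UNIV v" and "e > 0"
  obtains N where "N > 0"
    "\<And>z. norm z \<le> r \<Longrightarrow> \<bar>(\<Sum>j<N. (1 / real N) * v (z * cis (2 * pi * (real j / real N)))) - circ_mean v z\<bar> \<le> e"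
proof -
  have "uniformly_continuous_on (cball 0 r) v"
    by (intro compact_uniformly_continuous continuous_on_subset[OF v]) auto
  then obtain d where d: "d > 0"
    "\<And>x y. x \<in> cball 0 r \<Longrightarrow> y \<in> cball 0 r \<Longrightarrow> dist x y < d \<Longrightarrow> dist (v x) (v y) < e"
    using \<open>e > 0\<close> unfolding uniformly_continuous_on_def by metis
  obtain N0 :: nat where N0: "2 * pi * \<bar>r\<bar> / d < real N0" using reals_Archimedean2 by blast
  define N where "N = Suc N0"
  have N: "N > 0" "2 * pi * \<bar>r\<bar> / real N < d"
  proof -
    have "2 * pi * \<bar>r\<bar> / d < real N" using N0 by (simp add: N_def)
    then show "2 * pi * \<bar>r\<bar> / real N < d" using d(1) by (simp add: N_def field_simps)
  qed (simp add: N_def)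
  show ?thesis
  proof (rule that[OF N(1)])
    fix z :: complex assume z: "norm z \<le> r"
    define F where "F t = v (z * cis (2 * pi * t))" for t
    have cF: "continuous_on S F" for S unfolding F_def by (rule continuous_on_circle[OF v])
    have int: "F integrable_on {a..b}" for a b using cF integrable_continuous_real by blast
    have split: "integral {0..real n / real N} F = (\<Sum>j<n. integral {real j / real N..real (Suc j) / real N} F)" for n
    proof (induction n)
      case (Suc n)
      have "integral {0..real (Suc n) / real N} F =
          integral {0..real n / real N} F + integral {real n / real N..real (Suc n) / real N} F"
        using int N by (intro Henstock_Kurzweil_Integration.integral_combine[symmetric]) (auto simp: divide_right_mono)
      then show ?case using Suc by simp
    qed auto
    have piece: "\<bar>(1 / real N) * F (real j / real N) - integral {real j / real N..real (Suc j) / real N} F\<bar> \<le> e / real N" for j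
    proof -
      have le: "real j / real N \<le> real (Suc j) / real N" by (simp add: divide_right_mono)
      have len: "real (Suc j) / real N - real j / real N = 1 / real N"
        by (simp add: diff_divide_distrib[symmetric])
      have "integral {real j / real N..real (Suc j) / real N} (\<lambda>_. F (real j / real N)) = (1 / real N) * F (real j / real N)"
        using le len by simp
      then have "(1 / real N) * F (real j / real N) - integral {real j / real N..real (Suc j) / real N} F
          = integral {real j / real N..real (Suc j) / real N} (\<lambda>t. F (real j / real N) - F t)"
        using int by (subst Henstock_Kurzweil_Integration.integral_diff) auto
      also have "norm \<dots> \<le> e * (real (Suc j) / real N - real j / real N)"
      proof (rule integral_bound[OF le])
        show "continuous_on {real j / real N..real (Suc j) / real N} (\<lambda>t. F (real j / real N) - F t)"
          by (intro continuous_intros cF)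
        fix t assume t: "t \<in> {real j / real N..real (Suc j) / real N}"
        have "dist (z * cis (2 * pi * (real j / real N))) (z * cis (2 * pi * t))
            = norm z * norm (cis (2 * pi * (real j / real N)) - cis (2 * pi * t))"
          by (simp add: dist_norm flip: norm_mult right_diff_distrib)
        also have "\<dots> \<le> \<bar>r\<bar> * (2 * pi * (1 / real N))"
        proof (rule mult_mono)
          have "norm (cis (2 * pi * (real j / real N)) - cis (2 * pi * t)) \<le> \<bar>2 * pi * (real j / real N) - 2 * pi * t\<bar>"
            by (rule norm_cis_diff)
          also have "\<dots> = \<bar>2 * pi * (real j / real N - t)\<bar>" by (simp only: right_diff_distrib)
          also have "\<dots> = 2 * pi * \<bar>real j / real N - t\<bar>" by (simp add: abs_mult)
          also have "\<dots> \<le> 2 * pi * (1 / real N)"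
            using t len by (intro mult_left_mono) auto
          finally show "norm (cis (2 * pi * (real j / real N)) - cis (2 * pi * t)) \<le> 2 * pi * (1 / real N)" .
        qed (use z in auto)
        also have "\<dots> < d" using N(2) by (simp add: field_simps)
        finally have "dist (F (real j / real N)) (F t) < e"
          unfolding F_def using z by (intro d(2)) (auto simp: norm_mult)
        then show "norm (F (real j / real N) - F t) \<le> e" by (simp add: dist_norm)
      qed
      finally show ?thesis using len by simp
    qed
    have "circ_mean v z = (\<Sum>j<N. integral {real j / real N..real (Suc j) / real N} F)"
      using split[of N] N(1) unfolding circ_mean_def F_def[symmetric] by simp
    then have "(\<Sum>j<N. (1 / real N) * v (z * cis (2 * pi * (real j / real N)))) - circ_mean v z =
       (\<Sum>j<N. (1 / real N) * F (real j / real N) - integral {real j / real N..real (Suc j) / real N} F)"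
      by (simp add: F_def sum_subtractf)
    also have "\<bar>\<dots>\<bar> \<le> (\<Sum>j<N. e / real N)"
      by (rule order_trans[OF sum_abs]) (intro sum_mono piece)
    also have "\<dots> = e" using N by simp
    finally show "\<bar>(\<Sum>j<N. (1 / real N) * v (z * cis (2 * pi * (real j / real N)))) - circ_mean v z\<bar> \<le> e" .
  qed
qed

text \<open>Convexity in \<open>ln |z|\<close> is the maximum principle for the mean minus
  \<open>A * ln |z|\<close> on an annulus. It is applied to a finite sum \<open>V\<close> that
  differs from the mean by at most \<open>e / 2\<close>, and then \<open>e\<close> tends to
  0.\<close>

lemma circ_mean_convex:
  assumes v: "continuous_on UNIV v" "\<And>z. supported_at v z"
  shows "convex_on UNIV (\<lambda>s. circ_mean v (of_real (exp s)))"
proof (rule convex_on_linorderI)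
  define m where "m s = circ_mean v (of_real (exp s))" for s
  fix t x y :: real assume t: "0 < t" "t < 1"
  have main: "m s \<le> A * s + B" if xy: "x < s" "s < y" "m x \<le> A * x + B" "m y \<le> A * y + B" for x y s A B
  proof (rule field_le_epsilon)
    fix e :: real assume "e > 0"
    then obtain N where N: "N > 0"
      "\<And>z. norm z \<le> exp y \<Longrightarrow> \<bar>(\<Sum>j<N. (1 / real N) * v (z * cis (2 * pi * (real j / real N)))) - circ_mean v z\<bar> \<le> e / 2"
      using circ_mean_approx[OF v(1), of "e / 2"] by auto
    define V where "V z = (\<Sum>j<N. (1 / real N) * v (z * cis (2 * pi * (real j / real N))))" for z
    define u where "u z = V z + (- A) * ln (norm z)" for z :: complex
    define W where "W = {z::complex. exp x < norm z \<and> norm z < exp y}"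
    have appr: "\<bar>V z - m (ln (norm z))\<bar> \<le> e / 2" if "norm z \<le> exp y" "z \<noteq> 0" for z
      using N(2)[OF that(1)] circ_mean_norm[OF v(1), of z] that(2) by (simp add: V_def m_def)
    have oW: "open W"
      unfolding W_def by (intro open_Collect_conj open_Collect_less continuous_intros)
    have clW: "closure W \<subseteq> {z. exp x \<le> norm z \<and> norm z \<le> exp y}"
      by (intro closure_minimal closed_Collect_conj closed_Collect_le continuous_intros) (auto simp: W_def)
    have nz: "z \<noteq> 0" if "exp x \<le> norm z" for z :: complex
      using that exp_gt_zero[of x] by (metis norm_zero not_le)
    have "u (of_real (exp s)) \<le> B + e / 2"
    proof (rule supported_at_maximum_principle[OF oW])
      show "bounded W"
        by (rule bounded_subset[of "cball 0 (exp y)"]) (auto simp: W_def)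
      show "continuous_on (closure W) u"
        unfolding u_def V_def
        using clW nz by (intro continuous_intros continuous_on_compose2[OF v(1)]) auto
      show "supported_at u z" if "z \<in> W" for z
        unfolding u_def V_def using that nz[of z]
        by (intro supported_at_add supported_at_sum supported_at_cmult supported_at_rotate
            v(2) supported_at_ln_norm[of UNIV]) (auto simp: W_def)
      show "u z \<le> B + e / 2" if "z \<in> frontier W" for z
      proof -
        have z: "exp x \<le> norm z" "norm z \<le> exp y" "z \<notin> W"
          using that clW oW by (auto simp: frontier_def interior_open)
        then have "norm z = exp x \<or> norm z = exp y" by (auto simp: W_def)
        then have "m (ln (norm z)) \<le> A * ln (norm z) + B" using xy by auto
        moreover have "V z - m (ln (norm z)) \<le> e / 2" using appr[OF z(2) nz[OF z(1)]] by linarith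
        ultimately show ?thesis by (simp add: u_def)
      qed
      show "of_real (exp s) \<in> W" using xy by (simp add: W_def norm_of_real)
    qed
    moreover have "\<bar>V (of_real (exp s)) - m s\<bar> \<le> e / 2"
      using appr[of "of_real (exp s)"] xy by (simp add: norm_of_real)
    then have "m s \<le> V (of_real (exp s)) + e / 2" by linarith
    ultimately show "m s \<le> A * s + B + e"
      unfolding u_def by (simp add: norm_of_real)
  qed
  assume "x < y"
  define A where "A = (m y - m x) / (y - x)"
  have A: "A * (y - x) = m y - m x" using \<open>x < y\<close> by (simp add: A_def)
  have s1: "(1 - t) * x + t * y = x + t * (y - x)" and s2: "(1 - t) * x + t * y = y - (1 - t) * (y - x)"
    by (simp_all add: algebra_simps)
  have "x < (1 - t) * x + t * y" unfolding s1 using t \<open>x < y\<close> by simp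
  moreover have "(1 - t) * x + t * y < y" unfolding s2 using t \<open>x < y\<close> by simp
  ultimately have "m ((1 - t) * x + t * y) \<le> A * ((1 - t) * x + t * y) + (m x - A * x)"
    by (rule main) (use A in \<open>auto simp: algebra_simps\<close>)
  also have "\<dots> = t * (A * (y - x)) + m x" by (simp add: algebra_simps)
  also have "\<dots> = (1 - t) * m x + t * m y" by (simp only: A) (simp add: algebra_simps)
  finally show "circ_mean v (of_real (exp ((1 - t) *\<^sub>R x + t *\<^sub>R y))) \<le>
       (1 - t) * circ_mean v (of_real (exp x)) + t * circ_mean v (of_real (exp y))"
    by (simp add: m_def)
qed simp

section \<open>Integrality of the slopes of circular means\<close>

lemma exp_eq_1_imp_constant:
  assumes "open S" "convex S" "H holomorphic_on S" "\<And>z. z \<in> S \<Longrightarrow> exp (H z) = 1"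
  shows "\<exists>c. \<forall>z\<in>S. H z = c"
proof (rule has_field_derivative_zero_constant[OF assms(2)])
  fix z assume z: "z \<in> S"
  then obtain H' where H': "(H has_field_derivative H') (at z)"
    using assms holomorphic_derivI by blast
  then have "((\<lambda>z. exp (H z)) has_field_derivative exp (H z) * H') (at z)"
    by (auto intro!: derivative_eq_intros)
  then have "((\<lambda>z. 1) has_field_derivative exp (H z) * H') (at z)"
    by (rule has_field_derivative_transform_within_open[OF _ assms(1) z]) (use assms(4) in auto)
  then have "exp (H z) * H' = 0" using DERIV_unique DERIV_const by blast
  then show "(H has_field_derivative 0) (at z within S)"
    using H' DERIV_subset by (metis exp_not_eq_zero mult_eq_0_iff top_greatest)
qed

text \<open>Jensen's formula without zeros. In logarithmic coordinates
  \<open>h (exp z) = exp (G z)\<close> on a vertical strip, and \<open>G\<close> changes by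
  \<open>2 * pi * n * \<i>\<close> under the period of \<open>exp\<close>, where \<open>n\<close> is
  the winding number of \<open>h\<close> along the circles. This \<open>n\<close> becomes the
  slope.\<close>

lemma circ_mean_affine_on_annulus:
  assumes "open A" and h: "h holomorphic_on A" "\<And>z. z \<in> A \<Longrightarrow> h z \<noteq> 0"
    and sub: "\<And>z. exp a < norm z \<Longrightarrow> norm z < exp b \<Longrightarrow> z \<in> A"
    and v: "\<And>z. z \<in> A \<Longrightarrow> v z = ln (norm (h z))" and "a < b"
  obtains n :: int and c :: real where "\<And>s::real. a < s \<Longrightarrow> s < b \<Longrightarrow> circ_mean v (of_real (exp s)) = n * s + c"
proof -
  define S where "S = {z::complex. a < Re z \<and> Re z < b}"
  have S: "open S" "convex S"
    unfolding S_def Collect_conj_eq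
    by (intro open_Int convex_Int open_halfspace_Re_gt open_halfspace_Re_lt
        convex_halfspace_Re_gt convex_halfspace_Re_lt)+
  have expS: "exp z \<in> A" if "z \<in> S" for z
    using that by (intro sub) (auto simp: S_def)
  have "(h \<circ> exp) holomorphic_on S"
    by (rule holomorphic_on_compose_gen[OF _ h(1)]) (use expS in \<open>auto intro: holomorphic_intros\<close>)
  then obtain G where G: "G holomorphic_on S" "\<And>z. z \<in> S \<Longrightarrow> h (exp z) = exp (G z)"
    using contractible_imp_holomorphic_log[of "h \<circ> exp" S] convex_imp_contractible[OF S(2)] h(2) expS
    by (metis comp_apply)
  have shift: "z + of_real y * \<i> \<in> S" if "z \<in> S" for z y
    using that by (simp add: S_def)
  define p where "p = of_real (2 * pi) * \<i>"
  have shift_p: "z + p \<in> S" "z + of_real t * p \<in> S" if "z \<in> S" for z t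
    using shift[OF that, of "2 * pi"] shift[OF that, of "t * (2 * pi)"] by (auto simp: p_def mult.assoc)
  have "\<exists>c. \<forall>z\<in>S. G (z + p) - G z = c"
  proof (rule exp_eq_1_imp_constant[OF S])
    have "(G \<circ> (\<lambda>z. z + p)) holomorphic_on S"
      by (rule holomorphic_on_compose_gen[OF _ G(1)]) (use shift_p in \<open>auto intro!: holomorphic_intros\<close>)
    then show "(\<lambda>z. G (z + p) - G z) holomorphic_on S"
      by (intro holomorphic_intros G(1)) (simp add: o_def)
    fix z assume z: "z \<in> S"
    have "exp (z + p) = exp z" by (simp add: p_def exp_add exp_eq_1)
    then have "exp (G (z + p)) = exp (G z)" using G(2)[OF z] G(2)[OF shift_p(1)[OF z]] by simp
    then show "exp (G (z + p) - G z) = 1" by (simp add: exp_diff)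
  qed
  then obtain c0 where c0: "\<And>z. z \<in> S \<Longrightarrow> G (z + p) - G z = c0" by blast
  define s0 where "s0 = complex_of_real ((a + b) / 2)"
  have s0: "s0 \<in> S" using \<open>a < b\<close> by (simp add: S_def s0_def)
  have "exp c0 = 1"
  proof -
    have "exp (s0 + p) = exp s0" by (simp add: p_def exp_add exp_eq_1)
    then show ?thesis
      using G(2)[OF s0] G(2)[OF shift_p(1)[OF s0]] c0[OF s0] by (metis exp_diff divide_self exp_not_eq_zero)
  qed
  then obtain n :: int where n: "c0 = of_int n * p"
    using exp_eq_1[THEN iffD1, of c0] by (auto simp: complex_eq_iff p_def)
  \<comment> \<open>The average of \<open>G\<close> over a vertical segment of one period. Its
    derivative is the average of \<open>deriv G\<close>, that is
    \<open>(G (z + p) - G z) / p = n\<close>.\<close>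
  define \<Phi> where "\<Phi> z = integral (cbox 0 (1::real)) (\<lambda>t. G (z + of_real t * p))" for z
  have contG: "continuous_on S G" using G(1) by (rule holomorphic_on_imp_continuous_on)
  have contG': "continuous_on S (deriv G)"
    using holomorphic_deriv[OF G(1) S(1)] by (rule holomorphic_on_imp_continuous_on)
  have derivG: "(G has_field_derivative deriv G z) (at z)" if "z \<in> S" for z
    using holomorphic_derivI[OF G(1) S(1) that] by simp
  have int: "(\<lambda>t. G (z + of_real t * p)) integrable_on cbox 0 1" if "z \<in> S" for z
  proof (rule integrable_continuous, rule continuous_on_compose2[OF contG])
    show "continuous_on (cbox 0 1) (\<lambda>t::real. z + of_real t * p)"
      by (intro continuous_intros)
    show "(\<lambda>t. z + of_real t * p) ` cbox 0 1 \<subseteq> S"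
      using shift_p(2)[OF that] by blast
  qed
  have \<Phi>': "(\<Phi> has_field_derivative of_int n) (at z within S)" if z: "z \<in> S" for z
  proof -
    define F where "F = (\<lambda>x (t::real). G (x + of_real t * p))"
    define F' where "F' = (\<lambda>x (t::real). deriv G (x + of_real t * p))"
    have \<Phi>: "\<Phi> = (\<lambda>x. integral (cbox 0 1) (F x))"
      by (simp add: \<Phi>_def F_def fun_eq_iff)
    have "((\<lambda>x. integral (cbox 0 1) (F x)) has_field_derivative integral (cbox 0 1) (F' z)) (at z within S)"
    proof (rule leibniz_rule_field_derivative[where f=F and fx=F' and U=S and ?x0.0=z])
      show "((\<lambda>x. F x t) has_field_derivative F' x t) (at x within S)" if "x \<in> S" for x t
        unfolding F_def F'_def
        using DERIV_shift[THEN iffD1, OF derivG[OF shift_p(2)[OF that]]]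
        by (rule has_field_derivative_at_within)
      show "F x integrable_on cbox 0 1" if "x \<in> S" for x
        unfolding F_def by (rule int[OF that])
      have "continuous_on (S \<times> cbox (0::real) 1) (\<lambda>x. deriv G (fst x + of_real (snd x) * p))"
      proof (rule continuous_on_compose2[OF contG'])
        show "continuous_on (S \<times> cbox (0::real) 1) (\<lambda>x. fst x + of_real (snd x) * p)"
          by (intro continuous_intros)
        show "(\<lambda>x. fst x + of_real (snd x) * p) ` (S \<times> cbox (0::real) 1) \<subseteq> S"
          by (clarsimp simp: shift_p(2))
      qed
      then show "continuous_on (S \<times> cbox 0 1) (\<lambda>(x, t). F' x t)"
        by (simp add: F'_def case_prod_unfold)
    qed (use z S in auto)
    then have "(\<Phi> has_field_derivative integral {0..1} (\<lambda>t. deriv G (z + of_real t * p))) (at z within S)"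
      unfolding \<Phi> F'_def cbox_interval .
    moreover have "((\<lambda>t. p * deriv G (z + of_real t * p)) has_integral G (z + of_real 1 * p) - G (z + of_real 0 * p)) {0..1}"
    proof (rule fundamental_theorem_of_calculus)
      fix t :: real
      have "((\<lambda>t. z + of_real t * p) has_vector_derivative p) (at t within {0..1})"
        unfolding has_vector_derivative_def
        by (auto intro!: derivative_eq_intros simp: scaleR_conv_of_real)
      from field_vector_diff_chain_within[OF this
          has_field_derivative_at_within[OF derivG[OF shift_p(2)[OF z]]]]
      have "(G \<circ> (\<lambda>t. z + of_real t * p) has_vector_derivative (p * deriv G (z + of_real t * p))) (at t within {0..1})" .
      then show "((\<lambda>t. G (z + of_real t * p)) has_vector_derivative p * deriv G (z + of_real t * p)) (at t within {0..1})"
        by (simp add: o_def)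
    qed auto
    then have "((\<lambda>t. p * deriv G (z + of_real t * p)) has_integral c0) {0..1}"
      using c0[OF z] by simp
    from has_integral_mult_right[OF this, of "inverse p"]
    have "((\<lambda>t. deriv G (z + of_real t * p)) has_integral of_int n) {0..1}"
      using n by (simp add: p_def field_simps)
    ultimately show ?thesis by (simp add: integral_unique)
  qed
  have "\<exists>c. \<forall>z\<in>S. \<Phi> z - of_int n * z = c"
  proof (rule has_field_derivative_zero_constant[OF S(2)])
    fix z assume "z \<in> S"
    from DERIV_diff[OF \<Phi>'[OF this] DERIV_cmult[OF DERIV_ident, of "of_int n"]]
    show "((\<lambda>z. \<Phi> z - of_int n * z) has_field_derivative 0) (at z within S)"
      by simp
  qed
  then obtain c where c: "\<And>z. z \<in> S \<Longrightarrow> \<Phi> z - of_int n * z = c" by blast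
  show thesis
  proof (rule that[of n "Re c"])
    fix s assume s: "a < s" "s < b"
    then have sS: "of_real s \<in> S" by (simp add: S_def)
    have val: "v (of_real (exp s) * cis (2 * pi * t)) = Re (G (of_real s + of_real t * p))" for t
    proof -
      have S': "of_real s + of_real t * p \<in> S" using shift_p(2)[OF sS] .
      have e: "exp (of_real s + of_real t * p) = of_real (exp s) * cis (2 * pi * t)"
        by (simp add: exp_add p_def cis_conv_exp exp_of_real mult_ac)
      have "v (of_real (exp s) * cis (2 * pi * t)) = ln (norm (exp (G (of_real s + of_real t * p))))"
        using v[OF expS[OF S']] G(2)[OF S'] e by simp
      then show ?thesis by simp
    qed
    have "((\<lambda>t. G (of_real s + of_real t * p)) has_integral \<Phi> (of_real s)) {0..1}"
      using int[OF sS] by (simp add: \<Phi>_def integrable_integral)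
    from has_integral_Re[OF this]
    have "((\<lambda>t. v (of_real (exp s) * cis (2 * pi * t))) has_integral Re (\<Phi> (of_real s))) {0..1}"
      using val by simp
    then have "circ_mean v (of_real (exp s)) = Re (\<Phi> (of_real s))"
      unfolding circ_mean_def by (rule integral_unique)
    also have "\<Phi> (of_real s) = of_int n * of_real s + c" using c[OF sS] by (simp add: diff_eq_eq add.commute)
    finally show "circ_mean v (of_real (exp s)) = n * s + Re c" by simp
  qed
qed

section \<open>Circular means of a tract and their slopes\<close>

context tract
begin

text \<open>The subharmonic extension of \<open>ln |f / R|\<close> to the plane: it is continuous
  because \<open>|f| = R\<close> on the frontier, and off \<open>D\<close> the constant 0 supports
  it.\<close>

definition vplus :: "complex \<Rightarrow> real" where
  "vplus z = (if z \<in> D then ln (norm (f z) / R) else 0)"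

lemma vplus_pos: "z \<in> D \<Longrightarrow> vplus z > 0"
  unfolding vplus_def using norm_gt[of z] R_pos by (simp add: ln_gt_zero)

lemma vplus_nonneg: "vplus z \<ge> 0"
  using vplus_pos[of z] by (cases "z \<in> D") (auto simp: vplus_def)

lemma continuous_vplus: "continuous_on UNIV vplus"
proof -
  have "continuous_on (closure D \<union> - D) vplus"
    unfolding vplus_def
  proof (rule continuous_on_cases)
    show "continuous_on (closure D) (\<lambda>z. ln (norm (f z) / R))"
      using f_nonzero R_pos by (intro continuous_intros cont) auto
    show "\<forall>x. x \<in> closure D \<and> x \<notin> D \<or> x \<in> - D \<and> x \<in> D \<longrightarrow> ln (norm (f x) / R) = 0"
      using norm_frontier R_pos open_D by (auto simp: frontier_def interior_open)
  qed (use open_D in auto)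
  moreover have "closure D \<union> - D = UNIV" using closure_subset by auto
  ultimately show ?thesis by simp
qed

lemma supported_vplus: "supported_at vplus z"
proof (cases "z \<in> D")
  case True
  have "supported_at (\<lambda>z. 1 * ln (norm (f z / of_real R))) z"
    using R_pos True f_nonzero closure_subset[of D]
    by (intro supported_at_ln_norm[OF open_D]) (auto intro!: holomorphic_intros holo)
  then show ?thesis
    by (rule supported_at_mono[OF _ open_D True]) (use True R_pos in \<open>auto simp: vplus_def norm_divide\<close>)
next
  case False
  show ?thesis
    by (rule supported_at_mono[OF supported_at_const[of 0], of UNIV])
       (use False vplus_nonneg in \<open>auto simp: vplus_def\<close>)
qed

definition mean :: "real \<Rightarrow> real" where
  "mean s = circ_mean vplus (of_real (exp s))"

lemma convex_mean: "convex_on UNIV mean"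
  unfolding mean_def by (rule circ_mean_convex[OF continuous_vplus supported_vplus])

text \<open>By compactness a circle in \<open>D\<close> is surrounded by an annulus in
  \<open>D\<close>, where the mean is affine with the winding number of \<open>f\<close> as
  slope.\<close>

lemma mean_has_integer_derivative:
  assumes "sphere 0 (exp s) \<subseteq> D"
  obtains n :: int where "(mean has_real_derivative n) (at s)"
proof -
  have "\<exists>d>0. \<forall>x\<in>sphere 0 (exp s). \<forall>y\<in>- D. d \<le> dist x y"
    by (rule separate_compact_closed) (use assms open_D in auto)
  then obtain d where d: "d > 0" "\<And>x y. x \<in> sphere 0 (exp s) \<Longrightarrow> y \<in> - D \<Longrightarrow> d \<le> dist x y"
    by (auto simp only: Ball_def)
  have annulus: "z \<in> D" if "\<bar>norm z - exp s\<bar> < d" for z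
  proof (rule ccontr)
    assume "z \<notin> D"
    define w where "w = of_real (exp s) * cis (Arg z)"
    have "z = of_real (norm z) * cis (Arg z)"
      by (metis rcis_cmod_Arg rcis_def)
    then have "w - z = of_real (exp s - norm z) * cis (Arg z)"
      by (metis w_def left_diff_distrib of_real_diff)
    then have "dist w z = \<bar>exp s - norm z\<bar>"
      by (simp only: dist_norm norm_mult norm_of_real norm_cis mult_1_right)
    moreover have "d \<le> dist w z"
      using \<open>z \<notin> D\<close> by (intro d(2)) (auto simp: w_def norm_mult norm_of_real)
    ultimately show False using that by simp
  qed
  have "isCont exp s" by simp
  then obtain e where e: "e > 0" "\<And>x. \<bar>x - s\<bar> < e \<Longrightarrow> \<bar>exp x - exp s\<bar> < d"
    using d(1) unfolding continuous_at_eps_delta dist_real_def by metis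
  define b where "b = e / 2"
  have b: "b > 0" "\<bar>exp (s + b) - exp s\<bar> < d" "\<bar>exp (s - b) - exp s\<bar> < d"
    using e(1) e(2)[of "s + e / 2"] e(2)[of "s - e / 2"] by (simp_all add: b_def)
  obtain n :: int and c :: real where nc: "\<And>x::real. s - b < x \<Longrightarrow> x < s + b \<Longrightarrow> circ_mean vplus (of_real (exp x)) = n * x + c"
  proof (rule circ_mean_affine_on_annulus[OF open_D, of "\<lambda>z. f z / of_real R" "s - b" "s + b" vplus])
    show "z \<in> D" if "exp (s - b) < norm z" "norm z < exp (s + b)" for z
      using that b by (intro annulus) (auto simp: abs_less_iff)
  qed (use R_pos f_nonzero closure_subset[of D] b(1) in \<open>auto intro!: holomorphic_intros holo simp: vplus_def norm_divide\<close>)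
  have "((\<lambda>x. n * x + c) has_real_derivative n) (at s)"
    by (auto intro!: derivative_eq_intros)
  then have "(mean has_real_derivative n) (at s)"
  proof (rule has_field_derivative_transform_within_open[where S="{s - b<..<s + b}"])
    show "n * x + c = mean x" if "x \<in> {s - b<..<s + b}" for x :: real
      unfolding mean_def using that by (intro nc[symmetric]) auto
  qed (use b(1) in auto)
  then show thesis by (rule that)
qed

lemma mean_tangent:
  assumes "(mean has_real_derivative d) (at s)" shows "mean y \<ge> mean s + d * (y - s)"
  using convex_on_imp_above_tangent[OF convex_mean, of s y d] assms by auto

text \<open>Equal slopes on both sides of a hole \<open>p\<close> would make the mean affine in between, also after replacing
  \<open>v\<close> by \<open>max v c\<close>; but this replacement increases the mean on the circle through \<open>p\<close>.\<close>

lemma mean_slope_increases: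
  assumes D1: "sphere 0 (exp s1) \<subseteq> D" and D2: "sphere 0 (exp s2) \<subseteq> D"
    and d1: "(mean has_real_derivative d1) (at s1)" and d2: "(mean has_real_derivative d2) (at s2)"
    and p: "p \<notin> D" "exp s1 < norm p" "norm p < exp s2"
  shows "d1 < d2"
proof (rule ccontr)
  assume "\<not> d1 < d2"
  define y where "y = ln (norm p)"
  have np: "norm p > 0" using p(2) exp_gt_zero[of s1] by linarith
  then have ey: "exp y = norm p" by (simp add: y_def)
  have y: "s1 < y" "y < s2" using p ey by (metis exp_less_cancel_iff)+
  have t1: "mean s2 \<ge> mean s1 + d1 * (s2 - s1)" by (rule mean_tangent[OF d1])
  have t2: "mean s1 \<ge> mean s2 + d2 * (s1 - s2)" by (rule mean_tangent[OF d2])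
  have "d2 * (s2 - s1) \<le> d1 * (s2 - s1)"
    using \<open>\<not> d1 < d2\<close> y by (intro mult_right_mono) auto
  then have eq: "mean s2 = mean s1 + d1 * (s2 - s1)"
    using t1 t2 by (simp add: algebra_simps)
  have my: "mean y \<ge> mean s1 + d1 * (y - s1)" by (rule mean_tangent[OF d1])
  define K where "K = sphere (0::complex) (exp s1) \<union> sphere 0 (exp s2)"
  have "compact K" "K \<noteq> {}" by (auto simp: K_def sphere_eq_empty)
  then obtain z0 where z0: "z0 \<in> K" "\<And>z. z \<in> K \<Longrightarrow> vplus z0 \<le> vplus z"
    using continuous_attains_inf[of K vplus] continuous_on_subset[OF continuous_vplus] by blast
  \<comment> \<open>The minimum of \<open>vplus\<close> over both circles. Hence
    \<open>max vplus c\<close> has the same means there, and convexity bounds its mean in between by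
    the chord; at \<open>p\<close>, where \<open>vplus\<close> vanishes, it is strictly larger than
    \<open>vplus\<close>.\<close>
  define c where "c = vplus z0"
  have "c > 0" using z0(1) D1 D2 by (auto simp: c_def K_def intro!: vplus_pos)
  define w where "w z = max (vplus z) c" for z
  define mw where "mw s = circ_mean w (of_real (exp s))" for s
  have cw: "continuous_on UNIV w" unfolding w_def by (intro continuous_intros continuous_vplus)
  have "convex_on UNIV mw" unfolding mw_def
    by (rule circ_mean_convex[OF cw])
       (auto simp: w_def[abs_def] intro!: supported_at_max supported_vplus supported_at_const)
  define t where "t = (y - s1) / (s2 - s1)"
  have t: "0 \<le> t" "t \<le> 1" "t * (s2 - s1) = y - s1" using y by (auto simp: t_def)
  have yt: "(1 - t) *\<^sub>R s1 + t *\<^sub>R s2 = y" using t(3) by (simp add: algebra_simps)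
  have "mw y \<le> (1 - t) * mw s1 + t * mw s2"
    using convex_onD[OF \<open>convex_on UNIV mw\<close> t(1,2), of s1 s2] yt by simp
  moreover have "mw s1 = mean s1" "mw s2 = mean s2"
    unfolding mw_def mean_def circ_mean_def w_def
    by (intro arg_cong[where f="integral {0..1}"] ext max_absorb1,
        use z0(2) in \<open>auto simp: c_def K_def norm_mult norm_of_real\<close>)+
  moreover have "(1 - t) * mean s1 + t * mean s2 = mean s1 + d1 * (t * (s2 - s1))"
    by (simp only: eq) (simp add: algebra_simps)
  ultimately have "mw y \<le> mean y" using my t(3) by simp
  moreover have "mean y < mw y"
  proof -
    define t0 where "t0 = Arg2pi p / (2 * pi)"
    have t0: "t0 \<in> {0..1}"
      using Arg2pi_ge_0[of p] Arg2pi_lt_2pi[of p] by (auto simp: t0_def)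
    have "p = of_real (exp y) * cis (2 * pi * t0)"
      using Arg2pi_eq[of p] ey by (simp add: t0_def cis_conv_exp mult.commute)
    then have vp: "vplus (of_real (exp y) * cis (2 * pi * t0)) = 0"
      using p(1) by (simp add: vplus_def)
    have cont1: "continuous_on {0..1} (\<lambda>t. w (of_real (exp y) * cis (2 * pi * t)))"
      and cont2: "continuous_on {0..1} (\<lambda>t. vplus (of_real (exp y) * cis (2 * pi * t)))"
      by (intro continuous_on_circle cw continuous_vplus)+
    have "integral {0..1} (\<lambda>t. w (of_real (exp y) * cis (2 * pi * t)) - vplus (of_real (exp y) * cis (2 * pi * t))) \<noteq> 0"
      using integral_eq_0_iff[of 0 1 "\<lambda>t. w (of_real (exp y) * cis (2 * pi * t)) - vplus (of_real (exp y) * cis (2 * pi * t))"]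
        t0 vp \<open>c > 0\<close> continuous_on_diff[OF cont1 cont2] by (force simp: w_def)
    moreover have "integral {0..1} (\<lambda>t. w (of_real (exp y) * cis (2 * pi * t)) - vplus (of_real (exp y) * cis (2 * pi * t))) \<ge> 0"
      by (intro integral_nonneg integrable_diff integrable_circle cw continuous_vplus) (auto simp: w_def)
    moreover have "integral {0..1} (\<lambda>t. w (of_real (exp y) * cis (2 * pi * t)) - vplus (of_real (exp y) * cis (2 * pi * t))) = mw y - mean y"
      unfolding mw_def mean_def circ_mean_def
      by (intro Henstock_Kurzweil_Integration.integral_diff integrable_circle cw continuous_vplus)
    ultimately show ?thesis by simp
  qed
  ultimately show False by simp
qed

end

section \<open>Superpolynomial growth\<close>

lemma power_over_fact_le_exp:
  assumes "x \<ge> 0" shows "x ^ j / fact j \<le> exp (x::real)"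
proof -
  have "(\<Sum>n\<in>{j}. x ^ n /\<^sub>R fact n) \<le> (\<Sum>n. x ^ n /\<^sub>R fact n)"
    by (intro sum_le_suminf summable_exp_generic) (use assms in auto)
  then show ?thesis by (simp add: exp_def divide_inverse mult.commute)
qed

text \<open>The product equals \<open>j! * (N - 1 - j)! / N ^ (N - 1)\<close>, and each of the two
  factors \<open>k! / N ^ k\<close> is at least \<open>exp (- N)\<close> by the exponential
  series.\<close>

lemma prod_index_distance:
  assumes "j < N"
  shows "(\<Prod>i\<in>{..<N} - {j}. \<bar>real i - real j\<bar> / real N) \<ge> exp (- (2 * real N))"
proof -
  have *: "(fact k / real N ^ k) \<ge> exp (- real N)" for k
  proof -
    have "real N ^ k \<le> exp (real N) * fact k"
      using power_over_fact_le_exp[of "real N" k] by (simp add: divide_le_eq)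
    then show ?thesis
      using assms by (simp add: exp_minus field_simps)
  qed
  have "{..<N} - {j} = {..<j} \<union> {j<..<N}" using assms by auto
  then have "(\<Prod>i\<in>{..<N} - {j}. \<bar>real i - real j\<bar> / real N) =
      (\<Prod>i<j. \<bar>real i - real j\<bar> / real N) * (\<Prod>i\<in>{j<..<N}. \<bar>real i - real j\<bar> / real N)"
    by (simp add: prod.union_disjoint Int_def)
  also have "(\<Prod>i<j. \<bar>real i - real j\<bar> / real N) = fact j / real N ^ j"
  proof -
    have "(\<Prod>i<j. \<bar>real i - real j\<bar> / real N) = (\<Prod>i<j. real (Suc i) / real N)"
      by (rule prod.reindex_bij_witness[of _ "\<lambda>i. j - Suc i" "\<lambda>i. j - Suc i"]) auto
    also have "\<dots> = fact j / real N ^ j"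
      by (simp add: prod_dividef fact_prod_Suc lessThan_atLeast0)
    finally show ?thesis .
  qed
  also have "(\<Prod>i\<in>{j<..<N}. \<bar>real i - real j\<bar> / real N) = fact (N - Suc j) / real N ^ (N - Suc j)"
  proof -
    have "(\<Prod>i\<in>{j<..<N}. \<bar>real i - real j\<bar> / real N) = (\<Prod>i<N - Suc j. real (Suc i) / real N)"
      by (rule prod.reindex_bij_witness[of _ "\<lambda>i. i + Suc j" "\<lambda>i. i - Suc j"]) auto
    also have "\<dots> = fact (N - Suc j) / real N ^ (N - Suc j)"
      by (simp add: prod_dividef fact_prod_Suc lessThan_atLeast0)
    finally show ?thesis .
  qed
  finally show ?thesis
    using mult_mono[OF *[of j] *[of "N - Suc j"]] by (simp flip: exp_add)
qed

text \<open>Let \<open>\<zeta> j\<close> be the point whose modulus is closest to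
  \<open>|z|\<close>. The distances to the others are at least half the differences of the moduli,
  which leads to the factorial product above; \<open>far\<close> handles \<open>\<zeta> j\<close>
  itself. The losses are \<open>exp (- N)\<close> for \<open>\<zeta> j\<close>,
  \<open>exp (- 2 * N)\<close> for the product and \<open>2 ^ (- N)\<close> for the halves, and
  \<open>3 + ln 2 < 4\<close>.\<close>

lemma sum_ln_dist_ge:
  fixes \<zeta> :: "nat \<Rightarrow> complex"
  assumes "r > 0" "N > 0" and norm_\<zeta>: "\<And>i. i < N \<Longrightarrow> norm (\<zeta> i) = r * (1 + real i / real N)"
    and far: "\<And>i. i < N \<Longrightarrow> norm (z - \<zeta> i) \<ge> r * exp (- real N)"
  shows "(\<Sum>i<N. ln (norm (z - \<zeta> i))) \<ge> real N * (ln r - 4)"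
proof -
  obtain j where j: "j < N" "\<And>i. i < N \<Longrightarrow> \<bar>norm z - norm (\<zeta> j)\<bar> \<le> \<bar>norm z - norm (\<zeta> i)\<bar>"
    using ex_min_if_finite[of "(\<lambda>i. \<bar>norm z - norm (\<zeta> i)\<bar>) ` {..<N}"] \<open>N > 0\<close>
    by (force simp: not_less)
  have le_dist: "norm (z - \<zeta> i) \<ge> r / 2 * (\<bar>real i - real j\<bar> / real N)" if "i < N" for i
  proof -
    have "\<bar>norm (\<zeta> i) - norm (\<zeta> j)\<bar> \<le> 2 * \<bar>norm z - norm (\<zeta> i)\<bar>"
      using j(2)[OF that] abs_triangle_ineq4[of "norm z - norm (\<zeta> j)" "norm z - norm (\<zeta> i)"] by simp
    also have "\<bar>norm z - norm (\<zeta> i)\<bar> \<le> norm (z - \<zeta> i)" by (rule norm_triangle_ineq3)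
    also have "norm (\<zeta> i) - norm (\<zeta> j) = r * ((real i - real j) / real N)"
      using norm_\<zeta>[OF that] norm_\<zeta>[OF j(1)] by (simp add: algebra_simps diff_divide_distrib)
    finally show ?thesis using \<open>r > 0\<close> by (simp add: abs_mult abs_divide)
  qed
  define P where "P = (\<Prod>i<N. norm (z - \<zeta> i))"
  have pos: "norm (z - \<zeta> i) > 0" if "i < N" for i
    using far[OF that] \<open>r > 0\<close> by (meson exp_gt_zero less_le_trans mult_pos_pos)
  have "P = norm (z - \<zeta> j) * (\<Prod>i\<in>{..<N} - {j}. norm (z - \<zeta> i))"
    unfolding P_def using j(1) by (intro prod.remove) auto
  also have "\<dots> \<ge> (r * exp (- real N)) * (\<Prod>i\<in>{..<N} - {j}. r / 2 * (\<bar>real i - real j\<bar> / real N))"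
    using \<open>r > 0\<close> le_dist by (intro mult_mono far j prod_mono prod_nonneg) auto
  also have "(\<Prod>i\<in>{..<N} - {j}. r / 2 * (\<bar>real i - real j\<bar> / real N)) =
      (r / 2) ^ (N - 1) * (\<Prod>i\<in>{..<N} - {j}. \<bar>real i - real j\<bar> / real N)"
    using j(1) by (simp only: prod.distrib prod_constant) simp
  finally have P1: "P \<ge> (r * exp (- real N)) * ((r / 2) ^ (N - 1) * (\<Prod>i\<in>{..<N} - {j}. \<bar>real i - real j\<bar> / real N))" .
  have "(r * exp (- real N)) * ((r / 2) ^ (N - 1) * exp (- (2 * real N))) \<le>
     (r * exp (- real N)) * ((r / 2) ^ (N - 1) * (\<Prod>i\<in>{..<N} - {j}. \<bar>real i - real j\<bar> / real N))"
    using \<open>r > 0\<close> prod_index_distance[OF j(1)] by (intro mult_left_mono) auto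
  then have P2: "P \<ge> (r * exp (- real N)) * ((r / 2) ^ (N - 1) * exp (- (2 * real N)))" using P1 by linarith
  have "(r / 2) ^ N * exp (- (3 * real N)) \<le> (r * exp (- real N)) * ((r / 2) ^ (N - 1) * exp (- (2 * real N)))"
  proof -
    have "(r / 2) ^ N = r / 2 * (r / 2) ^ (N - 1)" using \<open>N > 0\<close> by (simp add: power_eq_if)
    moreover have "exp (- (3 * real N)) = exp (- real N) * exp (- (2 * real N))" by (simp flip: exp_add)
    ultimately have "(r / 2) ^ N * exp (- (3 * real N))
        = r / 2 * (r / 2) ^ (N - 1) * (exp (- real N) * exp (- (2 * real N)))"
      by simp
    also have "\<dots> \<le> r * (r / 2) ^ (N - 1) * (exp (- real N) * exp (- (2 * real N)))"
      using \<open>r > 0\<close> by (intro mult_right_mono) auto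
    finally show ?thesis by (simp only: mult_ac)
  qed
  then have P3: "P \<ge> (r / 2) ^ N * exp (- (3 * real N))" using P2 by linarith
  have "ln ((r / 2) ^ N * exp (- (3 * real N))) \<le> ln P"
    using P3 \<open>r > 0\<close> by (intro ln_mono) auto
  moreover have "ln ((r / 2) ^ N * exp (- (3 * real N))) = real N * (ln r - ln 2 - 3)"
    using \<open>r > 0\<close> by (simp add: ln_mult ln_realpow ln_div algebra_simps)
  moreover have "real N * (ln r - 4) \<le> real N * (ln r - ln 2 - 3)"
    using ln_2_less_1 by (intro mult_left_mono) auto
  moreover have "ln P = (\<Sum>i<N. ln (norm (z - \<zeta> i)))"
    unfolding P_def using pos by (intro ln_prod) auto
  ultimately show ?thesis by linarith
qed

text \<open>A weak form of Beurling's projection theorem; the barrier is the mean of \<open>ln |z - \<zeta> i|\<close> over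
  zeros \<open>\<zeta> i\<close> of \<open>v\<close> with equally spaced moduli.\<close>

lemma projection_estimate:
  assumes v: "continuous_on UNIV v" "\<And>z. supported_at v z" and "r > 0"
    and zeros: "\<And>s. r \<le> s \<Longrightarrow> s \<le> 2 * r \<Longrightarrow> \<exists>z. norm z = s \<and> v z = 0"
    and A: "A > 0" "\<And>z. norm z \<le> 8 * r \<Longrightarrow> v z \<le> A" and z: "norm z \<le> 2 * r"
  shows "v z \<le> 35 / 36 * A"
proof -
  have "uniformly_continuous_on (cball 0 (8 * r)) v"
    by (intro compact_uniformly_continuous continuous_on_subset[OF v(1)]) auto
  then obtain d where d: "d > 0"
    "\<And>x y. x \<in> cball 0 (8 * r) \<Longrightarrow> y \<in> cball 0 (8 * r) \<Longrightarrow> dist x y < d \<Longrightarrow> dist (v x) (v y) < A / 36"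
    using \<open>A > 0\<close> unfolding uniformly_continuous_on_def by (metis divide_pos_pos zero_less_numeral)
  obtain N0 :: nat where N0: "r / d < real N0" using reals_Archimedean2 by blast
  define N where "N = Suc N0"
  have N: "N > 0" and eN: "r * exp (- real N) < d"
  proof -
    have "r / d < real N" using N0 by (simp add: N_def)
    also have "\<dots> < exp (real N)" using exp_ge_add_one_self[of "real N"] by linarith
    finally show "r * exp (- real N) < d" using d(1) by (simp add: exp_minus field_simps)
  qed (simp add: N_def)
  \<comment> \<open>Radius of the discs to be removed around the zeros. It is small enough for
    \<open>v \<le> A / 36\<close> on them by uniform continuity, yet its logarithm is only
    \<open>ln r - N\<close>, so a very close zero lowers the mean of
    \<open>ln |z - \<zeta> i|\<close> by no more than 1.\<close>
  define \<epsilon> where "\<epsilon> = r * exp (- real N)"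
  have eps: "\<epsilon> > 0" "\<epsilon> < d" "\<epsilon> \<le> r" using \<open>r > 0\<close> eN by (auto simp: \<epsilon>_def)
  have "\<exists>z. norm z = r * (1 + real i / real N) \<and> v z = 0" if "i < N" for i
    using that \<open>r > 0\<close> by (intro zeros) (auto simp: algebra_simps divide_le_eq)
  then obtain \<zeta> where \<zeta>: "\<And>i. i < N \<Longrightarrow> norm (\<zeta> i) = r * (1 + real i / real N)" "\<And>i. i < N \<Longrightarrow> v (\<zeta> i) = 0"
    by metis
  have \<zeta>_le: "norm (\<zeta> i) \<le> 2 * r" if "i < N" for i
    using \<zeta>(1)[OF that] that \<open>r > 0\<close> by (auto simp: algebra_simps divide_le_eq)
  have near: "v z \<le> A / 36" if "i < N" "norm (z - \<zeta> i) \<le> \<epsilon>" for i z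
  proof -
    have "norm z \<le> norm (\<zeta> i) + norm (z - \<zeta> i)" by (metis norm_triangle_sub)
    then have "norm z \<le> 8 * r" using \<zeta>_le[OF that(1)] that(2) eps \<open>r > 0\<close> by linarith
    then have "dist (v z) (v (\<zeta> i)) < A / 36"
      using that eps \<zeta>_le[OF that(1)] \<open>r > 0\<close> by (intro d(2)) (auto simp: dist_norm)
    then show ?thesis using \<zeta>(2)[OF that(1)] by (simp add: dist_real_def)
  qed
  show ?thesis
  proof (cases "\<exists>i<N. norm (z - \<zeta> i) \<le> \<epsilon>")
    case True
    then show ?thesis using near[of _ z] \<open>A > 0\<close> by fastforce
  next
    case False
    define W where "W = ball 0 (8 * r) - (\<Union>i<N. cball (\<zeta> i) \<epsilon>)"
    have oW: "open W" unfolding W_def by (intro open_Diff closed_UN) auto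
    \<comment> \<open>The barrier has total weight \<open>A / 6\<close>, small enough for the
      bounded negative part near the zeros since \<open>ln 6 + 4 \<le> 6\<close>. On
      \<open>|z| = 8 * r\<close> all distances are at least \<open>6 * r\<close>, for
      \<open>|z| \<le> 2 * r\<close> at most \<open>4 * r\<close>; the gain
      \<open>A / 6 * ln (3 / 2) \<ge> A / 18\<close> beats the slack \<open>A / 36\<close>.\<close>
    define u where "u z = v z + (\<Sum>i<N. (- (A / (6 * real N))) * ln (norm (z - \<zeta> i)))" for z
    have clW: "closure W \<subseteq> {z. norm z \<le> 8 * r} \<inter> (\<Inter>i\<in>{..<N}. {z. \<epsilon> \<le> norm (z - \<zeta> i)})"
      by (intro closure_minimal closed_Int closed_INT ballI closed_Collect_le continuous_intros)
         (auto simp: W_def dist_norm norm_minus_commute)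
    have ge: "(\<Sum>i<N. ln (norm (z - \<zeta> i))) \<ge> real N * (ln r - 4)" if "z \<in> closure W" for z
      using that clW \<zeta> by (intro sum_ln_dist_ge[OF \<open>r > 0\<close> N]) (auto simp: \<epsilon>_def)
    have u_eq: "u z = v z - A / (6 * real N) * (\<Sum>i<N. ln (norm (z - \<zeta> i)))" for z
      by (simp add: u_def sum_distrib_left sum_negf)
    have scale: "A / (6 * real N) * (real N * x) = A / 6 * x" for x using N by simp
    have zW: "z \<in> W" using False z \<open>r > 0\<close> by (auto simp: W_def dist_norm norm_minus_commute not_le)
    have "u z \<le> A + A / 36 - A / 6 * ln (6 * r)"
    proof (rule supported_at_maximum_principle[OF oW])
      show "bounded W" by (rule bounded_subset[of "ball 0 (8 * r)"]) (auto simp: W_def)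
      have "\<epsilon> \<le> norm (z - \<zeta> i)" if "z \<in> closure W" "i < N" for z i using that clW by auto
      then have nz: "z - \<zeta> i \<noteq> 0" if "z \<in> closure W" "i < N" for z i
        using that eps(1) by fastforce
      then show "continuous_on (closure W) u"
        unfolding u_def using nz by (intro continuous_intros continuous_on_subset[OF v(1)]) auto
      show "supported_at u z" if "z \<in> W" for z
        unfolding u_def using nz[of z] that closure_subset[of W]
        by (intro supported_at_add v supported_at_sum supported_at_ln_norm[of UNIV])
           (auto intro!: holomorphic_intros)
      show "u z \<le> A + A / 36 - A / 6 * ln (6 * r)" if "z \<in> frontier W" for z
      proof -
        have zc: "z \<in> closure W" "z \<notin> W" using that oW by (auto simp: frontier_def interior_open)
        show ?thesis
        proof (cases "norm z = 8 * r")
          case True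
          have "real N * ln (6 * r) = (\<Sum>i<N. ln (6 * r))" by simp
          also have "\<dots> \<le> (\<Sum>i<N. ln (norm (z - \<zeta> i)))"
          proof (intro sum_mono ln_mono)
            fix i assume "i \<in> {..<N}"
            then show "6 * r \<le> norm (z - \<zeta> i)"
              using norm_triangle_ineq2[of z "\<zeta> i"] \<zeta>_le[of i] True by simp
          qed (use \<open>r > 0\<close> in auto)
          finally have "A / (6 * real N) * (real N * ln (6 * r)) \<le> A / (6 * real N) * (\<Sum>i<N. ln (norm (z - \<zeta> i)))"
            using \<open>A > 0\<close> by (intro mult_left_mono) auto
          then show ?thesis using A(2)[of z] True \<open>A > 0\<close> unfolding u_eq scale by simp
        next
          case False
          then have "z \<in> ball 0 (8 * r)" using zc clW by auto
          then obtain i where "i < N" "norm (z - \<zeta> i) \<le> \<epsilon>"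
            using zc(2) by (auto simp: W_def dist_norm norm_minus_commute)
          then have "v z \<le> A / 36" by (rule near)
          moreover have "A / (6 * real N) * (real N * (ln r - 4)) \<le> A / (6 * real N) * (\<Sum>i<N. ln (norm (z - \<zeta> i)))"
            using \<open>A > 0\<close> ge[OF zc(1)] by (intro mult_left_mono) auto
          moreover have "A / 6 * ln (6 * r) \<le> A + A / 6 * (ln r - 4)"
          proof -
            have "(6::real) \<le> exp 1 * exp 1"
              using mult_mono[OF exp_1_bounds(1) exp_1_bounds(1)] by simp
            then have "ln (6::real) \<le> ln (exp 1 * exp 1)" by (intro ln_mono) auto
            then have "ln (6::real) \<le> 2" by (simp add: ln_mult)
            then have "ln (6 * r) \<le> 6 + (ln r - 4)" using \<open>r > 0\<close> by (simp add: ln_mult)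
            then have "A / 6 * ln (6 * r) \<le> A / 6 * (6 + (ln r - 4))"
              using \<open>A > 0\<close> by (intro mult_left_mono) auto
            then show ?thesis by (simp add: algebra_simps)
          qed
          ultimately show ?thesis unfolding u_eq scale by linarith
        qed
      qed
    qed (rule zW)
    moreover have "A / (6 * real N) * (\<Sum>i<N. ln (norm (z - \<zeta> i))) \<le> A / (6 * real N) * (real N * ln (4 * r))"
    proof (rule mult_left_mono)
      have "(\<Sum>i<N. ln (norm (z - \<zeta> i))) \<le> (\<Sum>i<N. ln (4 * r))"
      proof (intro sum_mono ln_mono)
        fix i assume i: "i \<in> {..<N}"
        show "norm (z - \<zeta> i) \<le> 4 * r"
          using norm_triangle_ineq4[of z "\<zeta> i"] \<zeta>_le[of i] z i by simp
        show "0 < norm (z - \<zeta> i)" using False i eps(1) by force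
      qed
      then show "(\<Sum>i<N. ln (norm (z - \<zeta> i))) \<le> real N * ln (4 * r)" by simp
    qed (use \<open>A > 0\<close> in auto)
    ultimately have "v z \<le> A + A / 36 - A / 6 * (ln (6 * r) - ln (4 * r))"
      unfolding u_eq scale right_diff_distrib by linarith
    also have "ln (6 * r) - ln (4 * r) = ln (3 / 2)"
      using \<open>r > 0\<close> by (simp add: ln_mult ln_div flip: ln_realpow) (use ln_mult[of 2 3] ln_mult[of 2 2] in simp)
    also have "A + A / 36 - A / 6 * ln (3 / 2) \<le> A + A / 36 - A / 6 * (1 / 3)"
    proof -
      have "ln (3 / 2 :: real) \<ge> 1 / 3"
        using ln_le_minus_one[of "2 / 3 :: real"] ln_inverse[of "3 / 2 :: real"] by simp
      then show ?thesis using \<open>A > 0\<close> by (intro diff_left_mono mult_left_mono) auto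
    qed
    finally show ?thesis by simp
  qed
qed

section \<open>Polynomial growth in a tract leads to a contradiction\<close>

context tract
begin

text \<open>The bound is assumed only for arbitrarily large radii \<open>s\<close>;
  \<open>power_bound\<close> between \<open>a\<close> and such an \<open>s\<close> carries it to all
  points in between. The exponent \<open>\<kappa>\<close> is large enough for both circles and for
  the frontier, \<open>c\<close> pays for the division by \<open>R\<close> and for the disc
  \<open>|z| < a\<close>, and \<open>max r 2\<close> keeps the logarithm nonnegative.\<close>

lemma vplus_power_bound:
  assumes unb: "\<And>r. \<exists>s\<ge>r. ln (M_D f D s) \<le> K * ln s"
  obtains \<kappa> c where "\<kappa> \<ge> 0" "c \<ge> 0" "\<And>z r. norm z \<le> r \<Longrightarrow> vplus z \<le> \<kappa> * ln (max r 2) + c"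
proof -
  obtain d where d: "d \<in> D" using unbounded_D by (metis bounded_empty equals0I)
  define a where "a = max 2 (norm d)"
  have a: "a \<ge> 2" "a \<ge> norm d" by (auto simp: a_def)
  define \<kappa> where "\<kappa> = Max {K, 0, ln (M_D f D a) / ln a, ln R / ln a}"
  have "K \<le> \<kappa>" "0 \<le> \<kappa>" "ln (M_D f D a) / ln a \<le> \<kappa>" "ln R / ln a \<le> \<kappa>"
    by (auto simp: \<kappa>_def)
  then have \<kappa>: "K \<le> \<kappa>" "\<kappa> \<ge> 0" "ln (M_D f D a) \<le> \<kappa> * ln a" "ln R \<le> \<kappa> * ln a"
    using a by (auto simp: divide_le_eq)
  have fpos: "norm (f z) > 0" if "z \<in> D" for z
    using f_nonzero closure_subset[of D] that by auto
  have bound: "ln (norm (f z)) \<le> \<kappa> * ln (norm z)" if z: "z \<in> D" "norm z \<ge> a" for z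
  proof -
    obtain s where s: "s \<ge> norm z" "ln (M_D f D s) \<le> K * ln s" using unb by blast
    show ?thesis
    proof (rule power_bound[of a \<kappa> s])
      fix w assume w: "w \<in> D" "norm w = a \<or> norm w = s"
      have "ln (M_D f D (norm w)) \<le> \<kappa> * ln (norm w)"
        using w(2)
      proof
        assume "norm w = s"
        moreover have "K * ln s \<le> \<kappa> * ln s" using \<kappa>(1) s(1) z(2) a by (intro mult_right_mono) auto
        ultimately show ?thesis using s(2) by simp
      qed (use \<kappa> in simp)
      moreover have "ln (norm (f w)) \<le> ln (M_D f D (norm w))"
        using fpos[OF w(1)] M_upper[OF w(1)] by (intro ln_mono)
      ultimately show "ln (norm (f w)) \<le> \<kappa> * ln (norm w)" by linarith
    qed (use \<kappa> a z s in auto)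
  qed
  define c where "c = \<bar>ln R\<bar> + \<kappa> * ln a"
  show thesis
  proof (rule that[of \<kappa> c])
    show "c \<ge> 0" using \<kappa>(2) a by (auto simp: c_def)
    fix z :: complex and r assume r: "norm z \<le> r"
    show "vplus z \<le> \<kappa> * ln (max r 2) + c"
    proof (cases "z \<in> D")
      case True
      have "ln (norm (f z)) \<le> \<kappa> * ln (max r 2) + \<kappa> * ln a"
      proof (cases "norm z \<ge> a")
        case large: True
        have "\<kappa> * ln (norm z) \<le> \<kappa> * ln (max r 2)"
          using large a r \<kappa>(2) by (intro mult_left_mono ln_mono) auto
        moreover have "0 \<le> \<kappa> * ln a" using \<kappa>(2) a by auto
        ultimately show ?thesis using bound[OF True large] by linarith
      next
        case False
        then have "norm (f z) \<le> M_D f D a" using M_upper_disc[OF d a(2) True] by simp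
        then have "ln (norm (f z)) \<le> ln (M_D f D a)" using fpos[OF True] by (intro ln_mono)
        moreover have "0 \<le> \<kappa> * ln (max r 2)" using \<kappa>(2) by (intro mult_nonneg_nonneg ln_ge_zero) auto
        ultimately show ?thesis using \<kappa>(3) by linarith
      qed
      then show ?thesis using True R_pos fpos[OF True] by (simp add: vplus_def ln_div c_def)
    next
      case False
      have "0 \<le> \<kappa> * ln (max r 2)" using \<kappa>(2) by (intro mult_nonneg_nonneg ln_ge_zero) auto
      moreover have "c \<ge> 0" using \<kappa>(2) a by (auto simp: c_def)
      ultimately show ?thesis using False by (simp add: vplus_def)
    qed
  qed (rule \<kappa>)
qed

text \<open>Quadrupling the radius gains a factor \<open>35 / 36\<close>. This is geometric decay in
  \<open>k\<close>, against which a bound linear in \<open>k\<close> for the logarithm cannot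
  hold.\<close>

lemma iterated_projection_estimate:
  assumes "r > 0" and holes: "\<And>s. s \<ge> r \<Longrightarrow> \<exists>z. norm z = s \<and> z \<notin> D"
    and "A > 0" "\<And>z. norm z \<le> 2 * r * 4 ^ k \<Longrightarrow> vplus z \<le> A" and "norm z \<le> 2 * r"
  shows "vplus z \<le> (35 / 36) ^ k * A"
  using assms
proof (induction k arbitrary: r z)
  case (Suc k)
  show ?case
  proof -
    have "vplus z \<le> 35 / 36 * ((35 / 36) ^ k * A)"
    proof (rule projection_estimate[OF continuous_vplus supported_vplus \<open>r > 0\<close>])
      show "\<exists>z. norm z = s \<and> vplus z = 0" if "r \<le> s" for s
        using Suc.prems(2)[OF that] by (auto simp: vplus_def)
      show "vplus z \<le> (35 / 36) ^ k * A" if "norm z \<le> 8 * r" for z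
        by (rule Suc.IH[of "4 * r"]) (use Suc.prems that in \<open>auto simp: mult_ac\<close>)
    qed (use Suc.prems in auto)
    then show ?thesis by simp
  qed
qed simp

text \<open>A polynomial bound is refuted in two stages. If all large circles met the complement of
  \<open>D\<close>, then \<open>vplus z1 \<le> (35 / 36) ^ k * A k\<close> with \<open>A k\<close>
  linear in \<open>k\<close> would force \<open>vplus z1 \<le> 0\<close>. So there are arbitrarily
  large circles in \<open>D\<close>; as the complement is unbounded, there are holes between them,
  each raising the integral slope by at least 1, until it exceeds \<open>\<kappa>\<close>.\<close>

theorem superpolynomial_growth:
  assumes unbounded_complement: "\<not> bounded (- D)"
  shows "\<exists>r0. \<forall>r\<ge>r0. K * ln r \<le> ln (M_D f D r)"
proof (rule ccontr)
  assume "\<not> ?thesis"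
  then have "\<exists>s\<ge>r. ln (M_D f D s) \<le> K * ln s" for r
    by (meson less_imp_le not_le)
  then obtain \<kappa> c where kc: "\<kappa> \<ge> 0" "c \<ge> 0"
    "\<And>z r. norm z \<le> r \<Longrightarrow> vplus z \<le> \<kappa> * ln (max r 2) + c"
    using vplus_power_bound by blast
  have good: "\<exists>s. s > x \<and> sphere 0 (exp s) \<subseteq> D" for x
  proof (rule ccontr)
    assume bad: "\<nexists>s. s > x \<and> sphere 0 (exp s) \<subseteq> D"
    obtain z1 where z1: "z1 \<in> D" using unbounded_D by (metis bounded_empty equals0I)
    define r where "r = max (max 1 (exp (x + 1))) (norm z1)"
    have r: "r \<ge> 1" "r \<ge> exp (x + 1)" "r \<ge> norm z1" by (auto simp: r_def)
    have holes: "\<exists>z. norm z = s \<and> z \<notin> D" if "s \<ge> r" for s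
    proof -
      have "exp (x + 1) \<le> s" "s > 0" using that r by auto
      then have "x + 1 \<le> ln s" by (metis exp_gt_zero ln_exp ln_mono)
      then have "\<not> sphere 0 (exp (ln s)) \<subseteq> D" using bad by force
      then show ?thesis using \<open>s > 0\<close> by auto
    qed
    define A where "A k = \<kappa> * (ln (2 * r) + real k * ln 4) + c + 1" for k
    have bnd: "vplus z1 \<le> (35 / 36) ^ k * A k" for k
    proof (rule iterated_projection_estimate[of r])
      have "2 * r * 4 ^ k \<ge> 2 * 1 * 1"
        using r by (intro mult_mono) auto
      then have ln_eq: "ln (max (2 * r * 4 ^ k) 2) = ln (2 * r) + real k * ln 4"
        using r by (simp add: max_absorb1 ln_mult ln_realpow)
      then show "vplus z \<le> A k" if "norm z \<le> 2 * r * 4 ^ k" for z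
        using kc(3)[OF that] by (simp add: A_def)
      have "ln (2 * r) \<ge> 0" using r by simp
      then show "A k > 0"
        unfolding A_def using kc by (intro add_nonneg_pos add_nonneg_nonneg mult_nonneg_nonneg) auto
    qed (use r holes in auto)
    have "(\<lambda>k. (\<kappa> * ln (2 * r) + c + 1) * (35 / 36) ^ k + \<kappa> * ln 4 * (real k * (35 / 36) ^ k))
        \<longlonglongrightarrow> (\<kappa> * ln (2 * r) + c + 1) * 0 + \<kappa> * ln 4 * 0"
      by (intro tendsto_intros LIMSEQ_power_zero powser_times_n_limit_0) auto
    moreover have "(\<kappa> * ln (2 * r) + c + 1) * (35 / 36) ^ k + \<kappa> * ln 4 * (real k * (35 / 36) ^ k)
        = (35 / 36) ^ k * A k" for k
      by (simp add: A_def algebra_simps)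
    ultimately have "(\<lambda>k. (35 / 36) ^ k * A k) \<longlonglongrightarrow> 0" by simp
    then have "vplus z1 \<le> 0"
      using bnd by (intro LIMSEQ_le_const) auto
    then show False using vplus_pos[OF z1] by simp
  qed
  have next_slope: "\<exists>s' n'. sphere 0 (exp s') \<subseteq> D \<and> (mean has_real_derivative of_int n') (at s') \<and> n' \<ge> n + 1"
    if "sphere 0 (exp s) \<subseteq> D" "(mean has_real_derivative of_int n) (at s)" for s and n :: int
  proof -
    obtain p where p: "p \<notin> D" "norm p > exp s"
      using unbounded_complement unfolding bounded_iff by (meson ComplD not_le)
    obtain s' where s': "s' > ln (norm p)" "sphere 0 (exp s') \<subseteq> D" using good by blast
    obtain n' :: int where n': "(mean has_real_derivative of_int n') (at s')"
      using mean_has_integer_derivative[OF s'(2)] by blast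
    have "norm p > 0" using p(2) exp_gt_zero[of s] by linarith
    then have "norm p < exp s'" using s'(1) by (metis exp_less_cancel_iff exp_ln)
    then have "real_of_int n < real_of_int n'"
      using mean_slope_increases[OF that(1) s'(2) that(2) n' p] by blast
    then show ?thesis using s'(2) n' by (intro exI[of _ s'] exI[of _ n']) auto
  qed
  obtain s0 where "sphere 0 (exp s0) \<subseteq> D" using good by blast
  then obtain n0 :: int where n0: "sphere 0 (exp s0) \<subseteq> D" "(mean has_real_derivative of_int n0) (at s0)"
    using mean_has_integer_derivative by blast
  have "\<exists>s n. sphere 0 (exp s) \<subseteq> D \<and> (mean has_real_derivative of_int n) (at s) \<and> n \<ge> n0 + int j" for j
  proof (induction j)
    case 0
    then show ?case using n0 by auto
  next
    case (Suc j)
    then obtain s n where sn: "sphere 0 (exp s) \<subseteq> D" "(mean has_real_derivative of_int n) (at s)" "n \<ge> n0 + int j"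
      by blast
    show ?case using next_slope[OF sn(1,2)] sn(3) by force
  qed
  then obtain s n where sn: "(mean has_real_derivative of_int n) (at s)" "n \<ge> n0 + int (nat (\<lceil>\<kappa>\<rceil> + 1 - n0))"
    by blast
  then have "n \<ge> \<lceil>\<kappa>\<rceil> + 1" by linarith
  then have n: "real_of_int n \<ge> \<kappa> + 1" by linarith
  have mean_le: "mean y \<le> \<kappa> * y + c" if "y \<ge> 1" for y
  proof -
    have "max (exp y) 2 = exp y"
      using exp_ge_add_one_self[of y] that by (intro max_absorb1) linarith
    then have "vplus (of_real (exp y) * cis (2 * pi * t)) \<le> \<kappa> * y + c" for t
      using kc(3)[of "of_real (exp y) * cis (2 * pi * t)" "exp y"] by (simp add: norm_mult norm_of_real)
    then have "mean y \<le> integral {0..1} (\<lambda>t::real. \<kappa> * y + c)"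
      unfolding mean_def circ_mean_def by (intro integral_le integrable_circle continuous_vplus) auto
    then show ?thesis by simp
  qed
  have "real_of_int n * y - \<kappa> * y \<le> c + real_of_int n * s - mean s" if "y \<ge> 1" for y
    using mean_le[OF that] mean_tangent[OF sn(1), of y] by (simp add: algebra_simps)
  moreover have "real_of_int n * y - \<kappa> * y \<ge> y" if "y \<ge> 1" for y
    using mult_right_mono[OF n, of y] that by (simp add: algebra_simps)
  ultimately have "y \<le> c + real_of_int n * s - mean s" if "y \<ge> 1" for y
    using that by (meson order_trans)
  from this[of "max 1 (c + real_of_int n * s - mean s + 1)"] show False by linarith
qed

end

section \<open>A growth recursion\<close>

text \<open>The losses \<open>1 - 2 / sqrt t\<close> and \<open>C / d\<close> with \<open>d = 1 / sqrt t\<close> are summable because \<open>t\<close> grows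
  geometrically, so the initial factor 2 can be spent in portions \<open>1 / 2 ^ k\<close>.\<close>

lemma iterate_comparison:
  fixes \<phi> :: "real \<Rightarrow> real" and t :: "nat \<Rightarrow> real"
  assumes super: "\<And>K. \<exists>x0. \<forall>x\<ge>x0. K * x \<le> \<phi> x"
    and ratio: "\<And>x y. x1 \<le> x \<Longrightarrow> x \<le> y \<Longrightarrow> \<phi> x * y \<le> \<phi> y * x"
    and rec: "\<And>n d. n \<ge> n0 \<Longrightarrow> 0 < d \<Longrightarrow> d < 1 \<Longrightarrow> (1 - d) * t n \<ge> x1 \<Longrightarrow> \<phi> ((1 - d) * t n) \<le> t (Suc n) + C / d"
    and lim: "filterlim t at_top sequentially" and "C \<ge> 0"
  obtains x2 where "\<And>\<tau>. \<tau> \<ge> x2 \<Longrightarrow> \<exists>N0. \<forall>N\<ge>N0. \<forall>k. (\<phi> ^^ k) \<tau> \<le> t (N + k)"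
proof -
  \<comment> \<open>The part \<open>2 * C\<close> absorbs the loss \<open>C / d\<close>, and the 8
    gives \<open>t (Suc n) \<ge> 4 * t n\<close>. The 64 in \<open>x2\<close> makes the square root
    of \<open>t n\<close> at least 8, that is \<open>d \<le> 1 / 8\<close>.\<close>
  obtain a where a: "\<And>x. x \<ge> a \<Longrightarrow> (2 * C + 8) * x \<le> \<phi> x" using super by meson
  define x2 where "x2 = max (max x1 a) 64"
  have x2: "x2 \<ge> x1" "x2 \<ge> a" "x2 \<ge> 64" by (auto simp: x2_def)
  have phi_ge: "x \<le> \<phi> x" if "x \<ge> x2" for x
  proof -
    have "1 * x \<le> (2 * C + 8) * x" using that x2 \<open>C \<ge> 0\<close> by (intro mult_right_mono) auto
    also have "\<dots> \<le> \<phi> x" using that x2 by (intro a) auto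
    finally show ?thesis by simp
  qed
  have mult: "m * \<phi> x \<le> \<phi> (m * x)" if "x \<ge> x2" "m \<ge> 1" for x m
  proof -
    have "x > 0" using that x2 by simp
    then have "x \<le> m * x" using that by simp
    then have "\<phi> x * (m * x) \<le> \<phi> (m * x) * x" using that x2 by (intro ratio) auto
    then have "(m * \<phi> x) * x \<le> \<phi> (m * x) * x" by (simp add: mult_ac)
    then show ?thesis using \<open>x > 0\<close> by simp
  qed
  have step: "\<phi> ((1 - 2 / sqrt (t n)) * t n) \<le> t (Suc n)" "4 * t n \<le> t (Suc n)"
    if n: "n \<ge> n0" and tn: "t n \<ge> 2 * x2" for n
  proof -
    define s where "s = sqrt (t n)"
    have ts: "t n = s * s" and "s \<ge> 8"
      using tn x2 by (auto simp: s_def intro!: real_le_rsqrt)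
    then have "s > 0" by simp
    define d where "d = 1 / s"
    have d: "0 < d" "d \<le> 1 / 8" "d * s = 1" using \<open>s \<ge> 8\<close> by (auto simp: d_def field_simps)
    define y where "y = (1 - 2 * d) * t n"
    have "(3 / 4) * t n \<le> y" unfolding y_def using d tn x2 by (intro mult_right_mono) auto
    then have y: "y \<ge> x2" "y \<ge> t n / 2" using tn x2 by auto
    \<comment> \<open>Evaluating the recursion at \<open>(1 - d) * t n\<close> instead of
      \<open>(1 - 2 * d) * t n\<close> leaves a spare factor \<open>1 + d\<close>, and the additive
      gain \<open>d * \<phi> y\<close> from it pays for \<open>C / d\<close>.\<close>
    have lam: "(1 + d) * y \<le> (1 - d) * t n"
    proof -
      have "(1 + d) * (1 - 2 * d) \<le> 1 - d" using d by (simp add: algebra_simps)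
      then show ?thesis unfolding y_def using tn x2 by (simp add: mult.assoc[symmetric] mult_right_mono)
    qed
    define m where "m = (1 - d) * t n / y"
    have "y > 0" using y x2 by simp
    then have l: "m \<ge> 1 + d" "m * y = (1 - d) * t n" using lam by (auto simp: m_def pos_le_divide_eq)
    have py: "(2 * C + 8) * y \<le> \<phi> y" using y x2 by (intro a) auto
    then have py0: "\<phi> y \<ge> 0" using phi_ge[OF y(1)] \<open>y > 0\<close> by simp
    have "(1 + d) * \<phi> y \<le> m * \<phi> y" using l py0 by (intro mult_right_mono) auto
    also have "\<dots> \<le> \<phi> ((1 - d) * t n)" using mult[of y m] y(1) l d by simp
    also have "\<dots> \<le> t (Suc n) + C / d"
    proof (rule rec[OF n])
      have "1 * y \<le> (1 + d) * y" using d \<open>y > 0\<close> by (intro mult_right_mono) auto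
      then have "x2 \<le> (1 - d) * t n" using lam y(1) by linarith
      then show "x1 \<le> (1 - d) * t n" using x2 by simp
    qed (use d in auto)
    finally have main: "(1 + d) * \<phi> y \<le> t (Suc n) + C / d" .
    have "C / d \<le> d * \<phi> y"
    proof -
      have "C / d = d * (C * (s * s))" using \<open>s > 0\<close> by (simp add: d_def field_simps)
      also have "\<dots> \<le> d * \<phi> y"
      proof (rule mult_left_mono)
        have "C * (s * s) = (2 * C) * (t n / 2)" by (simp add: ts)
        also have "\<dots> \<le> (2 * C + 8) * y" using y \<open>C \<ge> 0\<close> tn x2 by (intro mult_mono) auto
        also have "\<dots> \<le> \<phi> y" by (rule py)
        finally show "C * (s * s) \<le> \<phi> y" .
      qed (use d in auto)
      finally show ?thesis .
    qed
    then have le: "\<phi> y \<le> t (Suc n)" using main by (simp add: algebra_simps)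
    have "y = (1 - 2 / sqrt (t n)) * t n" by (simp add: y_def d_def s_def)
    then show "\<phi> ((1 - 2 / sqrt (t n)) * t n) \<le> t (Suc n)" using le by simp
    have "8 * (t n / 2) \<le> (2 * C + 8) * y" using y \<open>C \<ge> 0\<close> tn x2 by (intro mult_mono) auto
    then show "4 * t n \<le> t (Suc n)" using py le by simp
  qed
  show thesis
  proof (rule that[of x2])
    fix \<tau> assume tau: "\<tau> \<ge> x2"
    obtain N1 where N1: "\<And>n. n \<ge> N1 \<Longrightarrow> t n \<ge> 2 * \<tau>"
      using lim unfolding filterlim_at_top eventually_sequentially by blast
    have iter: "(\<phi> ^^ k) \<tau> \<ge> x2" for k
    proof (induction k)
      case (Suc k)
      then show ?case using phi_ge[OF Suc] by simp
    qed (use tau in simp)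
    \<comment> \<open>The second conjunct makes the square root \<open>s\<close> of
      \<open>t (N + k)\<close> at least \<open>8 * 2 ^ k\<close>. Then \<open>2 / s\<close> is at
      most a quarter of \<open>q = (1/2) ^ k\<close>, and multiplication of \<open>1 + q\<close> by
      \<open>1 - 2 / s\<close> leaves at least \<open>1 + q / 2\<close>.\<close>
    have main: "(1 + (1/2) ^ k) * (\<phi> ^^ k) \<tau> \<le> t (N + k) \<and> 4 ^ k * (2 * x2) \<le> t (N + k)"
      if N: "N \<ge> max n0 N1" for N k
    proof (induction k)
      case 0
      then show ?case using N1[of N] N tau by simp
    next
      case (Suc k)
      define s where "s = sqrt (t (N + k))"
      have "1 * (2 * x2) \<le> 4 ^ k * (2 * x2)" using x2 by (intro mult_right_mono) auto
      then have tn: "t (N + k) \<ge> 2 * x2" using Suc by simp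
      have "(2 ^ k * 8)\<^sup>2 \<le> t (N + k)"
      proof -
        have "(2 ^ k * 8)\<^sup>2 = (4 ^ k * 64 :: real)"
          by (simp add: power_mult_distrib power2_eq_square flip: power_mult_distrib)
        also have "\<dots> \<le> 4 ^ k * (2 * x2)" using x2 by (intro mult_left_mono) auto
        also have "\<dots> \<le> t (N + k)" using Suc by blast
        finally show ?thesis .
      qed
      then have s: "s \<ge> 2 ^ k * 8" unfolding s_def by (rule real_le_rsqrt)
      define q where "q = (1/2 :: real) ^ k"
      have q: "0 < q" "q \<le> 1" "(2::real) ^ k = 1 / q" by (auto simp: q_def power_one_over power_le_one)
      have "2 / s \<le> 2 / (2 ^ k * 8)" using s by (intro divide_left_mono mult_pos_pos) (auto intro: less_le_trans[of _ "2 ^ k * 8"])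
      then have sq: "2 / s \<le> q / 4" using q by simp
      have fac: "1 + q / 2 \<le> (1 - 2 / s) * (1 + q)"
      proof -
        have "2 / s * (1 + q) \<le> q / 4 * 2" using sq q by (intro mult_mono) auto
        moreover have "(1 - 2 / s) * (1 + q) = 1 + q - 2 / s * (1 + q)" by (simp only: left_diff_distrib mult_1)
        ultimately show ?thesis by linarith
      qed
      define x where "x = (\<phi> ^^ k) \<tau>"
      have x: "x \<ge> x2" "x > 0" using iter[of k] x2 by (auto simp: x_def)
      have "2 / s \<le> 1" using sq q by simp
      have "(1 + q / 2) * x \<le> (1 - 2 / s) * (1 + q) * x" using fac x by (intro mult_right_mono) auto
      also have "\<dots> = (1 - 2 / s) * ((1 + q) * x)" by simp
      also have "\<dots> \<le> (1 - 2 / s) * t (N + k)"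
        using Suc \<open>2 / s \<le> 1\<close> by (intro mult_left_mono) (auto simp: q_def x_def)
      finally have le: "(1 + q / 2) * x \<le> (1 - 2 / s) * t (N + k)" .
      have "1 * x \<le> (1 + q / 2) * x" using x q by (intro mult_right_mono) auto
      then have xle: "x2 \<le> (1 + q / 2) * x" using x by linarith
      have "\<phi> ((1 + q / 2) * x) \<le> \<phi> ((1 - 2 / s) * t (N + k))"
      proof -
        define m where "m = (1 - 2 / s) * t (N + k) / ((1 + q / 2) * x)"
        have pos: "(1 + q / 2) * x > 0" using x q by (intro mult_pos_pos) auto
        then have l: "m \<ge> 1" "m * ((1 + q / 2) * x) = (1 - 2 / s) * t (N + k)"
          using le by (auto simp: m_def)
        have "\<phi> ((1 + q / 2) * x) \<ge> 0" using phi_ge[OF xle] pos by simp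
        then have "1 * \<phi> ((1 + q / 2) * x) \<le> m * \<phi> ((1 + q / 2) * x)"
          using l by (intro mult_right_mono) auto
        then show ?thesis using mult[OF xle l(1)] l(2) by simp
      qed
      also have "\<dots> \<le> t (Suc (N + k))" unfolding s_def using step(1)[OF _ tn] N by simp
      finally have "\<phi> ((1 + q / 2) * x) \<le> t (Suc (N + k))" .
      moreover have "(1 + q / 2) * \<phi> x \<le> \<phi> ((1 + q / 2) * x)" using x q by (intro mult) auto
      ultimately have "(1 + (1/2) ^ Suc k) * (\<phi> ^^ Suc k) \<tau> \<le> t (N + Suc k)"
        by (simp add: q_def x_def)
      moreover have "4 ^ Suc k * (2 * x2) \<le> t (N + Suc k)"
        using step(2)[OF _ tn] N Suc by simp
      ultimately show ?case by blast
    qed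
    have "(\<phi> ^^ k) \<tau> \<le> t (N + k)" if "N \<ge> max n0 N1" for N k
    proof -
      have "1 * (\<phi> ^^ k) \<tau> \<le> (1 + (1/2) ^ k) * (\<phi> ^^ k) \<tau>"
        using iter[of k] x2 by (intro mult_right_mono) auto
      then show ?thesis using main[OF that, of k] by linarith
    qed
    then show "\<exists>N0. \<forall>N\<ge>N0. \<forall>k. (\<phi> ^^ k) \<tau> \<le> t (N + k)" by blast
  qed
qed

section \<open>Nested domains in a tract\<close>

text \<open>To be used for a tail of the sequence of Fatou components, so that what holds eventually
  may be assumed for every index.\<close>

locale wandering_tract = tract +
  fixes U :: "nat \<Rightarrow> complex set"
  assumes unbounded_complement: "\<not> bounded (- D)"
    and open_U: "\<And>n. open (U n)" and connected_U: "\<And>n. connected (U n)"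
    and bounded_U: "\<And>n. bounded (U n)" and U_nonempty: "\<And>n. U n \<noteq> {}"
    and surrounds: "\<And>n. 0 \<in> fill (U n) - U n"
    and U_disjoint: "\<And>m n. m \<noteq> n \<Longrightarrow> U m \<inter> U n = {}"
    and closure_U: "\<And>n. closure (U n) \<subseteq> D"
    and f_U: "\<And>n. f ` U n \<subseteq> U (Suc n)"
    and U_tendsto: "\<And>B. eventually (\<lambda>n. \<forall>z\<in>U n. B \<le> norm z) sequentially"
    and U_gt_R: "\<And>n z. z \<in> U n \<Longrightarrow> norm z > R"
begin

lemma outer_gt_R: "outer (U n) \<subseteq> {w. norm w > R}"
  using cball_subset_fill[OF bounded_U[of n], of R] surrounds[of n] U_gt_R[of _ n] R_pos
  by (force simp: outer_def)

lemma outer_components: "C \<in> components (outer (U n)) \<Longrightarrow> \<not> bounded C"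
  using connected_outer[OF bounded_U] outer_in_components(2)[OF bounded_U]
  by (metis components_eq_sing_iff bounded_empty singletonD)

lemma closed_outer_U: "closed (outer (U n))"
  by (rule closed_outer[OF bounded_U open_U])

text \<open>Each component of the preimage is unbounded, and it misses \<open>U n\<close> because
  \<open>f\<close> maps \<open>U n\<close> into \<open>U (n + 1)\<close>; so it lies
  outside.\<close>

lemma pull_outer: "pull (outer (U (Suc n))) \<subseteq> outer (U n)"
proof
  fix z assume z: "z \<in> pull (outer (U (Suc n)))"
  then obtain C where C: "C \<in> components (pull (outer (U (Suc n))))" "z \<in> C"
    using Union_components by blast
  then have "\<not> bounded C"
    using unbounded_component_pull[OF closed_outer_U outer_gt_R] outer_components[of _ "Suc n"] by meson
  moreover have "C \<inter> U n = {}"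
  proof -
    have "C \<subseteq> pull (outer (U (Suc n)))" using C(1) in_components_subset by blast
    then show ?thesis using f_U[of n] outer_disjoint[of "U (Suc n)"] by (force simp: pull_def)
  qed
  ultimately have "C \<subseteq> outer (U n)"
    using C(1) in_components_connected by (intro unbounded_subset_outer[OF bounded_U]) auto
  then show "z \<in> outer (U n)" using C(2) by blast
qed

lemma f_fill: "z \<in> D \<Longrightarrow> z \<in> fill (U n) \<Longrightarrow> f z \<in> fill (U (Suc n))"
  using pull_outer[of n] by (auto simp: outer_def pull_def)

lemma U_subset_D: "U n \<subseteq> D"
  using closure_U closure_subset by blast

text \<open>If \<open>U (n + 1)\<close> were inside \<open>U n\<close>, all later domains would stay inside \<open>U n\<close>.\<close>

lemma U_Suc_outer: "U (Suc n) \<subseteq> outer (U n)"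
proof (rule ccontr)
  assume "\<not> ?thesis"
  have "U (Suc (n + k)) \<subseteq> fill (U (n + k))" for k
  proof (induction k)
    case 0
    have "U (Suc n) \<subseteq> outer (U n) \<or> U (Suc n) \<subseteq> fill (U n)"
      by (intro outer_or_fill bounded_U connected_U U_disjoint) auto
    then show ?case using \<open>\<not> U (Suc n) \<subseteq> outer (U n)\<close> by simp
  next
    case (Suc k)
    obtain z where z: "z \<in> U (Suc (n + k))" using U_nonempty by blast
    then have "f z \<in> fill (U (Suc (n + k)))" using f_fill Suc U_subset_D by blast
    moreover have "f z \<in> U (Suc (Suc (n + k)))" using z f_U by blast
    moreover have "U (Suc (Suc (n + k))) \<subseteq> outer (U (Suc (n + k))) \<or> U (Suc (Suc (n + k))) \<subseteq> fill (U (Suc (n + k)))"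
      by (intro outer_or_fill bounded_U connected_U U_disjoint) auto
    ultimately show ?case by (auto simp: outer_def)
  qed
  then have sub: "fill (U (Suc (n + k))) \<subseteq> fill (U (n + k))" for k
    by (intro fill_mono bounded_U)
  have all: "fill (U (n + k)) \<subseteq> fill (U n)" for k
  proof (induction k)
    case (Suc k)
    then show ?case using sub[of k] by simp
  qed simp
  obtain B where B: "\<And>z. z \<in> fill (U n) \<Longrightarrow> norm z \<le> B"
    using bounded_fill[OF bounded_U[of n]] unfolding bounded_iff by blast
  obtain N where N: "\<And>k z. k \<ge> N \<Longrightarrow> z \<in> U k \<Longrightarrow> B + 1 \<le> norm z"
    using U_tendsto[of "B + 1"] unfolding eventually_sequentially by blast
  obtain z where "z \<in> U (n + N)" using U_nonempty by blast
  then show False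
    using N[of "n + N" z] B[of z] all[of N] subset_fill[of "U (n + N)"] by fastforce
qed

lemma fill_U_mono: "fill (U n) \<subseteq> fill (U (Suc n))"
  by (rule nested_domains[OF bounded_U connected_U bounded_U connected_U U_disjoint surrounds surrounds U_Suc_outer])
     simp

section \<open>Inradii of the filled domains and their recursion\<close>

definition inrad :: "nat \<Rightarrow> real" where
  "inrad n = infdist 0 (outer (U n))"

lemma inrad_attained: obtains w where "w \<in> outer (U n)" "norm w = inrad n"
proof -
  have "outer (U n) \<noteq> {}" using outer_in_components(2)[OF bounded_U] by (metis bounded_empty)
  then obtain w where "w \<in> outer (U n)" "infdist 0 (outer (U n)) = dist 0 w"
    using infdist_attains_inf[OF closed_outer_U] by metis
  then show thesis using that[of w] by (simp add: inrad_def)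
qed

lemma inrad_le: "w \<in> outer (U n) \<Longrightarrow> inrad n \<le> norm w"
  unfolding inrad_def using infdist_le[of w "outer (U n)" 0] by simp

lemma ball_inrad: "ball 0 (inrad n) \<subseteq> fill (U n)"
proof
  fix z :: complex assume "z \<in> ball 0 (inrad n)"
  then have "z \<notin> outer (U n)" using inrad_le[of z n] by auto
  then show "z \<in> fill (U n)" by (simp add: outer_def)
qed

lemma inrad_gt_R: "inrad n > R"
proof -
  obtain w where "w \<in> outer (U n)" "norm w = inrad n" by (rule inrad_attained)
  then show ?thesis using outer_gt_R[of n] by auto
qed

lemma inrad_tendsto: "filterlim inrad at_top sequentially"
  unfolding filterlim_at_top
proof
  fix Z :: real
  have "eventually (\<lambda>n. \<forall>z\<in>U n. \<bar>Z\<bar> + 1 \<le> norm z) sequentially" by (rule U_tendsto)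
  then show "eventually (\<lambda>n. Z \<le> inrad n) sequentially"
  proof eventually_elim
    case (elim n)
    have sub: "cball 0 \<bar>Z\<bar> \<subseteq> fill (U n)" using elim surrounds[of n] by (intro cball_subset_fill bounded_U) force+
    obtain w where w: "w \<in> outer (U n)" "norm w = inrad n" by (rule inrad_attained)
    then have "w \<notin> cball 0 \<bar>Z\<bar>" using sub unfolding outer_def by blast
    then show ?case using w(2) by simp
  qed
qed

lemma closure_U_Suc: "closure (U (Suc n)) \<subseteq> outer (U n)"
  using U_Suc_outer closed_outer_U closure_minimal by blast

lemma f_closure_U: "f ` closure (U n) \<subseteq> closure (U (Suc n))"
proof -
  have "continuous_on (closure (U n)) f"
    using holomorphic_on_imp_continuous_on[OF holo] closure_U continuous_on_subset by blast
  then have "f ` closure (U n) \<subseteq> closure (f ` U n)"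
    by (metis closed_closure closure_subset image_closure_subset)
  then show ?thesis using f_U closure_mono by blast
qed

lemma inrad_recursion:
  obtains n0 x1 where "\<And>n \<delta>. n \<ge> n0 \<Longrightarrow> 0 < \<delta> \<Longrightarrow> \<delta> < 1 \<Longrightarrow> (1 - \<delta>) * ln (inrad n) \<ge> x1 \<Longrightarrow>
    ln (M_D f D (exp ((1 - \<delta>) * ln (inrad n)))) \<le> ln (inrad (Suc n)) + 80 / \<delta>"
proof -
  obtain d where d: "d \<in> D" using unbounded_D by (metis bounded_empty equals0I)
  define a where "a = max 1 (norm d)"
  have a: "a \<ge> 1" "a \<ge> norm d" by (auto simp: a_def)
  have "eventually (\<lambda>n. M_D f D a < inrad n) sequentially"
    using inrad_tendsto unfolding filterlim_at_top_dense by blast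
  then obtain n0 where n0: "\<And>n. n \<ge> n0 \<Longrightarrow> M_D f D a < inrad n"
    unfolding eventually_sequentially by blast
  show thesis
  proof (rule that[of n0 "ln a + 1"])
    fix n and \<delta> :: real
    assume n: "n \<ge> n0" and \<delta>: "0 < \<delta>" "\<delta> < 1" and x: "(1 - \<delta>) * ln (inrad n) \<ge> ln a + 1"
    define t where "t = ln (inrad n)"
    have opos: "inrad n > 0" "inrad (Suc n) > 0" using inrad_gt_R R_pos by (meson less_trans)+
    have "ln a \<ge> 0" using a by simp
    then have xt: "(1 - \<delta>) * t > ln a" "(1 - \<delta>) * t > 0" using x by (auto simp: t_def)
    then have tpos: "t > 0" using \<delta> by (simp add: zero_less_mult_iff)
    \<comment> \<open>The radii are \<open>a < s < q < inrad n\<close>, where \<open>s\<close> and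
      \<open>q\<close> have logarithms \<open>(1 - \<delta>) * t\<close> and
      \<open>(1 - \<delta> / 2) * t\<close>. Then \<open>ln (q / s) = \<delta> / 2 * t\<close> and
      \<open>ln (q / a) \<le> t\<close>, so the constant 40 becomes
      \<open>80 / \<delta>\<close>.\<close>
    define s where "s = exp ((1 - \<delta>) * t)"
    define q where "q = exp ((1 - \<delta> / 2) * t)"
    have as: "a < s" using xt(1) a unfolding s_def by (metis exp_less_cancel_iff exp_ln less_le_trans zero_less_one)
    have sq: "s < q" using tpos \<delta> by (simp add: s_def q_def)
    have "(1 - \<delta> / 2) * t < t" using tpos \<delta> by simp
    then have qo: "q < inrad n" using opos unfolding q_def t_def by (metis exp_less_cancel_iff exp_ln)
    have bound: "norm (f z) \<le> inrad (Suc n) * exp (80 / \<delta>)" if z: "z \<in> D" "norm z = s" for z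
    proof (cases "norm (f z) > inrad (Suc n)")
      case True
      obtain w where w: "w \<in> outer (U (Suc n))" "norm w = inrad (Suc n)" by (rule inrad_attained)
      have "ln (norm (f z) / inrad (Suc n)) \<le> 40 * ln (q / a) / ln (q / norm z)"
      proof (rule bohr_estimate[of "fill (U (Suc n))" _ w])
        show "open (fill (U (Suc n)))" by (intro open_fill bounded_U open_U)
        show "simply_connected (fill (U (Suc n)))" by (intro simply_connected_fill bounded_U open_U connected_U)
        show "w \<notin> fill (U (Suc n))" using w by (simp add: outer_def)
        show "f z \<in> fill (U (Suc n))" if "z \<in> D" "norm z \<le> q" for z
          using that qo ball_inrad[of n] by (intro f_fill) auto
        show "norm (f z) < inrad (Suc n)" if "z \<in> D" "norm z = a" for z
          using M_upper[OF that(1)] that(2) n0[of "Suc n"] n by simp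
      qed (use ball_inrad w inrad_gt_R a as sq z True in auto)
      also have "\<dots> \<le> 80 / \<delta>"
      proof -
        have "ln (q / norm z) = \<delta> / 2 * t"
          using z by (simp add: s_def q_def ln_div algebra_simps)
        moreover have "ln (q / a) \<le> t"
        proof -
          have "ln (q / a) = (1 - \<delta> / 2) * t - ln a" using a by (simp add: q_def ln_div)
          then show ?thesis using \<open>(1 - \<delta> / 2) * t < t\<close> \<open>ln a \<ge> 0\<close> by simp
        qed
        ultimately have "40 * ln (q / a) / ln (q / norm z) \<le> 40 * t / (\<delta> / 2 * t)"
          using tpos \<delta> by (simp only:) (intro divide_right_mono, auto)
        also have "\<dots> = 80 / \<delta>" using tpos \<delta> by (simp add: field_simps)
        finally show ?thesis .
      qed
      finally have "ln (norm (f z) / inrad (Suc n)) \<le> 80 / \<delta>" .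
      moreover have "norm (f z) / inrad (Suc n) > 0" using True opos by (intro divide_pos_pos) linarith+
      ultimately have "norm (f z) / inrad (Suc n) \<le> exp (80 / \<delta>)" by (metis exp_le_cancel_iff exp_ln)
      then show ?thesis using opos by (simp add: pos_divide_le_eq mult.commute)
    next
      case False
      have "inrad (Suc n) * 1 \<le> inrad (Suc n) * exp (80 / \<delta>)"
        using opos \<delta> by (intro mult_left_mono) auto
      then show ?thesis using False by simp
    qed
    have "s \<ge> norm d" using a as by simp
    then obtain z where z: "z \<in> D" "norm z = s" using circle_meets[OF d] by blast
    have "M_D f D s \<le> inrad (Suc n) * exp (80 / \<delta>)" using M_le[OF z bound] .
    moreover have "M_D f D s > 0" using M_gt_R[OF d \<open>s \<ge> norm d\<close>] R_pos by simp
    ultimately have "ln (M_D f D s) \<le> ln (inrad (Suc n) * exp (80 / \<delta>))" by (intro ln_mono)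
    then show "ln (M_D f D (exp ((1 - \<delta>) * ln (inrad n)))) \<le> ln (inrad (Suc n)) + 80 / \<delta>"
      using opos by (simp add: ln_mult s_def t_def)
  qed
qed

section \<open>\<open>ln M_D\<close> as a function of the logarithmic radius, and its
  iterates\<close>

definition \<phi> :: "real \<Rightarrow> real" where "\<phi> x = ln (M_D f D (exp x))"

lemma \<phi>_superlinear: "\<exists>x0. \<forall>x\<ge>x0. K * x \<le> \<phi> x"
proof -
  obtain r0 where r0: "\<And>r. r \<ge> r0 \<Longrightarrow> K * ln r \<le> ln (M_D f D r)"
    using superpolynomial_growth[OF unbounded_complement] by blast
  have "K * x \<le> \<phi> x" if "x \<ge> r0" for x
    using r0[of "exp x"] that exp_ge_add_one_self[of x] by (simp add: \<phi>_def)
  then show ?thesis by blast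
qed

text \<open>\<open>\<phi> x / x\<close> is nondecreasing for large \<open>x\<close>, by
  \<open>power_bound\<close> with \<open>\<kappa> = \<phi> y / y\<close> between \<open>a\<close>
  and \<open>exp y\<close>. Superlinearity makes this \<open>\<kappa>\<close> large enough for the
  inner circle and the frontier.\<close>

lemma \<phi>_ratio:
  obtains x1 where "\<And>x y. x1 \<le> x \<Longrightarrow> x \<le> y \<Longrightarrow> \<phi> x * y \<le> \<phi> y * x"
proof -
  obtain d where d: "d \<in> D" using unbounded_D by (metis bounded_empty equals0I)
  define a where "a = max 2 (norm d)"
  have a: "a \<ge> 2" "a \<ge> norm d" by (auto simp: a_def)
  have la: "ln a > 0" using a by simp
  define K where "K = Max {0, ln (M_D f D a) / ln a, ln R / ln a}"
  have "0 \<le> K" "ln (M_D f D a) / ln a \<le> K" "ln R / ln a \<le> K" by (auto simp: K_def)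
  then have K: "0 \<le> K" "ln (M_D f D a) \<le> K * ln a" "ln R \<le> K * ln a"
    using la by (auto simp: divide_le_eq)
  obtain x0 where x0: "\<And>x. x \<ge> x0 \<Longrightarrow> K * x \<le> \<phi> x" using \<phi>_superlinear by blast
  show thesis
  proof (rule that[of "max x0 (ln a)"])
    fix x y assume xy: "max x0 (ln a) \<le> x" "x \<le> y"
    then have pos: "x > 0" "y > 0" using la by auto
    define \<kappa> where "\<kappa> = \<phi> y / y"
    have \<kappa>: "K \<le> \<kappa>" "\<kappa> * y = \<phi> y" using x0[of y] xy pos by (auto simp: \<kappa>_def le_divide_eq)
    have \<kappa>a: "K * ln a \<le> \<kappa> * ln a" using \<kappa> la by (intro mult_right_mono) auto
    have \<kappa>R: "\<kappa> \<ge> 0" "ln R \<le> \<kappa> * ln a" using \<kappa>a \<kappa>(1) K by linarith+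
    have ax: "a \<le> exp x" using xy(1) a by (metis exp_le_cancel_iff exp_ln less_le_trans max.boundedE zero_less_numeral)
    then have "norm d \<le> exp x" using a by simp
    then obtain w where w: "w \<in> D" "norm w = exp x" using circle_meets[OF d] by blast
    have fpos: "norm (f z) > 0" if "z \<in> D" for z
      using f_nonzero closure_subset[of D] that by auto
    have "norm (f z) \<le> exp (\<kappa> * x)" if z: "z \<in> D" "norm z = exp x" for z
    proof -
      have "ln (norm (f z)) \<le> \<kappa> * ln (norm z)"
      proof (rule power_bound[of a \<kappa> "exp y"])
        fix w assume w: "w \<in> D" "norm w = a \<or> norm w = exp y"
        have "ln (M_D f D (norm w)) \<le> \<kappa> * ln (norm w)"
          using w(2) K(2) \<kappa>a \<kappa>(2) by (auto simp: \<phi>_def)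
        moreover have "ln (norm (f w)) \<le> ln (M_D f D (norm w))"
          using fpos[OF w(1)] M_upper[OF w(1)] by (intro ln_mono)
        ultimately show "ln (norm (f w)) \<le> \<kappa> * ln (norm w)" by linarith
      qed (use \<kappa>R a ax z xy in auto)
      then have "ln (norm (f z)) \<le> \<kappa> * x" using z by simp
      then show ?thesis using fpos[OF z(1)] by (metis exp_le_cancel_iff exp_ln)
    qed
    then have "M_D f D (exp x) \<le> exp (\<kappa> * x)" using M_le[OF w] by blast
    moreover have "M_D f D (exp x) > 0" using M_gt_R[OF d \<open>norm d \<le> exp x\<close>] R_pos by simp
    ultimately have "\<phi> x \<le> \<kappa> * x" unfolding \<phi>_def by (metis exp_le_cancel_iff exp_ln)
    then have "\<phi> x * y \<le> \<kappa> * x * y" using pos by (intro mult_right_mono) auto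
    also have "\<kappa> * x * y = \<phi> y * x" by (simp add: \<kappa>(2)[symmetric])
    finally show "\<phi> x * y \<le> \<phi> y * x" .
  qed
qed

lemma iterates_le_inrad:
  obtains x2 where "\<And>\<tau>. \<tau> \<ge> x2 \<Longrightarrow> \<exists>N0. \<forall>N\<ge>N0. \<forall>k. (\<phi> ^^ k) \<tau> \<le> ln (inrad (N + k))"
proof -
  obtain x1 where x1: "\<And>x y. x1 \<le> x \<Longrightarrow> x \<le> y \<Longrightarrow> \<phi> x * y \<le> \<phi> y * x" using \<phi>_ratio by blast
  obtain n0 x1' where rec: "\<And>n \<delta>. n \<ge> n0 \<Longrightarrow> 0 < \<delta> \<Longrightarrow> \<delta> < 1 \<Longrightarrow> (1 - \<delta>) * ln (inrad n) \<ge> x1' \<Longrightarrow>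
    ln (M_D f D (exp ((1 - \<delta>) * ln (inrad n)))) \<le> ln (inrad (Suc n)) + 80 / \<delta>"
    using inrad_recursion by blast
  note result = that
  show thesis
  proof (rule iterate_comparison[of \<phi> "max x1 x1'" n0 "\<lambda>n. ln (inrad n)" 80])
    show "filterlim (\<lambda>n. ln (inrad n)) at_top sequentially"
      by (rule filterlim_compose[OF ln_at_top inrad_tendsto])
    show "\<phi> x * y \<le> \<phi> y * x" if "max x1 x1' \<le> x" "x \<le> y" for x y using x1 that by simp
    show "\<phi> ((1 - d) * ln (inrad n)) \<le> ln (inrad (Suc n)) + 80 / d"
      if "n \<ge> n0" "0 < d" "d < 1" "(1 - d) * ln (inrad n) \<ge> max x1 x1'" for n d
      using rec[of n d] that by (simp add: \<phi>_def)
    show thesis if "\<And>\<tau>. \<tau> \<ge> x2 \<Longrightarrow> \<exists>N0. \<forall>N\<ge>N0. \<forall>k. (\<phi> ^^ k) \<tau> \<le> ln (inrad (N + k))" for x2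
      by (rule result[OF that])
  qed (simp_all add: \<phi>_superlinear)
qed

lemma M_iterate_eq_exp:
  assumes "d \<in> D" "norm d \<le> exp \<tau>" "\<And>x. x \<ge> \<tau> \<Longrightarrow> x \<le> \<phi> x"
  shows "(M_D f D ^^ k) (exp \<tau>) = exp ((\<phi> ^^ k) \<tau>) \<and> (\<phi> ^^ k) \<tau> \<ge> \<tau>"
proof (induction k)
  case (Suc k)
  define x where "x = (\<phi> ^^ k) \<tau>"
  have x: "x \<ge> \<tau>" "(M_D f D ^^ k) (exp \<tau>) = exp x" using Suc by (auto simp: x_def)
  have "norm d \<le> exp x" using assms(2) x(1) by (meson exp_le_cancel_iff order_trans)
  then have "M_D f D (exp x) > 0" using M_gt_R[OF assms(1), of "exp x"] R_pos by simp
  then have "M_D f D (exp x) = exp (\<phi> x)" by (simp add: \<phi>_def)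
  then show ?case using x assms(3)[OF x(1)] by (simp add: x_def)
qed simp

text \<open>Below the modulus of the tract, \<open>M_D\<close> takes the junk value \<open>Sup {}\<close>; the large starting value \<open>\<tau>\<close>
  also dominates it.\<close>

lemma M_iterate_dominated:
  assumes gt: "\<And>r. r > \<rho>0 \<Longrightarrow> M_D f D r > r" and "\<rho> > \<rho>0"
  obtains \<tau> where "\<tau> \<ge> b" "\<And>x. x \<ge> \<tau> \<Longrightarrow> 2 * x \<le> \<phi> x" "\<tau> \<ge> 1"
    "\<And>k. (M_D f D ^^ k) \<rho> \<le> exp ((\<phi> ^^ k) \<tau>)"
proof -
  obtain d where d: "d \<in> D" using unbounded_D by (metis bounded_empty equals0I)
  obtain x0 where x0: "\<And>x. x \<ge> x0 \<Longrightarrow> 2 * x \<le> \<phi> x" using \<phi>_superlinear by blast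
  define r1 where "r1 = norm d"
  define c where "c = max (Sup {}) (M_D f D r1)"
  have small: "M_D f D r \<le> c" if "r \<le> r1" for r
  proof (cases "\<exists>z\<in>D. norm z = r")
    case True
    then obtain z where z: "z \<in> D" "norm z = r" by blast
    have "M_D f D r \<le> M_D f D r1"
      using M_mono[OF z(1), of r r1] z(2) that by simp
    then show ?thesis by (simp add: c_def)
  next
    case False
    then have "M_D f D r = Sup {}" unfolding M_D_def by (intro arg_cong[where f=Sup]) auto
    then show ?thesis by (simp add: c_def)
  qed
  define \<tau> where "\<tau> = Max {b, x0, 1, \<rho>, r1, c}"
  have t: "\<tau> \<ge> b" "\<tau> \<ge> x0" "\<tau> \<ge> 1" "\<tau> \<ge> \<rho>" "\<tau> \<ge> r1" "\<tau> \<ge> c"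
    by (auto simp: \<tau>_def)
  have et: "exp \<tau> \<ge> \<tau>" using exp_ge_add_one_self[of \<tau>] by linarith
  have two: "2 * x \<le> \<phi> x" if "x \<ge> \<tau>" for x using x0 t that by simp
  then have one: "x \<le> \<phi> x" if "x \<ge> \<tau>" for x using that t by fastforce
  have "norm d \<le> exp \<tau>" using t et by (simp add: r1_def)
  note eq = M_iterate_eq_exp[OF d this one]
  have "(M_D f D ^^ k) \<rho> > \<rho>0 \<and> (M_D f D ^^ k) \<rho> \<le> exp ((\<phi> ^^ k) \<tau>)" for k
  proof (induction k)
    case 0
    then show ?case using \<open>\<rho> > \<rho>0\<close> t et by simp
  next
    case (Suc k)
    define x where "x = (M_D f D ^^ k) \<rho>"
    define y where "y = (M_D f D ^^ k) (exp \<tau>)"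
    have xy: "x \<le> y" "x > \<rho>0" using Suc eq[of k] by (auto simp: x_def y_def)
    have "M_D f D x \<le> (M_D f D ^^ Suc k) (exp \<tau>)"
    proof (cases "x \<le> r1")
      case True
      have "c \<le> exp ((\<phi> ^^ Suc k) \<tau>)" using t et eq[of "Suc k"] by (meson exp_le_cancel_iff order_trans)
      then show ?thesis using small[OF True] eq[of "Suc k"] by simp
    next
      case False
      then show ?thesis using M_mono[OF d, of x y] xy(1) by (simp add: r1_def y_def)
    qed
    moreover have "M_D f D x > \<rho>0" using gt[OF xy(2)] xy(2) by simp
    ultimately show ?case using eq[of "Suc k"] by (simp add: x_def)
  qed
  then show thesis using that[OF t(1) two t(3)] by blast
qed

section \<open>Orbits that stay in the tract and outside the domains\<close>

lemma iterate_closure_U: "z \<in> closure (U n) \<Longrightarrow> (f ^^ k) z \<in> closure (U (n + k))"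
proof (induction k)
  case (Suc k)
  then show ?case using f_closure_U[of "n + k"] by auto
qed simp

text \<open>The domain \<open>U (n + k)\<close> lags one index behind the orbit of
  \<open>U (n + 1)\<close>. This slack lets the set contain the closure of \<open>U (n + 1)\<close>,
  boundary included.\<close>

definition itin :: "nat \<Rightarrow> complex set" where
  "itin n = {z. \<forall>k. (f ^^ k) z \<in> D \<and> (f ^^ k) z \<in> outer (U (n + k))}"

lemma closure_U_subset_itin: "closure (U (Suc n)) \<subseteq> itin n"
proof
  fix z assume z: "z \<in> closure (U (Suc n))"
  have "(f ^^ k) z \<in> closure (U (Suc (n + k)))" for k using iterate_closure_U[OF z, of k] by simp
  then show "z \<in> itin n" unfolding itin_def using closure_U closure_U_Suc by blast
qed

text \<open>The finite stages of \<open>itin n\<close>: closed and decreasing in \<open>k\<close>,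
  with all components unbounded. The last iterate, of index \<open>k\<close>, has to be outside but
  not yet in \<open>D\<close>.\<close>

fun pull_iter :: "nat \<Rightarrow> nat \<Rightarrow> complex set" where
  "pull_iter 0 n = outer (U n)"
| "pull_iter (Suc k) n = pull (pull_iter k (Suc n))"

lemma pull_mono: "A \<subseteq> B \<Longrightarrow> pull A \<subseteq> pull B"
  by (auto simp: pull_def)

lemma pull_iter_Suc_subset: "pull_iter (Suc k) n \<subseteq> pull_iter k n"
proof (induction k arbitrary: n)
  case 0
  then show ?case using pull_outer by simp
next
  case (Suc k)
  then show ?case using pull_mono[OF Suc[of "Suc n"]] by simp
qed

lemma pull_iter_subset_outer: "pull_iter k n \<subseteq> outer (U n)"
proof (induction k)
  case (Suc k)
  then show ?case using pull_iter_Suc_subset[of k n] by blast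
qed simp

lemma closed_pull_iter: "closed (pull_iter k n)"
proof (induction k arbitrary: n)
  case (Suc k)
  show ?case
    unfolding pull_iter.simps using pull_iter_subset_outer outer_gt_R
    by (intro closed_pull Suc) blast
qed (simp add: closed_outer_U)

lemma unbounded_component_pull_iter: "C \<in> components (pull_iter k n) \<Longrightarrow> \<not> bounded C"
proof (induction k arbitrary: n C)
  case 0
  then show ?case using outer_components by simp
next
  case (Suc k)
  show ?case
  proof (rule unbounded_component_pull[OF closed_pull_iter[of k "Suc n"]])
    show "pull_iter k (Suc n) \<subseteq> {w. norm w > R}"
      using pull_iter_subset_outer outer_gt_R by blast
  qed (use Suc in auto)
qed

lemma pull_iter_iterate: "z \<in> pull_iter k n \<Longrightarrow> j \<le> k \<Longrightarrow> (f ^^ j) z \<in> outer (U (n + j)) \<and> (j < k \<longrightarrow> (f ^^ j) z \<in> D)"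
proof (induction j arbitrary: k n z)
  case 0
  then have "z \<in> outer (U n)" using pull_iter_subset_outer by blast
  moreover have "z \<in> D" if "0 < k" using 0 that by (cases k) (auto simp: pull_def)
  ultimately show ?case by simp
next
  case (Suc j)
  then obtain k' where k: "k = Suc k'" by (cases k) auto
  then have "f z \<in> pull_iter k' (Suc n)" using Suc.prems by (simp add: pull_def)
  then have "(f ^^ j) (f z) \<in> outer (U (Suc n + j)) \<and> (j < k' \<longrightarrow> (f ^^ j) (f z) \<in> D)"
    by (rule Suc.IH) (use Suc.prems k in auto)
  then show ?case
    unfolding funpow_Suc_right o_apply k add_Suc_right add_Suc Suc_less_eq by blast
qed

lemma itin_eq: "itin n = (\<Inter>k. pull_iter k n)"
proof
  show "(\<Inter>k. pull_iter k n) \<subseteq> itin n"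
  proof
    fix z assume z: "z \<in> (\<Inter>k. pull_iter k n)"
    have "(f ^^ k) z \<in> D \<and> (f ^^ k) z \<in> outer (U (n + k))" for k
    proof -
      have "z \<in> pull_iter (Suc k) n" using z by blast
      from pull_iter_iterate[OF this, of k] show ?thesis by simp
    qed
    then show "z \<in> itin n" by (simp add: itin_def)
  qed
  have "z \<in> pull_iter k n" if "z \<in> itin n" for z k
    using that
  proof (induction k arbitrary: n z)
    case 0
    from 0[unfolded itin_def mem_Collect_eq, rule_format, of 0] show ?case by simp
  next
    case (Suc k)
    have "f z \<in> itin (Suc n)"
      unfolding itin_def
    proof (intro CollectI allI)
      fix k
      show "(f ^^ k) (f z) \<in> D \<and> (f ^^ k) (f z) \<in> outer (U (Suc n + k))"
        using Suc.prems[unfolded itin_def mem_Collect_eq, rule_format, of "Suc k"]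
        unfolding funpow_Suc_right o_apply add_Suc_right add_Suc by blast
    qed
    moreover have "z \<in> D"
      using Suc.prems[unfolded itin_def mem_Collect_eq, rule_format, of 0] by simp
    ultimately show ?case using Suc.IH by (simp add: pull_def)
  qed
  then show "itin n \<subseteq> (\<Inter>k. pull_iter k n)" by blast
qed

text \<open>A bounded component would, by Sura-Bura, lie in a bounded open \<open>W\<close> whose
  frontier misses \<open>itin n\<close>. But the component of \<open>z0\<close> in each
  \<open>pull_iter k n\<close> is unbounded and so crosses the compact frontier of \<open>W\<close>;
  by nested compactness the intersection of the stages meets this frontier too.\<close>

lemma unbounded_component_itin:
  assumes "z0 \<in> itin n"
  shows "\<not> bounded (connected_component_set (itin n) z0)"
proof
  define C where "C = connected_component_set (itin n) z0"
  assume "bounded (connected_component_set (itin n) z0)"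
  then have "bounded C" by (simp add: C_def)
  have cl: "closed (itin n)" unfolding itin_eq by (intro closed_INT ballI closed_pull_iter)
  have C: "C \<in> components (itin n)" using assms by (auto simp: C_def components_def)
  have "compact C" using \<open>bounded C\<close> closed_components[OF cl C] by (simp add: compact_eq_bounded_closed)
  then obtain K where K: "openin (top_of_set (itin n)) K" "compact K" "C \<subseteq> K"
    using Sura_Bura_clopen_subset[OF closed_imp_locally_compact[OF cl] C, of UNIV] by auto
  obtain T where T: "open T" "K = itin n \<inter> T" using K(1) by (auto simp: openin_open)
  have "closed (itin n - T)" using cl T(1) by (rule closed_Diff)
  moreover have "K \<inter> (itin n - T) = {}" using T by auto
  ultimately have "\<exists>e>0. \<forall>x\<in>K. \<forall>y\<in>itin n - T. e \<le> dist x y"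
    by (intro separate_compact_closed K)
  then obtain e where e: "e > 0" "\<And>x y. x \<in> K \<Longrightarrow> y \<in> itin n - T \<Longrightarrow> e \<le> dist x y"
    by (auto simp only: Ball_def)
  \<comment> \<open>Half the distance between \<open>K\<close> and the rest of
    \<open>itin n\<close>, so that the frontier avoids both.\<close>
  define W where "W = (\<Union>x\<in>K. ball x (e / 2))"
  have "open W" "K \<subseteq> W" using e(1) by (auto simp: W_def)
  have "bounded W"
  proof -
    obtain B where B: "\<And>x. x \<in> K \<Longrightarrow> norm x \<le> B" using compact_imp_bounded[OF K(2)] unfolding bounded_iff by blast
    have "norm w \<le> B + e / 2" if wW: "w \<in> W" for w
    proof -
      obtain x where x: "x \<in> K" "w \<in> ball x (e / 2)" using wW unfolding W_def by blast
      have "norm w \<le> norm x + norm (w - x)" by (metis norm_triangle_sub)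
      moreover have "norm (w - x) < e / 2" using x(2) by (simp add: dist_norm norm_minus_commute)
      ultimately show ?thesis using B[OF x(1)] by linarith
    qed
    then show ?thesis unfolding bounded_iff by blast
  qed
  have fr: "frontier W \<inter> itin n = {}"
  proof (rule ccontr)
    assume "frontier W \<inter> itin n \<noteq> {}"
    then obtain y where y: "y \<in> closure W" "y \<notin> W" "y \<in> itin n"
      using \<open>open W\<close> by (auto simp: frontier_def interior_open)
    then have "y \<in> itin n - T" using \<open>K \<subseteq> W\<close> T by blast
    obtain w where w: "w \<in> W" "dist w y < e / 2" using y(1) e(1) unfolding closure_approachable by (meson half_gt_zero)
    then obtain x where "x \<in> K" "w \<in> ball x (e / 2)" unfolding W_def by blast
    then have "dist x w < e / 2" by simp
    then have "dist x y < e" using w(2) dist_triangle[of x y w] by simp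
    then show False using e(2)[OF \<open>x \<in> K\<close> \<open>y \<in> itin n - T\<close>] by simp
  qed
  have "compact (frontier W)" using \<open>bounded W\<close> by (rule compact_frontier_bounded)
  moreover have "closed (pull_iter k n)" for k by (rule closed_pull_iter)
  moreover have "frontier W \<inter> pull_iter k n \<noteq> {}" for k
  proof -
    have z0: "z0 \<in> pull_iter k n" using assms by (auto simp: itin_eq)
    define E where "E = connected_component_set (pull_iter k n) z0"
    have "E \<in> components (pull_iter k n)" using z0 by (auto simp: E_def components_def)
    then have unb: "\<not> bounded E" by (rule unbounded_component_pull_iter)
    have "z0 \<in> E" using z0 by (simp add: E_def)
    moreover have "z0 \<in> C" using assms by (simp add: C_def)
    then have "z0 \<in> W" using K(3) \<open>K \<subseteq> W\<close> by blast
    ultimately have "E \<inter> W \<noteq> {}" by blast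
    moreover have "E - W \<noteq> {}" using unb \<open>bounded W\<close> bounded_subset by blast
    moreover have "connected E" by (simp add: E_def)
    ultimately have "E \<inter> frontier W \<noteq> {}" by (intro connected_Int_frontier)
    moreover have "E \<subseteq> pull_iter k n" by (simp add: E_def connected_component_subset)
    ultimately show ?thesis by blast
  qed
  ultimately have "frontier W \<inter> (\<Inter>k. pull_iter k n) \<noteq> {}"
  proof -
    assume cW: "compact (frontier W)" and clp: "\<And>k. closed (pull_iter k n)"
      and ne: "\<And>k. frontier W \<inter> pull_iter k n \<noteq> {}"
    have "(\<Inter>k. frontier W \<inter> pull_iter k n) \<noteq> {}"
    proof (rule compact_nest)
      show "compact (frontier W \<inter> pull_iter k n)" for k by (intro compact_Int_closed cW clp)
      show "frontier W \<inter> pull_iter k n \<noteq> {}" for k by (rule ne)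
      have "decseq (\<lambda>k. pull_iter k n)" by (rule decseq_SucI) (rule pull_iter_Suc_subset)
      then show "frontier W \<inter> pull_iter k' n \<subseteq> frontier W \<inter> pull_iter k n" if "k \<le> k'" for k k'
        using that by (auto dest: decseqD)
    qed
    then show ?thesis by auto
  qed
  then show False using fr by (simp add: itin_eq)
qed

lemma itin_growth:
  assumes "\<And>x. x \<ge> \<tau> \<Longrightarrow> 2 * x \<le> \<phi> x" "\<tau> \<ge> 1"
    and z: "\<And>k. norm ((f ^^ k) z) \<ge> exp ((\<phi> ^^ k) \<tau>)"
  shows "filterlim (\<lambda>n. norm ((f ^^ n) z)) at_top sequentially"
    and "filterlim (\<lambda>n. ln (ln (norm ((f ^^ n) z))) / real n) at_top sequentially"
proof -
  have ge: "(\<phi> ^^ k) \<tau> \<ge> \<tau> \<and> (\<phi> ^^ k) \<tau> \<ge> real k" for k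
  proof (induction k)
    case (Suc k)
    then have "2 * (\<phi> ^^ k) \<tau> \<le> \<phi> ((\<phi> ^^ k) \<tau>)" by (intro assms) auto
    then show ?case using Suc assms(2) by auto
  qed (use assms in auto)
  have "filterlim (\<lambda>k. (\<phi> ^^ k) \<tau>) at_top sequentially"
    by (rule filterlim_at_top_mono[OF filterlim_real_sequentially]) (use ge in auto)
  then have "filterlim (\<lambda>k. exp ((\<phi> ^^ k) \<tau>)) at_top sequentially"
    by (rule filterlim_compose[OF exp_at_top])
  then show "filterlim (\<lambda>n. norm ((f ^^ n) z)) at_top sequentially"
    by (rule filterlim_at_top_mono) (use z in auto)
  show "filterlim (\<lambda>n. ln (ln (norm ((f ^^ n) z))) / real n) at_top sequentially"
    unfolding filterlim_at_top
  proof
    fix Z :: real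
    \<comment> \<open>From index \<open>m\<close> on every step multiplies by at least
      \<open>\<Lambda>\<close>. The factor 2 in the exponent makes up for the first \<open>m\<close>
      steps, as \<open>n - m \<ge> n / 2\<close>.\<close>
    define \<Lambda> where "\<Lambda> = exp (2 * \<bar>Z\<bar>)"
    obtain x0 where x0: "\<And>x. x \<ge> x0 \<Longrightarrow> \<Lambda> * x \<le> \<phi> x" using \<phi>_superlinear by blast
    obtain m :: nat where m: "real m \<ge> x0" using real_arch_simple by blast
    have pow: "\<Lambda> ^ j \<le> (\<phi> ^^ (m + j)) \<tau>" for j
    proof (induction j)
      case 0
      then show ?case using ge[of m] assms(2) by simp
    next
      case (Suc j)
      have "\<Lambda> * \<Lambda> ^ j \<le> \<Lambda> * (\<phi> ^^ (m + j)) \<tau>" using Suc by (intro mult_left_mono) (auto simp: \<Lambda>_def)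
      also have "\<dots> \<le> \<phi> ((\<phi> ^^ (m + j)) \<tau>)" using ge[of "m + j"] m by (intro x0) simp
      finally show ?case by simp
    qed
    have "Z \<le> ln (ln (norm ((f ^^ n) z))) / real n" if n: "n \<ge> 2 * m + 1" for n
    proof -
      define j where "j = n - m"
      have j: "n = m + j" "2 * real j \<ge> real n" using n by (auto simp: j_def)
      have "exp (\<Lambda> ^ j) \<le> exp ((\<phi> ^^ n) \<tau>)" using pow[of j] j by simp
      also have "\<dots> \<le> norm ((f ^^ n) z)" by (rule z)
      finally have "\<Lambda> ^ j \<le> ln (norm ((f ^^ n) z))" by (metis exp_gt_zero ln_exp ln_mono)
      then have "ln (\<Lambda> ^ j) \<le> ln (ln (norm ((f ^^ n) z)))" by (intro ln_mono) (auto simp: \<Lambda>_def)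
      moreover have "ln (\<Lambda> ^ j) = real j * (2 * \<bar>Z\<bar>)" by (simp add: \<Lambda>_def ln_realpow)
      moreover have "Z * real n \<le> \<bar>Z\<bar> * (2 * real j)" using j by (intro mult_mono) auto
      ultimately have "Z * real n \<le> ln (ln (norm ((f ^^ n) z)))" by (simp add: mult_ac)
      then show ?thesis using n by (simp add: pos_le_divide_eq)
    qed
    then show "eventually (\<lambda>n. Z \<le> ln (ln (norm ((f ^^ n) z))) / real n) sequentially"
      unfolding eventually_sequentially by blast
  qed
qed

lemma itin_fast:
  assumes gt: "\<And>r. r > \<rho>0 \<Longrightarrow> M_D f D r > r" and "\<rho> > \<rho>0"
  obtains N where "\<And>n. n \<ge> N \<Longrightarrow> itin n \<subseteq> A_rho f D \<rho>"
    "\<And>n z. n \<ge> N \<Longrightarrow> z \<in> itin n \<Longrightarrow> filterlim (\<lambda>n. norm ((f ^^ n) z)) at_top sequentially"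
    "\<And>n z. n \<ge> N \<Longrightarrow> z \<in> itin n \<Longrightarrow> filterlim (\<lambda>n. ln (ln (norm ((f ^^ n) z))) / real n) at_top sequentially"
proof -
  obtain x2 where x2: "\<And>\<tau>. \<tau> \<ge> x2 \<Longrightarrow> \<exists>N0. \<forall>N\<ge>N0. \<forall>k. (\<phi> ^^ k) \<tau> \<le> ln (inrad (N + k))"
    using iterates_le_inrad by blast
  obtain \<tau> where t: "\<tau> \<ge> x2" "\<And>x. x \<ge> \<tau> \<Longrightarrow> 2 * x \<le> \<phi> x" "\<tau> \<ge> 1"
    "\<And>k. (M_D f D ^^ k) \<rho> \<le> exp ((\<phi> ^^ k) \<tau>)"
    using M_iterate_dominated[OF gt \<open>\<rho> > \<rho>0\<close>, of x2] by metis
  obtain N0 where N0: "\<And>N k. N \<ge> N0 \<Longrightarrow> (\<phi> ^^ k) \<tau> \<le> ln (inrad (N + k))" using x2[OF t(1)] by blast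
  have big: "norm ((f ^^ k) z) \<ge> exp ((\<phi> ^^ k) \<tau>)" if "n \<ge> N0" "z \<in> itin n" for n z k
  proof -
    have "(f ^^ k) z \<in> outer (U (n + k))" using that(2) by (simp add: itin_def)
    then have "norm ((f ^^ k) z) \<ge> inrad (n + k)" by (rule inrad_le)
    moreover have "inrad (n + k) > 0" using inrad_gt_R[of "n + k"] R_pos by linarith
    then have "inrad (n + k) \<ge> exp ((\<phi> ^^ k) \<tau>)" using N0[OF that(1), of k] by (metis exp_le_cancel_iff exp_ln)
    ultimately show ?thesis by linarith
  qed
  show thesis
  proof (rule that[of N0])
    show "itin n \<subseteq> A_rho f D \<rho>" if n: "n \<ge> N0" for n
    proof
      fix z assume z: "z \<in> itin n"
      have "(f ^^ k) z \<in> D" for k using z by (simp add: itin_def)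
      moreover from this[of 0] have "z \<in> D" by simp
      moreover have "(M_D f D ^^ k) \<rho> \<le> norm ((f ^^ k) z)" for k
        using t(4)[of k] big[OF n z, of k] by linarith
      ultimately show "z \<in> A_rho f D \<rho>" by (simp add: A_rho_def)
    qed
    show "filterlim (\<lambda>n. norm ((f ^^ n) z)) at_top sequentially" if "n \<ge> N0" "z \<in> itin n" for n z
      by (rule itin_growth(1)[OF t(2,3) big[OF that]])
    show "filterlim (\<lambda>n. ln (ln (norm ((f ^^ n) z))) / real n) at_top sequentially"
      if "n \<ge> N0" "z \<in> itin n" for n z
      by (rule itin_growth(2)[OF t(2,3) big[OF that]])
  qed
qed

section \<open>Separation of closures and boundary continua\<close>

lemma closure_U_subset_fill: "closure (U n) \<subseteq> fill (U (Suc n))"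
proof -
  have sub: "U n \<subseteq> - U (Suc n)" using U_disjoint[of n "Suc n"] by auto
  obtain H where H: "H \<in> components (- U (Suc n))" "U n \<subseteq> H"
    using exists_component_superset[OF sub _ connected_U] sub U_nonempty by blast
  \<comment> \<open>\<open>fill (U (Suc n))\<close> is open, so the inclusion does not pass to
    limits directly; the complementary component around \<open>U n\<close> is closed and
    does.\<close>
  have "closed H" using closed_components[OF _ H(1)] open_U by blast
  then have "closure (U n) \<subseteq> H" using H(2) closure_minimal by blast
  moreover have "H \<inter> outer (U (Suc n)) = {}"
  proof -
    have "U n \<subseteq> fill (U (Suc n))" using fill_U_mono subset_fill by blast
    then have "\<not> H \<subseteq> outer (U (Suc n))" using H(2) U_nonempty[of n] by (auto simp: outer_def)
    then show ?thesis
      using components_eq[OF H(1) outer_in_components(1)[OF bounded_U]] by blast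
  qed
  ultimately show ?thesis by (auto simp: outer_def)
qed

lemma fill_U_le: "m \<le> n \<Longrightarrow> fill (U m) \<subseteq> fill (U n)"
  by (rule lift_Suc_mono_le[of "\<lambda>n. fill (U n)"]) (rule fill_U_mono)

text \<open>The gap in the indices leaves room for a filled domain that separates the two closures;
  hence continua will be taken from every second domain.\<close>

lemma closures_disjoint: assumes "m + 1 < n" shows "closure (U m) \<inter> closure (U n) = {}"
proof -
  obtain k where n: "n = Suc k" using assms by (cases n) auto
  have "closure (U m) \<subseteq> fill (U k)"
    using closure_U_subset_fill[of m] fill_U_le[of "Suc m" k] assms n by auto
  moreover have "closure (U n) \<subseteq> outer (U k)" using closure_U_Suc n by simp
  ultimately show ?thesis by (auto simp: outer_def)
qed

text \<open>The frontier of the hole containing 0 is connected because \<open>U n\<close> is. It is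
  not contained in a point \<open>a\<close>: the plane without \<open>a\<close> is connected and
  meets both the bounded hole, which contains a disc, and its complement.\<close>

lemma frontier_continuum:
  obtains K where "compact K" "connected K" "\<nexists>a. K \<subseteq> {a}" "K \<subseteq> frontier (U n)"
proof -
  define C where "C = connected_component_set (- U n) 0"
  have 0: "0 \<in> - U n" "0 \<in> fill (U n)" using surrounds by auto
  have C: "C \<in> components (- U n)" using 0 by (auto simp: C_def components_def)
  have "0 \<in> C" using 0 by (simp add: C_def)
  then have "C \<noteq> outer (U n)" using 0 by (auto simp: outer_def)
  then have bC: "bounded C"
    using cobounded_unique_unbounded_components[of "- U n" "outer (U n)" C] C bounded_U
      outer_in_components[OF bounded_U] by auto
  have "ball 0 R \<subseteq> C" unfolding C_def
    using U_gt_R[of _ n] R_pos by (intro connected_component_maximal) force+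
  show thesis
  proof (rule that[of "frontier C"])
    show "compact (frontier C)" using bC by (rule compact_frontier_bounded)
    show "connected (frontier C)" by (rule connected_frontier_component_complement[OF connected_U C])
    have "frontier C \<subseteq> frontier (- U n)" by (rule frontier_of_components_subset[OF C])
    then show "frontier C \<subseteq> frontier (U n)" by (simp add: frontier_complement)
    show "\<nexists>a. frontier C \<subseteq> {a}"
    proof
      assume "\<exists>a. frontier C \<subseteq> {a}"
      then obtain a where a: "frontier C \<subseteq> {a}" by blast
      have "connected (- {a})" by (rule connected_punctured_universe) simp
      moreover have "- {a} \<inter> C \<noteq> {}"
      proof -
        have "of_real (R / 2) \<in> C" using \<open>ball 0 R \<subseteq> C\<close> R_pos by (auto simp: subset_eq)
        moreover have "of_real (R / 2) \<noteq> (0::complex)" using R_pos by simp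
        ultimately show ?thesis using \<open>0 \<in> C\<close> by (metis ComplI IntI emptyE singletonD)
      qed
      moreover have "- {a} - C \<noteq> {}"
      proof
        assume "- {a} - C = {}"
        then have "UNIV \<subseteq> insert a C" by blast
        then have "bounded (UNIV :: complex set)" using bC bounded_subset bounded_insert by blast
        then show False using not_bounded_UNIV by blast
      qed
      ultimately have "- {a} \<inter> frontier C \<noteq> {}" by (rule connected_Int_frontier)
      then show False using a by blast
    qed
  qed
qed

end

section \<open>Fatou components\<close>

locale transcendental =
  fixes f :: "complex \<Rightarrow> complex"
  assumes transcendental: "transcendental_meromorphic f"
begin

lemma ball_holomorphic:
  assumes "\<not> is_pole f z"
  obtains e where "e > 0" "f holomorphic_on ball z e" "\<And>w. w \<in> ball z e \<Longrightarrow> \<not> is_pole f w"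
proof -
  have "f analytic_on {z}"
    using transcendental assms analytic_on_subset[of f "{z. \<not> is_pole f z}" "{z}"]
    by (auto simp: transcendental_meromorphic_def)
  then obtain e where e: "e > 0" "f holomorphic_on ball z e"
    by (auto simp: analytic_on_def)
  then show thesis
    using that[of e] not_is_pole_holomorphic[OF open_ball _ e(2)] by blast
qed

lemma isCont_f: assumes "\<not> is_pole f z" shows "isCont f z"
proof -
  obtain e where "e > 0" "f holomorphic_on ball z e" using ball_holomorphic[OF assms] by blast
  then show ?thesis
    using holomorphic_on_imp_continuous_on continuous_on_eq_continuous_at[OF open_ball] by (metis centre_in_ball)
qed

text \<open>Constancy near one point spreads to all non-poles by the identity theorem for
  meromorphic functions, and \<open>f\<close> would be rational. This makes the open mapping theorem
  applicable near Fatou points.\<close>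

lemma nonconstant_ball:
  assumes "e > 0" "f holomorphic_on ball z e" shows "\<not> f constant_on ball z e"
proof
  assume "f constant_on ball z e"
  then obtain c where c: "\<And>w. w \<in> ball z e \<Longrightarrow> f w = c" by (auto simp: constant_on_def)
  have mero: "f meromorphic_on UNIV" using transcendental by (simp add: transcendental_meromorphic_def)
  have "eventually (\<lambda>w. w \<in> ball z e) (at z)"
    using assms(1) by (intro eventually_at_in_open') auto
  then have ev: "eventually (\<lambda>w. f w = c) (at z)"
    by (rule eventually_mono) (use c in auto)
  have "eventually (\<lambda>w. f w = c) (cosparse UNIV) \<or> eventually (\<lambda>w. f w \<noteq> c) (cosparse UNIV)"
    by (rule meromorphic_imp_constant_or_avoid[OF mero]) auto
  then have const: "eventually (\<lambda>w. f w = c) (at w)" for w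
  proof
    assume "eventually (\<lambda>w. f w \<noteq> c) (cosparse UNIV)"
    then have "eventually (\<lambda>w. f w \<noteq> c) (at z)" by (simp add: eventually_cosparse_open_eq)
    with ev have "eventually (\<lambda>w. False) (at z)" by eventually_elim simp
    then show ?thesis by simp
  qed (simp add: eventually_cosparse_open_eq)
  have "f w = c" if "\<not> is_pole f w" for w
  proof -
    have "f \<midarrow>w\<rightarrow> f w" using isCont_f[OF that] by (simp add: isCont_def)
    moreover have "f \<midarrow>w\<rightarrow> c" using const[of w] by (rule tendsto_eventually)
    ultimately show ?thesis using LIM_unique by blast
  qed
  then have "\<forall>w. \<not> is_pole f w \<and> poly [:1::complex:] w \<noteq> 0 \<longrightarrow> f w = poly [:c:] w / poly [:1:] w"
    by simp
  then show False
    using transcendental unfolding transcendental_meromorphic_def by (metis one_pCons one_neq_zero)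
qed

lemma iterates_defined_f: "iterates_defined f z \<Longrightarrow> iterates_defined f (f z)"
  unfolding iterates_defined_def
proof
  fix k assume "\<forall>k. \<not> is_pole f ((f ^^ k) z)"
  then have "\<not> is_pole f ((f ^^ Suc k) z)" by blast
  then show "\<not> is_pole f ((f ^^ k) (f z))" unfolding funpow_Suc_right o_apply .
qed

lemma fatou_iterates_defined: "z \<in> fatou f \<Longrightarrow> iterates_defined f z"
  unfolding fatou_def by blast

lemma fatou_not_pole: assumes "z \<in> fatou f" shows "\<not> is_pole f z"
proof -
  have "\<not> is_pole f ((f ^^ 0) z)"
    using fatou_iterates_defined[OF assms] unfolding iterates_defined_def by blast
  then show ?thesis by simp
qed

lemma open_fatou: "open (fatou f)"
proof (subst open_subopen, intro ballI)
  fix z assume "z \<in> fatou f"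
  then obtain W where W: "open W" "z \<in> W" "\<forall>w\<in>W. iterates_defined f w" "normal_family W (range (\<lambda>n. f ^^ n))"
    unfolding fatou_def by blast
  have "W \<subseteq> fatou f"
    unfolding fatou_def by (intro subsetI CollectI exI[of _ W] conjI W)
  then show "\<exists>T. open T \<and> z \<in> T \<and> T \<subseteq> fatou f"
    using W(1,2) by (intro exI[of _ W] conjI)
qed

text \<open>A sequence \<open>f ^^ k n\<close> on the image is the sequence
  \<open>f ^^ Suc (k n)\<close> upstairs. Uniform convergence on the single compact set
  \<open>L\<close> is carried over by choosing one preimage \<open>p y\<close> in \<open>L\<close>
  for each \<open>y\<close>, so injectivity plays no part.\<close>

lemma normal_family_image:
  assumes "compact L" "L \<subseteq> W" and normal: "normal_family W (range (\<lambda>n. f ^^ n))" and "V \<subseteq> f ` L"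
  shows "normal_family V (range (\<lambda>n. f ^^ n))"
  unfolding normal_family_def
proof (intro allI impI)
  fix g :: "nat \<Rightarrow> complex \<Rightarrow> complex" assume "\<forall>n. g n \<in> range (\<lambda>n. f ^^ n)"
  then have "\<forall>n. \<exists>k. g n = f ^^ k" by blast
  then have "\<exists>k. \<forall>n. g n = f ^^ k n" by (rule choice)
  then obtain k where k: "\<And>n. g n = f ^^ k n" by (elim exE) simp
  have gk: "g n (f w) = (f ^^ Suc (k n)) w" for n w
    unfolding k funpow_Suc_right o_apply ..
  have "\<exists>r. strict_mono r \<and>
     ((\<exists>h. \<forall>K. compact K \<and> K \<subseteq> W \<longrightarrow> uniform_limit K (\<lambda>n. f ^^ Suc (k (r n))) h sequentially) \<or>
      (\<forall>K. compact K \<and> K \<subseteq> W \<longrightarrow>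
         (\<forall>B. eventually (\<lambda>n. \<forall>z\<in>K. B \<le> norm ((f ^^ Suc (k (r n))) z)) sequentially)))"
    by (rule normal[unfolded normal_family_def, rule_format, of "\<lambda>n. f ^^ Suc (k n)"]) blast
  then obtain r where r: "strict_mono r" and
    alt: "(\<exists>h. \<forall>K. compact K \<and> K \<subseteq> W \<longrightarrow> uniform_limit K (\<lambda>n. f ^^ Suc (k (r n))) h sequentially) \<or>
      (\<forall>K. compact K \<and> K \<subseteq> W \<longrightarrow>
         (\<forall>B. eventually (\<lambda>n. \<forall>z\<in>K. B \<le> norm ((f ^^ Suc (k (r n))) z)) sequentially))"
    by blast
  define p where "p y = (SOME w. w \<in> L \<and> f w = y)" for y
  have p: "p y \<in> L \<and> f (p y) = y" if "y \<in> f ` L" for y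
    unfolding p_def by (rule someI_ex) (use that in auto)
  have "(\<exists>h. \<forall>K. compact K \<and> K \<subseteq> V \<longrightarrow> uniform_limit K (\<lambda>n. g (r n)) h sequentially) \<or>
     (\<forall>K. compact K \<and> K \<subseteq> V \<longrightarrow> (\<forall>B. eventually (\<lambda>n. \<forall>z\<in>K. B \<le> norm (g (r n) z)) sequentially))"
    using alt
  proof
    assume "\<exists>h. \<forall>K. compact K \<and> K \<subseteq> W \<longrightarrow> uniform_limit K (\<lambda>n. f ^^ Suc (k (r n))) h sequentially"
    then obtain h where h: "uniform_limit L (\<lambda>n. f ^^ Suc (k (r n))) h sequentially"
      using assms(1,2) by blast
    have "uniform_limit (f ` L) (\<lambda>n. g (r n)) (h \<circ> p) sequentially"
      unfolding uniform_limit_iff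
    proof (intro allI impI)
      fix e :: real assume "e > 0"
      with h have "\<forall>\<^sub>F n in sequentially. \<forall>x\<in>L. dist ((f ^^ Suc (k (r n))) x) (h x) < e"
        unfolding uniform_limit_iff by blast
      then show "\<forall>\<^sub>F n in sequentially. \<forall>y\<in>f ` L. dist (g (r n) y) ((h \<circ> p) y) < e"
      proof eventually_elim
        case (elim n)
        show ?case
        proof
          fix y assume "y \<in> f ` L"
          then have "p y \<in> L" "f (p y) = y" using p by auto
          then show "dist (g (r n) y) ((h \<circ> p) y) < e"
            using elim gk[of "r n" "p y"] by (metis comp_apply)
        qed
      qed
    qed
    then show ?thesis using uniform_limit_on_subset assms(4) by (metis order_trans)
  next
    assume inf: "\<forall>K. compact K \<and> K \<subseteq> W \<longrightarrow>
         (\<forall>B. eventually (\<lambda>n. \<forall>z\<in>K. B \<le> norm ((f ^^ Suc (k (r n))) z)) sequentially)"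
    have "eventually (\<lambda>n. \<forall>y\<in>f ` L. B \<le> norm (g (r n) y)) sequentially" for B
    proof -
      have "eventually (\<lambda>n. \<forall>z\<in>L. B \<le> norm ((f ^^ Suc (k (r n))) z)) sequentially"
        using inf assms(1,2) by blast
      then show ?thesis by eventually_elim (use gk in auto)
    qed
    then have "eventually (\<lambda>n. \<forall>y\<in>K. B \<le> norm (g (r n) y)) sequentially" if "K \<subseteq> V" for K B
      by (rule eventually_mono) (use that assms(4) in blast)
    then show ?thesis by blast
  qed
  then show "\<exists>r. strict_mono r \<and>
           ((\<exists>h. \<forall>K. compact K \<and> K \<subseteq> V \<longrightarrow> uniform_limit K (\<lambda>n. g (r n)) h sequentially)
            \<or> (\<forall>K. compact K \<and> K \<subseteq> V \<longrightarrow>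
                 (\<forall>B. eventually (\<lambda>n. \<forall>z\<in>K. B \<le> norm (g (r n) z)) sequentially)))"
    using r by blast
qed

lemma f_fatou: "f ` fatou f \<subseteq> fatou f"
proof
  fix y assume "y \<in> f ` fatou f"
  then obtain z where z: "z \<in> fatou f" "y = f z" by blast
  obtain W where W: "open W" "z \<in> W" "\<And>w. w\<in>W \<Longrightarrow> iterates_defined f w" "normal_family W (range (\<lambda>n. f ^^ n))"
    using z(1) unfolding fatou_def by blast
  obtain e1 where e1: "e1 > 0" "f holomorphic_on ball z e1"
    using ball_holomorphic[OF fatou_not_pole[OF z(1)]] by blast
  obtain e2 where e2: "e2 > 0" "cball z e2 \<subseteq> W" using W(1,2) open_contains_cball by blast
  define e where "e = min e1 e2"
  have e: "e > 0" "ball z e \<subseteq> ball z e1" "cball z e \<subseteq> W"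
    using e1 e2 by (auto simp: e_def subset_eq)
  have holo: "f holomorphic_on ball z e" using e1(2) e(2) holomorphic_on_subset by blast
  have op: "open (f ` ball z e)"
    by (rule open_mapping_thm[OF holo _ _ _ _ nonconstant_ball[OF e(1) holo]]) auto
  show "y \<in> fatou f"
    unfolding fatou_def
  proof (intro CollectI exI conjI ballI)
    show "open (f ` ball z e)" by (rule op)
    show "y \<in> f ` ball z e" using z(2) e(1) by auto
    show "iterates_defined f w" if "w \<in> f ` ball z e" for w
      using that W(3) e(3) iterates_defined_f by (auto simp: subset_eq)
    show "normal_family (f ` ball z e) (range (\<lambda>n. f ^^ n))"
      by (rule normal_family_image[OF compact_cball e(3) W(4)]) (use ball_subset_cball in blast)
  qed
qed

lemma continuous_on_fatou: "continuous_on (fatou f) f"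
  by (intro continuous_at_imp_continuous_on ballI isCont_f fatou_not_pole)

lemma connected_iterate_image:
  assumes "connected S" "S \<subseteq> fatou f" shows "connected ((f ^^ n) ` S) \<and> (f ^^ n) ` S \<subseteq> fatou f"
proof (induction n)
  case (Suc n)
  have eq: "(f ^^ Suc n) ` S = f ` (f ^^ n) ` S" unfolding image_comp funpow.simps(2) ..
  have "continuous_on ((f ^^ n) ` S) f"
    using Suc continuous_on_subset[OF continuous_on_fatou] by blast
  then have "connected (f ` (f ^^ n) ` S)" using Suc connected_continuous_image by blast
  moreover have "f ` (f ^^ n) ` S \<subseteq> fatou f" using Suc f_fatou image_mono by blast
  ultimately show ?case unfolding eq by blast
qed (use assms in auto)

text \<open>Existence and uniqueness behind the definite description: a connected nonempty subset of
  the Fatou set lies in exactly one component.\<close>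

lemma fatou_comp_iter:
  assumes U: "U \<in> components (fatou f)"
  shows "fatou_comp_iter f U n \<in> components (fatou f)" "(f ^^ n) ` U \<subseteq> fatou_comp_iter f U n"
proof -
  have ne: "(f ^^ n) ` U \<noteq> {}" using in_components_nonempty[OF U] by blast
  have "connected ((f ^^ n) ` U)" "(f ^^ n) ` U \<subseteq> fatou f"
    using connected_iterate_image in_components_connected[OF U] in_components_subset[OF U] by blast+
  then obtain V where V: "V \<in> components (fatou f)" "(f ^^ n) ` U \<subseteq> V"
    using exists_component_superset[of "(f ^^ n) ` U" "fatou f"] ne in_components_nonempty by blast
  have "\<exists>!V. V \<in> components (fatou f) \<and> (f ^^ n) ` U \<subseteq> V"
  proof (rule ex1I[of _ V])
    fix V' assume V': "V' \<in> components (fatou f) \<and> (f ^^ n) ` U \<subseteq> V'"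
    then have "V' \<inter> V \<noteq> {}" using V ne by blast
    then show "V' = V" using V' V components_eq by blast
  qed (use V in blast)
  from theI'[OF this] show "fatou_comp_iter f U n \<in> components (fatou f)" "(f ^^ n) ` U \<subseteq> fatou_comp_iter f U n"
    unfolding fatou_comp_iter_def by blast+
qed

lemma f_fatou_comp_iter:
  assumes U: "U \<in> components (fatou f)"
  shows "f ` fatou_comp_iter f U n \<subseteq> fatou_comp_iter f U (Suc n)"
proof (rule components_maximal[OF fatou_comp_iter(1)[OF U]])
  have C: "fatou_comp_iter f U n \<in> components (fatou f)" by (rule fatou_comp_iter(1)[OF U])
  have "connected ((f ^^ 1) ` fatou_comp_iter f U n) \<and> (f ^^ 1) ` fatou_comp_iter f U n \<subseteq> fatou f"
    by (rule connected_iterate_image[OF in_components_connected[OF C] in_components_subset[OF C]])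
  then show "connected (f ` fatou_comp_iter f U n)" "f ` fatou_comp_iter f U n \<subseteq> fatou f" by simp_all
  have "(f ^^ Suc n) ` U = f ` (f ^^ n) ` U" unfolding image_comp funpow.simps(2) ..
  then have "(f ^^ Suc n) ` U \<subseteq> f ` fatou_comp_iter f U n"
    using fatou_comp_iter(2)[OF U, of n] by blast
  moreover have "(f ^^ Suc n) ` U \<subseteq> fatou_comp_iter f U (Suc n)" by (rule fatou_comp_iter(2)[OF U])
  moreover have "(f ^^ Suc n) ` U \<noteq> {}" using in_components_nonempty[OF U] by blast
  ultimately show "fatou_comp_iter f U (Suc n) \<inter> f ` fatou_comp_iter f U n \<noteq> {}" by blast
qed

lemma fatou_comp_iter_0:
  assumes U: "U \<in> components (fatou f)" shows "fatou_comp_iter f U 0 = U"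
  using components_eq[OF fatou_comp_iter(1)[OF U] U] fatou_comp_iter(2)[OF U, of 0] in_components_nonempty[OF U]
  by (metis Int_absorb1 funpow_0 image_ident image_cong)

lemma frontier_component_julia:
  assumes "V \<in> components (fatou f)" shows "frontier V \<subseteq> julia f"
proof -
  have "frontier V \<subseteq> frontier (fatou f)" by (rule frontier_of_components_subset[OF assms])
  then show ?thesis using open_fatou by (auto simp: julia_def frontier_def interior_open)
qed

text \<open>Near a pole \<open>|f|\<close> exceeds every bound, while \<open>V\<close> would
  accumulate there with a bounded image. It makes \<open>f\<close> continuous on the closures of the
  early components, which are not known to lie in \<open>D\<close>.\<close>

lemma closure_not_pole:
  assumes V: "V \<in> components (fatou f)" and "bounded (f ` V)" and "z \<in> closure V"
  shows "\<not> is_pole f z"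
proof
  assume pole: "is_pole f z"
  have "z \<notin> V" using pole fatou_not_pole in_components_subset[OF V] by blast
  then have "z islimpt V" using assms(3) by (simp add: closure_def)
  obtain B where B: "\<And>w. w \<in> V \<Longrightarrow> norm (f w) \<le> B" using assms(2) unfolding bounded_iff by blast
  have ev: "eventually (\<lambda>w. norm (f w) > B) (at z)"
    using pole unfolding is_pole_def filterlim_at_infinity_conv_norm_at_top filterlim_at_top_dense by blast
  have "frequently (\<lambda>w. w \<in> V) (at z)"
    using \<open>z islimpt V\<close> by (simp add: islimpt_conv_frequently_at)
  from frequently_ex[OF frequently_eventually_frequently[OF this ev]]
  obtain w where "w \<in> V" "norm (f w) > B" by blast
  then show False using B[of w] by simp
qed

end

section \<open>Baker wandering domains\<close>

lemma direct_tract_imp_tract: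
  assumes "direct_tract f D R" shows "tract f D R"
proof
  have D: "open D" "\<not> bounded D" "\<not> bounded (- D)" using assms by (simp_all add: direct_tract_def)
  then show "frontier D \<noteq> {}"
    using not_bounded_UNIV by (metis Compl_UNIV_eq bounded_empty frontier_eq_empty)
qed (use assms in \<open>auto simp: direct_tract_def\<close>)

locale baker = transcendental +
  fixes U :: "complex set"
  assumes baker: "baker_wandering_domain f U"
begin

abbreviation V :: "nat \<Rightarrow> complex set" where "V n \<equiv> fatou_comp_iter f U n"

lemma U_component: "U \<in> components (fatou f)"
  using baker by (simp add: baker_wandering_domain_def)

lemmas V_component = fatou_comp_iter(1)[OF U_component]
lemmas f_V = f_fatou_comp_iter[OF U_component]

lemma open_V: "open (V n)" and connected_V: "connected (V n)" and V_nonempty: "V n \<noteq> {}"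
  using V_component open_components[OF open_fatou] in_components_connected in_components_nonempty
  by blast+

lemma V_disjoint: "m \<noteq> n \<Longrightarrow> V m \<inter> V n = {}"
  using baker components_eq[OF V_component V_component, of m n]
  unfolding baker_wandering_domain_def by blast

lemma V_tendsto: "eventually (\<lambda>n. \<forall>z\<in>V n. B \<le> norm z) sequentially"
  using baker by (simp add: baker_wandering_domain_def)

lemma V_eventually: "eventually (\<lambda>n. bounded (V n) \<and> 0 \<in> fill (V n) - V n) sequentially"
proof -
  have "eventually (\<lambda>n. bounded (V n) \<and> \<not> simply_connected (V n) \<and> 0 \<in> fill (V n) - V n) sequentially"
    using baker by (simp add: baker_wandering_domain_def)
  then show ?thesis by eventually_elim simp
qed

lemma V_eventually_meets:
  assumes "connected S" "\<not> bounded S"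
  shows "eventually (\<lambda>n. S \<inter> V n \<noteq> {}) sequentially"
proof -
  obtain x where x: "x \<in> S" using assms(2) by (metis bounded_empty equals0I)
  show ?thesis
    using V_eventually V_tendsto[of "norm x + 1"]
  proof eventually_elim
    case (elim n)
    then show ?case by (intro unbounded_connected_meets[OF _ _ assms x]) force+
  qed
qed

text \<open>Extends boundedness from large indices to all: an unbounded component would meet the
  later ones, from which it is disjoint.\<close>

lemma bounded_V: "bounded (V n)"
proof (rule ccontr)
  assume "\<not> bounded (V n)"
  then have "eventually (\<lambda>k. V n \<inter> V k \<noteq> {} \<and> k > n) sequentially"
    by (intro eventually_conj V_eventually_meets connected_V eventually_gt_at_top)
  then obtain k where "V n \<inter> V k \<noteq> {}" "k > n"
    using eventually_happens'[OF sequentially_bot] by blast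
  then show False using V_disjoint[of n k] by simp
qed

lemma f_closure_V: "f ` closure (V n) \<subseteq> closure (V (Suc n))"
proof -
  have "bounded (f ` V n)" using bounded_subset[OF bounded_V f_V] .
  then have "continuous_on (closure (V n)) f"
    by (intro continuous_at_imp_continuous_on ballI isCont_f closure_not_pole[OF V_component])
  then have "f ` closure (V n) \<subseteq> closure (f ` V n)"
    by (intro image_closure_subset closed_closure closure_subset)
  then show ?thesis using closure_mono[OF f_V] by blast
qed

lemma iterate_closure_V: "z \<in> closure U \<Longrightarrow> (f ^^ n) z \<in> closure (V n)"
proof (induction n)
  case 0
  then show ?case using fatou_comp_iter_0[OF U_component] by simp
next
  case (Suc n)
  then show ?case using f_closure_V by auto
qed

text \<open>The unbounded connected \<open>D\<close> meets \<open>V n\<close> for large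
  \<open>n\<close>. On \<open>V n\<close> the values of \<open>f\<close> lie in
  \<open>V (n + 1)\<close>, far from the circle of radius \<open>R\<close>, so \<open>V n\<close>
  cannot cross the frontier of \<open>D\<close>; the margin \<open>R + 1\<close> keeps the closure
  inside as well.\<close>

lemma V_eventually_in_tract:
  assumes D: "direct_tract f D R"
  shows "eventually (\<lambda>n. closure (V n) \<subseteq> D \<and> (\<forall>z\<in>V n. norm z > R)) sequentially"
proof -
  interpret tract f D R by (rule direct_tract_imp_tract[OF D])
  obtain N where N: "\<And>n z. n \<ge> N \<Longrightarrow> z \<in> V n \<Longrightarrow> norm z \<ge> R + 1"
    using V_tendsto[of "R + 1"] unfolding eventually_sequentially by blast
  have "eventually (\<lambda>n. D \<inter> V n \<noteq> {}) sequentially"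
    by (rule V_eventually_meets[OF connected_D unbounded_D])
  then show ?thesis
    using eventually_ge_at_top[of N]
  proof eventually_elim
    case (elim n)
    have f_ge: "norm (f z) \<ge> R + 1" if "z \<in> V n" for z
    proof -
      have "f z \<in> V (Suc n)" using that f_V by blast
      then show ?thesis using N[of "Suc n"] elim by simp
    qed
    have "V n \<inter> frontier D = {}" using f_ge norm_frontier by force
    then have "V n - D = {}" using connected_Int_frontier[OF connected_V] elim by blast
    then have cl: "closure (V n) \<subseteq> closure D" by (intro closure_mono) auto
    have "f ` closure (V n) \<subseteq> {w. norm w \<ge> R + 1}"
    proof (rule image_closure_subset)
      show "continuous_on (closure (V n)) f" using cont cl continuous_on_subset by blast
      show "closed {w::complex. norm w \<ge> R + 1}" by (intro closed_Collect_le continuous_intros)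
    qed (use f_ge in auto)
    then have "closure (V n) \<subseteq> D" using in_D_iff cl by force
    moreover have "\<forall>z\<in>V n. norm z > R" using N elim by force
    ultimately show ?case by blast
  qed
qed

text \<open>Two unbounded components of \<open>A\<close> both meet some connected \<open>V n\<close>
  contained in \<open>A\<close>, so they coincide; \<open>S\<close> provides existence.\<close>

lemma unique_unbounded_component:
  assumes S: "connected S" "\<not> bounded S" "S \<subseteq> A"
    and VA: "eventually (\<lambda>n. V n \<subseteq> A) sequentially"
  shows "\<exists>!C. C \<in> components A \<and> \<not> bounded C"
proof (rule ex_ex1I)
  have "S \<noteq> {}" using S(2) by auto
  then obtain C where "C \<in> components A" "S \<subseteq> C"
    using exists_component_superset[OF S(3) _ S(1)] S(3) by blast
  then show "\<exists>C. C \<in> components A \<and> \<not> bounded C" using S(2) bounded_subset by blast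
next
  fix C C' assume C: "C \<in> components A \<and> \<not> bounded C" and C': "C' \<in> components A \<and> \<not> bounded C'"
  have "eventually (\<lambda>n. V n \<subseteq> A \<and> C \<inter> V n \<noteq> {} \<and> C' \<inter> V n \<noteq> {}) sequentially"
    using C C' in_components_connected by (intro eventually_conj VA V_eventually_meets) auto
  then obtain n where n: "V n \<subseteq> A" "C \<inter> V n \<noteq> {}" "C' \<inter> V n \<noteq> {}"
    using eventually_happens'[OF sequentially_bot] by blast
  have "V n \<subseteq> C" "V n \<subseteq> C'"
    using components_maximal[OF _ connected_V n(1)] C C' n(2,3) by blast+
  then show "C = C'" using components_eq[of C A C'] C C' V_nonempty[of n] by blast
qed

lemma tail_wandering_tract:
  assumes "direct_tract f D R"
  obtains N where "wandering_tract f D R (\<lambda>n. V (n + N))"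
proof -
  have "eventually (\<lambda>n. (bounded (V n) \<and> 0 \<in> fill (V n) - V n) \<and>
      (closure (V n) \<subseteq> D \<and> (\<forall>z\<in>V n. norm z > R))) sequentially"
    by (intro eventually_conj V_eventually V_eventually_in_tract assms)
  then obtain N where N: "\<And>n. n \<ge> N \<Longrightarrow> (bounded (V n) \<and> 0 \<in> fill (V n) - V n) \<and>
      (closure (V n) \<subseteq> D \<and> (\<forall>z\<in>V n. norm z > R))"
    unfolding eventually_sequentially by blast
  interpret tract f D R by (rule direct_tract_imp_tract[OF assms])
  show thesis
  proof (rule that[of N], unfold_locales)
    show "\<not> bounded (- D)" using assms by (simp add: direct_tract_def)
    show "eventually (\<lambda>n. \<forall>z\<in>V (n + N). B \<le> norm z) sequentially" for B
      using V_tendsto[of B] by (rule sequentially_offset)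
    show "f ` V (n + N) \<subseteq> V (Suc n + N)" for n using f_V[of "n + N"] by simp
    show "norm z > R" if "z \<in> V (n + N)" for n z using N[of "n + N"] that by simp
    show "0 \<in> fill (V (n + N)) - V (n + N)" for n using N[of "n + N"] by simp
    show "closure (V (n + N)) \<subseteq> D" for n using N[of "n + N"] by simp
    show "V (m + N) \<inter> V (n + N) = {}" if "m \<noteq> n" for m n using that by (intro V_disjoint) simp
  qed (rule open_V connected_V bounded_V V_nonempty)+
qed

end

theorem theorem5p1:
  fixes f :: "complex \<Rightarrow> complex" and D U :: "complex set" and R \<rho>\<^sub>0 \<rho> :: real
  assumes "transcendental_meromorphic f"
    and "direct_tract f D R"
    and "baker_wandering_domain f U"
    and "\<rho>\<^sub>0 > R" and "\<forall>r > \<rho>\<^sub>0. M_D f D r > r" and "\<rho> > \<rho>\<^sub>0"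
  shows "closure U \<subseteq> A_set f D \<rho>
    \<and> (\<exists>N::nat. \<exists>\<rho>'>0.
          (\<forall>n\<ge>N. fatou_comp_iter f U n \<subseteq> fill (fatou_comp_iter f U (Suc n)) \<and>
                  closure (fatou_comp_iter f U n) \<subseteq> A_rho f D \<rho>') \<and>
          (\<forall>n\<ge>N. closure (fatou_comp_iter f U n) \<subseteq> D))
    \<and> (\<forall>D' R'. direct_tract f D' R' \<longrightarrow> D' \<inter> D \<noteq> {})
    \<and> (\<forall>C \<in> components (- D). bounded C)
    \<and> (\<exists>K :: nat \<Rightarrow> complex set. inj K \<and> disjoint_family K \<and>
          (\<forall>i. compact (K i) \<and> connected (K i) \<and> \<not> (\<exists>a. K i \<subseteq> {a}) \<and>
               K i \<subseteq> A_set f D \<rho> \<inter> julia f))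
    \<and> (\<exists>!C. C \<in> components (A_set f D \<rho>) \<and> \<not> bounded C)
    \<and> (\<exists>!C. C \<in> components (Zset f) \<and> \<not> bounded C)
    \<and> (\<exists>!C. C \<in> components (escaping f) \<and> \<not> bounded C)"
proof -
  interpret baker f U using assms by unfold_locales
  obtain N where "wandering_tract f D R (\<lambda>n. V (n + N))"
    using tail_wandering_tract[OF assms(2)] by blast
  then interpret W: wandering_tract f D R "\<lambda>n. V (n + N)" .
  have gt: "M_D f D r > r" if "r > \<rho>\<^sub>0" for r using assms(5) that by blast
  obtain M where M: "\<And>n. n \<ge> M \<Longrightarrow> W.itin n \<subseteq> A_rho f D \<rho>"
    "\<And>n z. n \<ge> M \<Longrightarrow> z \<in> W.itin n \<Longrightarrow> filterlim (\<lambda>n. norm ((f ^^ n) z)) at_top sequentially"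
    "\<And>n z. n \<ge> M \<Longrightarrow> z \<in> W.itin n \<Longrightarrow> filterlim (\<lambda>n. ln (ln (norm ((f ^^ n) z))) / real n) at_top sequentially"
    using W.itin_fast[OF gt assms(6)] by blast
  have not_pole: "\<not> is_pole f z" if "z \<in> D" for z
    using assms(2) that closure_subset[of D] by (auto simp: direct_tract_def)
  have A_sub: "A_rho f D \<rho> \<subseteq> A_set f D \<rho>"
  proof
    fix z assume "z \<in> A_rho f D \<rho>"
    then have "(f ^^ 0) z \<in> A_rho f D \<rho>" by simp
    then show "z \<in> A_set f D \<rho>" unfolding A_set_def by blast
  qed
  have esc: "W.itin n \<subseteq> escaping f" if n: "n \<ge> M" for n
  proof
    fix z assume z: "z \<in> W.itin n"
    then have "iterates_defined f z" using not_pole by (simp add: W.itin_def iterates_defined_def)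
    then show "z \<in> escaping f" using M(2)[OF n z] by (simp add: escaping_def)
  qed
  have Z: "W.itin n \<subseteq> Zset f" if "n \<ge> M" for n
    using esc[OF that] M(3)[OF that] by (auto simp: Zset_def)
  \<comment> \<open>\<open>N\<close> undoes the shift to the tail; the \<open>Suc\<close> is the lag
    by which the closure of the domain with index \<open>n + 1\<close> lies in
    \<open>itin n\<close>.\<close>
  define N1 where "N1 = Suc M + N"
  have closure_itin: "closure (V n) \<subseteq> W.itin (n - Suc N)" if "n \<ge> N1" for n
  proof -
    have "n = Suc (n - Suc N) + N" using that by (simp add: N1_def)
    then show ?thesis using W.closure_U_subset_itin[of "n - Suc N"] by simp
  qed
  have closure_A: "closure (V n) \<subseteq> A_rho f D \<rho>" if "n \<ge> N1" for n
  proof -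
    have "n - Suc N \<ge> M" using that by (simp add: N1_def)
    then show ?thesis using closure_itin[OF that] M(1) by blast
  qed
  have ev: "eventually (\<lambda>n. V n \<subseteq> A) sequentially" if "\<And>n. n \<ge> N1 \<Longrightarrow> closure (V n) \<subseteq> A" for A
    unfolding eventually_sequentially using that closure_subset by (meson order_trans)
  have V_esc: "closure (V n) \<subseteq> escaping f" "closure (V n) \<subseteq> Zset f" if n: "n \<ge> N1" for n
  proof -
    have m: "n - Suc N \<ge> M" using n by (simp add: N1_def)
    show "closure (V n) \<subseteq> escaping f" by (rule order_trans[OF closure_itin[OF n] esc[OF m]])
    show "closure (V n) \<subseteq> Zset f" by (rule order_trans[OF closure_itin[OF n] Z[OF m]])
  qed
  obtain z0 where "z0 \<in> V (Suc M + N)" using V_nonempty by blast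
  then have z0: "z0 \<in> W.itin M" using W.closure_U_subset_itin[of M] closure_subset by blast
  \<comment> \<open>One unbounded connected set serves the claims on
    \<open>A_set f D \<rho>\<close>, \<open>Zset f\<close> and \<open>escaping f\<close>, since
    \<open>itin M\<close> lies in all three.\<close>
  define S where "S = connected_component_set (W.itin M) z0"
  have S: "connected S" "\<not> bounded S" "S \<subseteq> W.itin M"
    using W.unbounded_component_itin[OF z0] by (auto simp: S_def connected_component_subset)
  have "closure U \<subseteq> A_set f D \<rho>"
  proof
    fix z assume "z \<in> closure U"
    \<comment> \<open>Closures are mapped into closures for every index, so the orbit enters the
      closure of \<open>V N1\<close> even if earlier components leave \<open>D\<close>.\<close>
    then have "(f ^^ N1) z \<in> A_rho f D \<rho>" using iterate_closure_V closure_A[of N1] by blast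
    then show "z \<in> A_set f D \<rho>" unfolding A_set_def by blast
  qed
  moreover have "\<exists>N::nat. \<exists>\<rho>'>0. (\<forall>n\<ge>N. V n \<subseteq> fill (V (Suc n)) \<and> closure (V n) \<subseteq> A_rho f D \<rho>') \<and>
      (\<forall>n\<ge>N. closure (V n) \<subseteq> D)"
  proof (intro exI[of _ N1] exI[of _ \<rho>] conjI allI impI)
    show "\<rho> > 0" using W.R_pos assms(4,6) by linarith
    fix n assume n: "n \<ge> N1"
    then have "n = (n - N) + N" by (simp add: N1_def)
    then show "V n \<subseteq> fill (V (Suc n))"
      using W.fill_U_mono[of "n - N"] subset_fill[of "V n"] by auto
    show "closure (V n) \<subseteq> A_rho f D \<rho>" by (rule closure_A[OF n])
    then show "closure (V n) \<subseteq> D" by (auto simp: A_rho_def)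
  qed
  moreover have "D' \<inter> D \<noteq> {}" if "direct_tract f D' R'" for D' R'
  proof -
    have "eventually (\<lambda>n. (closure (V n) \<subseteq> D' \<and> (\<forall>z\<in>V n. norm z > R')) \<and>
        (closure (V n) \<subseteq> D \<and> (\<forall>z\<in>V n. norm z > R))) sequentially"
      by (intro eventually_conj V_eventually_in_tract that assms(2))
    then obtain n where "closure (V n) \<subseteq> D'" "closure (V n) \<subseteq> D"
      using eventually_happens'[OF sequentially_bot] by blast
    then show ?thesis using V_nonempty[of n] closure_subset[of "V n"] by blast
  qed
  moreover have "bounded C" if C: "C \<in> components (- D)" for C
  proof (rule ccontr)
    assume "\<not> bounded C"
    then have "eventually (\<lambda>n. C \<inter> V n \<noteq> {} \<and> (closure (V n) \<subseteq> D \<and> (\<forall>z\<in>V n. norm z > R))) sequentially"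
      using C in_components_connected by (intro eventually_conj V_eventually_meets V_eventually_in_tract assms(2)) auto
    then obtain n where "C \<inter> V n \<noteq> {}" "closure (V n) \<subseteq> D"
      using eventually_happens'[OF sequentially_bot] by blast
    then show False using in_components_subset[OF C] closure_subset[of "V n"] by blast
  qed
  moreover have "\<exists>K :: nat \<Rightarrow> complex set. inj K \<and> disjoint_family K \<and>
          (\<forall>i. compact (K i) \<and> connected (K i) \<and> \<not> (\<exists>a. K i \<subseteq> {a}) \<and> K i \<subseteq> A_set f D \<rho> \<inter> julia f)"
  proof -
    \<comment> \<open>The factor 2 in the index makes the closures, and with them the continua,
      pairwise disjoint.\<close>
    have "\<forall>i. \<exists>K. compact K \<and> connected K \<and> \<not> (\<exists>a. K \<subseteq> {a}) \<and> K \<subseteq> frontier (V (2 * i + Suc M + N))"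
    proof
      fix i
      obtain K where "compact K" "connected K" "\<nexists>a. K \<subseteq> {a}" "K \<subseteq> frontier (V (2 * i + Suc M + N))"
        using W.frontier_continuum[of "2 * i + Suc M"] by blast
      then show "\<exists>K. compact K \<and> connected K \<and> \<not> (\<exists>a. K \<subseteq> {a}) \<and> K \<subseteq> frontier (V (2 * i + Suc M + N))"
        by blast
    qed
    from choice[OF this] obtain K where K: "\<And>i. compact (K i)" "\<And>i. connected (K i)"
      "\<And>i. \<not> (\<exists>a. K i \<subseteq> {a})" "\<And>i. K i \<subseteq> frontier (V (2 * i + Suc M + N))"
      by blast
    have disj: "K i \<inter> K j = {}" if "i < j" for i j
    proof -
      have "closure (V (2 * i + Suc M + N)) \<inter> closure (V (2 * j + Suc M + N)) = {}"
        using W.closures_disjoint[of "2 * i + Suc M" "2 * j + Suc M"] that by simp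
      then show ?thesis using K(4)[of i] K(4)[of j] by (auto simp: frontier_def)
    qed
    then have disj': "K i \<inter> K j = {}" if "i \<noteq> j" for i j
      using that by (metis Int_commute linorder_neqE_nat)
    have "K i \<noteq> {}" for i using K(3)[of i] by auto
    then have "inj K" using disj' unfolding inj_def by (metis Int_absorb)
    moreover have "disjoint_family K" using disj' by (simp add: disjoint_family_on_def)
    moreover have "K i \<subseteq> A_set f D \<rho> \<inter> julia f" for i
    proof
      fix z assume z: "z \<in> K i"
      have "z \<in> closure (V (2 * i + Suc M + N))" using K(4) z by (auto simp: frontier_def)
      then have "z \<in> A_set f D \<rho>" using closure_A[of "2 * i + Suc M + N"] A_sub by (auto simp: N1_def)
      moreover have "z \<in> julia f" using frontier_component_julia[OF V_component] K(4) z by blast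
      ultimately show "z \<in> A_set f D \<rho> \<inter> julia f" by blast
    qed
    ultimately show ?thesis using K(1-3) by blast
  qed
  moreover have "\<exists>!C. C \<in> components (A_set f D \<rho>) \<and> \<not> bounded C"
  proof (rule unique_unbounded_component[OF S(1,2)])
    show "S \<subseteq> A_set f D \<rho>" by (rule order_trans[OF S(3) order_trans[OF M(1)[OF order_refl] A_sub]])
    show "eventually (\<lambda>n. V n \<subseteq> A_set f D \<rho>) sequentially"
      by (rule ev) (rule order_trans[OF closure_A A_sub])
  qed
  moreover have "\<exists>!C. C \<in> components (Zset f) \<and> \<not> bounded C"
    by (rule unique_unbounded_component[OF S(1,2) order_trans[OF S(3) Z[OF order_refl]] ev[OF V_esc(2)]])
  moreover have "\<exists>!C. C \<in> components (escaping f) \<and> \<not> bounded C"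
    by (rule unique_unbounded_component[OF S(1,2) order_trans[OF S(3) esc[OF order_refl]] ev[OF V_esc(1)]])
  ultimately show ?thesis by (intro conjI allI impI ballI)
qed

end
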